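(* Let $Y$ be a Banach sequence lattice with associated Köthe space $Y^{\times}$, let $X$ be a Banach lattice and $E$ a Banach space. (i) Let $T:E\to X$ be a continuous linear operator. Then $T$ is $Y$-convex if and only if the transpose operator $T^{*}:X^{*}\to E^{*}$ is $Y^{\times}$-concave. In this case, $\|T\|_{\mathcal{K}^{Y}}=\|T^{*}\|_{\mathcal{K}_{Y^{\times}}}$. (ii) Let $S:X\to E$ be a continuous linear operator. Then $S$ is $Y$-concave if and only if the transpose operator $S^{*}:E^{*}\to X^{*}$ is $Y^{\times}$-convex. In this case, $\|S^{*}\|_{\mathcal{K}^{Y^{\times}}}=\|S\|_{\mathcal{K}_{Y}}$.
   Context: All vector spaces are real. A Banach sequence lattice is a linear subspace $Y\subset\mathbb{R}^{\mathbb{N}}$ containing all canonical sequences $e_n$, with a complete norm $\|\cdot\|_Y$ such that if $f\in\mathbb{R}^{\mathbb{N}}$, $g\in Y$ and $|f|\le|g|$ pointwise, then $f\in Y$ and $\|f\|_Y\le\|g\|_Y$. A finite tuple $(t_1,\dots,t_n)\in\mathbb{R}^n$ is identified with $(t_1,\dots,t_n,0,0,\dots)\in Y$. Associated Köthe space: $Y^{\times}:=\{(\beta_n)\in\mathbb{R}^{\mathbb{N}}:\sum_n|\alpha_n\beta_n|<\infty\ \forall(\alpha_n)\in Y\}$ with norm $\|(\beta_n)\|_{Y^{\times}}:=\sup\{\sum_n|\alpha_n\beta_n|:\|(\alpha_n)\|_Y\le1\}$; it is again a Banach sequence lattice. Krivine's functional calculus: let $\mathcal{H}_n$ be the space of continuous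 $h:\mathbb{R}^n\to\mathbb{R}$ with $h(\lambda t)=\lambda h(t)$ for $\lambda\ge0$, with the pointwise order. For a Banach lattice $X$ and $x=(x_1,\dots,x_n)\in X^n$ there is a unique linear map $\tau_{n,x}:\mathcal{H}_n\to X$ with $\tau_{n,x}(\pi_{n,j})=x_j$ for each coordinate projection $\pi_{n,j}$ and $\tau_{n,x}(h_1\vee h_2)=\tau_{n,x}(h_1)\vee\tau_{n,x}(h_2)$. For a Banach sequence lattice $Y$ write $\|(x_1,\dots,x_n)\|_Y:=\tau_{n,x}\big(t\mapsto\|(t_1,\dots,t_n)\|_Y\big)\in X$ and $\|(x_1,\dots,x_n)\|_{X^n,Y,\tau}:=\big\|\,\|(x_1,\dots,x_n)\|_Y\big\|_X\in\mathbb{R}$. For a Banach space $E$ write $\|(w_1,\dots,w_n)\|_{E^n,Y}:=\|(\|w_1\|_E,\dots,\|w_n\|_E)\|_Y$. A linear operator $T:E\to X$ is $Y$-convex if there is a constant $C>0$ with $\|(Tw_1,\dots,Tw_n)\|_{X^n,Y,\tau}\le C\|(w_1,\dots,w_n)\|_{E^n,Y}$ for all $n\in\mathbb{N}$, $w_1,\dots,w_n\in E$; the smallest such constant (infimum of all such $C$) is $\|T\|_{\mathcal{K}^Y}$. A linear operator $S:X\to E$ is $Y$-concave if there is $K>0$ with $\|(Sx_1,\dots,Sx_n)\|_{E^n,Y}\le K\|(x_1,\dots,x_n)\|_{X^n,Y,\tau}$ for all $n\in\mathbb{N}$, $x_1,\dots,x_n\in X$; the smallest such constant (infimum) is $\|S\|_{\mathcal{K}_Y}$.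 The same definitions are used with $Y^{\times}$ in place of $Y$. The dual $X^{*}$ of a Banach lattice is a Banach lattice with order $\varphi_1\le\varphi_2$ iff $\varphi_1(x)\le\varphi_2(x)$ for all $x\ge0$. *)

theory Defs
  imports "HOL-Analysis.Analysis" "HOL-Library.Lattice_Algebras" "HOL-Library.FuncSet"
begin

section \<open>Banach lattices\<close>

class banach_lattice = banach + ordered_real_vector + lattice_ab_group_add_abs +
  assumes norm_mono_abs: "\<bar>x\<bar> \<le> \<bar>y\<bar> \<Longrightarrow> norm x \<le> norm y"

section \<open>The topological dual\<close>

text \<open>A copy of the space of bounded linear functionals. The order on the dual makes sense for
  real-valued functionals only, so it cannot be declared as a type class instance of
  \<^type>\<open>blinfun\<close> itself.\<close>

typedef (overloaded) 'a dual = "UNIV :: ('a::real_normed_vector \<Rightarrow>\<^sub>L real) set"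
  morphisms functional Dual
  by simp

setup_lifting type_definition_dual

instantiation dual :: (real_normed_vector) real_normed_vector
begin

lift_definition zero_dual :: "'a dual" is 0 .
lift_definition plus_dual :: "'a dual \<Rightarrow> 'a dual \<Rightarrow> 'a dual" is "(+)" .
lift_definition minus_dual :: "'a dual \<Rightarrow> 'a dual \<Rightarrow> 'a dual" is "(-)" .
lift_definition uminus_dual :: "'a dual \<Rightarrow> 'a dual" is "uminus" .
lift_definition scaleR_dual :: "real \<Rightarrow> 'a dual \<Rightarrow> 'a dual" is "(*\<^sub>R)" .
lift_definition norm_dual :: "'a dual \<Rightarrow> real" is norm .

definition dist_dual :: "'a dual \<Rightarrow> 'a dual \<Rightarrow> real" where
  "dist_dual a b = norm (a - b)"

definition sgn_dual :: "'a dual \<Rightarrow> 'a dual" where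
  "sgn_dual a = scaleR (inverse (norm a)) a"

definition uniformity_dual :: "('a dual \<times> 'a dual) filter" where
  "uniformity_dual = (INF e\<in>{0<..}. principal {(x, y). dist x y < e})"

definition open_dual :: "'a dual set \<Rightarrow> bool" where
  "open_dual U = (\<forall>x\<in>U. \<forall>\<^sub>F (x', y) in uniformity. x' = x \<longrightarrow> y \<in> U)"

instance
  by standard
    (simp_all add: dist_dual_def sgn_dual_def uniformity_dual_def open_dual_def,
      (transfer, simp add: algebra_simps norm_triangle_ineq)+)

end

lemmas functional_simps =
  plus_dual.rep_eq minus_dual.rep_eq uminus_dual.rep_eq scaleR_dual.rep_eq zero_dual.rep_eq
  norm_dual.rep_eq[symmetric]

lemma dist_functional: "dist (functional a) (functional b) = dist a b"
  by (simp add: dist_dual_def dist_norm norm_dual.rep_eq minus_dual.rep_eq)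

instance dual :: (real_normed_vector) banach
proof
  fix f :: "nat \<Rightarrow> 'a dual"
  assume "Cauchy f"
  hence "Cauchy (\<lambda>n. functional (f n))"
    by (simp add: Cauchy_def dist_functional)
  then obtain l where "(\<lambda>n. functional (f n)) \<longlonglongrightarrow> l"
    using Cauchy_convergent convergent_def by blast
  hence "f \<longlonglongrightarrow> Dual l"
    by (simp add: tendsto_iff flip: dist_functional) (simp add: Dual_inverse)
  thus "convergent f"
    by (auto simp: convergent_def)
qed

definition transpose_op ::
    "('a::real_normed_vector \<Rightarrow>\<^sub>L 'b::real_normed_vector) \<Rightarrow> 'b dual \<Rightarrow> 'a dual" where
  "transpose_op T \<phi> = Dual (functional \<phi> o\<^sub>L T)"

section \<open>The dual of a Banach lattice is a Banach lattice\<close>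

definition pos_val :: "('a::banach_lattice \<Rightarrow>\<^sub>L real) \<Rightarrow> 'a \<Rightarrow> real" where
  "pos_val \<phi> x = (SUP y\<in>{0..x}. \<phi> y)"

lemma norm_mono_pos:
  fixes x y :: "'a::banach_lattice"
  assumes "0 \<le> x" "x \<le> y"
  shows "norm x \<le> norm y"
  using assms by (intro norm_mono_abs) (simp add: order.trans[OF assms])

lemma norm_abs_lattice: "norm \<bar>x\<bar> = norm (x::'a::banach_lattice)"
  by (intro antisym norm_mono_abs) simp_all

lemma functional_le_norm:
  fixes \<phi> :: "'a::banach_lattice \<Rightarrow>\<^sub>L real"
  assumes "0 \<le> y" "y \<le> x"
  shows "\<phi> y \<le> norm \<phi> * norm x"
proof -
  have "\<phi> y \<le> norm \<phi> * norm y"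
    using norm_blinfun[of \<phi> y] by simp
  also have "\<dots> \<le> norm \<phi> * norm x"
    by (intro mult_left_mono norm_mono_pos assms) simp
  finally show ?thesis .
qed

lemma bdd_above_pos_val:
  fixes \<phi> :: "'a::banach_lattice \<Rightarrow>\<^sub>L real"
  shows "bdd_above (\<phi> ` {0..x})"
  using functional_le_norm[of _ x \<phi>] by (auto intro!: bdd_aboveI2)

lemma pos_val_upper:
  fixes \<phi> :: "'a::banach_lattice \<Rightarrow>\<^sub>L real"
  shows "0 \<le> y \<Longrightarrow> y \<le> x \<Longrightarrow> \<phi> y \<le> pos_val \<phi> x"
  unfolding pos_val_def by (rule cSUP_upper[OF _ bdd_above_pos_val]) simp

lemma pos_val_least:
  fixes \<phi> :: "'a::banach_lattice \<Rightarrow>\<^sub>L real"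
  assumes "0 \<le> x" "\<And>y. 0 \<le> y \<Longrightarrow> y \<le> x \<Longrightarrow> \<phi> y \<le> c"
  shows "pos_val \<phi> x \<le> c"
  unfolding pos_val_def using assms by (intro cSUP_least) auto

lemma pos_val_nonneg: "0 \<le> x \<Longrightarrow> 0 \<le> pos_val \<phi> x"
  using pos_val_upper[of 0 x \<phi>] by (simp add: blinfun.zero_right)

lemma pos_val_add:
  assumes x: "0 \<le> x" and y: "0 \<le> y"
  shows "pos_val \<phi> (x + y) = pos_val \<phi> x + pos_val \<phi> y"
proof (rule antisym)
  show "pos_val \<phi> (x + y) \<le> pos_val \<phi> x + pos_val \<phi> y"
  proof (rule pos_val_least)
    fix z assume z: "0 \<le> z" "z \<le> x + y"
    have eq: "z - inf z x = sup 0 (z - x)"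
      using diff_inf_eq_sup[of z z x] by (simp add: add_sup_distrib_left)
    have "0 \<le> z - inf z x" "z - inf z x \<le> y"
      unfolding eq using z y by (simp_all add: algebra_simps)
    hence "\<phi> (z - inf z x) \<le> pos_val \<phi> y"
      by (rule pos_val_upper)
    moreover have "\<phi> (inf z x) \<le> pos_val \<phi> x"
      using z x by (intro pos_val_upper) auto
    ultimately show "\<phi> z \<le> pos_val \<phi> x + pos_val \<phi> y"
      unfolding blinfun.diff_right by linarith
  qed (use x y in simp)
  have "pos_val \<phi> x \<le> pos_val \<phi> (x + y) - pos_val \<phi> y"
  proof (rule pos_val_least[OF x])
    fix u assume u: "0 \<le> u" "u \<le> x"
    have "pos_val \<phi> y \<le> pos_val \<phi> (x + y) - \<phi> u"
    proof (rule pos_val_least[OF y])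
      fix v assume v: "0 \<le> v" "v \<le> y"
      have "\<phi> (u + v) \<le> pos_val \<phi> (x + y)"
        using u v by (intro pos_val_upper add_nonneg_nonneg add_mono)
      thus "\<phi> v \<le> pos_val \<phi> (x + y) - \<phi> u"
        by (simp add: blinfun.add_right)
    qed
    thus "\<phi> u \<le> pos_val \<phi> (x + y) - pos_val \<phi> y" by simp
  qed
  thus "pos_val \<phi> x + pos_val \<phi> y \<le> pos_val \<phi> (x + y)" by simp
qed

lemma pos_val_scaleR_le:
  assumes x: "0 \<le> x" and c: "0 < c"
  shows "pos_val \<phi> (c *\<^sub>R x) \<le> c * pos_val \<phi> x"
proof (rule pos_val_least)
  fix y assume y: "0 \<le> y" "y \<le> c *\<^sub>R x"
  have "inverse c *\<^sub>R y \<le> inverse c *\<^sub>R (c *\<^sub>R x)"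
    using c y by (intro scaleR_left_mono) simp_all
  hence "\<phi> (inverse c *\<^sub>R y) \<le> pos_val \<phi> x"
    using c y by (intro pos_val_upper) (simp_all add: scaleR_nonneg_nonneg)
  thus "\<phi> y \<le> c * pos_val \<phi> x"
    using c by (simp add: blinfun.scaleR_right field_simps)
qed (use x c in \<open>simp add: scaleR_nonneg_nonneg\<close>)

lemma pos_val_scaleR:
  assumes x: "0 \<le> x" and c: "0 \<le> c"
  shows "pos_val \<phi> (c *\<^sub>R x) = c * pos_val \<phi> x"
proof (cases "c = 0")
  case True
  thus ?thesis by (simp add: pos_val_def blinfun.zero_right)
next
  case False
  hence c: "0 < c" using c by simp
  have "pos_val \<phi> (inverse c *\<^sub>R (c *\<^sub>R x)) \<le> inverse c * pos_val \<phi> (c *\<^sub>R x)"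
    using x c by (intro pos_val_scaleR_le) (simp_all add: scaleR_nonneg_nonneg)
  hence "c * pos_val \<phi> x \<le> pos_val \<phi> (c *\<^sub>R x)"
    using c by (simp add: field_simps)
  with pos_val_scaleR_le[OF x c, of \<phi>] show ?thesis by simp
qed

definition pos_fun :: "('a::banach_lattice \<Rightarrow>\<^sub>L real) \<Rightarrow> 'a \<Rightarrow> real" where
  "pos_fun \<phi> x = pos_val \<phi> (pprt x) - pos_val \<phi> (- nprt x)"

lemma pos_fun_diff:
  assumes "0 \<le> u" "0 \<le> v"
  shows "pos_fun \<phi> (u - v) = pos_val \<phi> u - pos_val \<phi> v"
proof -
  have "pprt (u - v) + v = u + - nprt (u - v)"
    using prts[of "u - v"] by (simp add: algebra_simps)
  hence "pos_val \<phi> (pprt (u - v)) + pos_val \<phi> v = pos_val \<phi> u + pos_val \<phi> (- nprt (u - v))"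
    using assms by (simp flip: pos_val_add)
  thus ?thesis by (simp add: pos_fun_def)
qed

lemma pos_fun_nonneg: "0 \<le> x \<Longrightarrow> pos_fun \<phi> x = pos_val \<phi> x"
  using pos_fun_diff[of x 0 \<phi>] pos_val_scaleR[of x 0 \<phi>] by simp

lemma bounded_linear_pos_fun: "bounded_linear (pos_fun \<phi>)"
proof (rule bounded_linear_intro)
  have dec: "x = pprt x - (- nprt x)" for x :: 'a
    using prts[of x] by simp
  show "pos_fun \<phi> (x + y) = pos_fun \<phi> x + pos_fun \<phi> y" for x y
  proof -
    have "x + y = (pprt x + pprt y) - (- nprt x + - nprt y)"
      using dec[of x] dec[of y] by (metis add_diff_add)
    hence "pos_fun \<phi> (x + y) = pos_val \<phi> (pprt x + pprt y) - pos_val \<phi> (- nprt x + - nprt y)"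
      using pos_fun_diff[of "pprt x + pprt y" "- nprt x + - nprt y" \<phi>]
      by (metis add_nonneg_nonneg neg_0_le_iff_le nprt_le_zero zero_le_pprt)
    also have "\<dots> = pos_fun \<phi> x + pos_fun \<phi> y"
      unfolding pos_fun_def
      using pos_val_add[of "pprt x" "pprt y" \<phi>] pos_val_add[of "- nprt x" "- nprt y" \<phi>]
      by simp
    finally show ?thesis .
  qed
  show "pos_fun \<phi> (c *\<^sub>R x) = c *\<^sub>R pos_fun \<phi> x" for c x
  proof (cases "0 \<le> c")
    case True
    have "c *\<^sub>R x = c *\<^sub>R pprt x - c *\<^sub>R (- nprt x)"
      using dec[of x] by (metis scaleR_diff_right)
    hence "pos_fun \<phi> (c *\<^sub>R x) = pos_val \<phi> (c *\<^sub>R pprt x) - pos_val \<phi> (c *\<^sub>R (- nprt x))"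
      using pos_fun_diff[of "c *\<^sub>R pprt x" "c *\<^sub>R (- nprt x)" \<phi>] True
      by (metis neg_0_le_iff_le nprt_le_zero scaleR_nonneg_nonneg zero_le_pprt)
    thus ?thesis
      using True pos_val_scaleR[of "- nprt x" c \<phi>] pos_val_scaleR[of "pprt x" c \<phi>]
      by (simp add: pos_fun_def algebra_simps)
  next
    case False
    have "c *\<^sub>R x = (- c) *\<^sub>R (- nprt x) - (- c) *\<^sub>R pprt x"
      using dec[of x] by (metis (no_types) minus_diff_eq scaleR_diff_right scaleR_minus_left scaleR_minus_right)
    hence "pos_fun \<phi> (c *\<^sub>R x) = pos_val \<phi> ((- c) *\<^sub>R (- nprt x)) - pos_val \<phi> ((- c) *\<^sub>R pprt x)"
      using pos_fun_diff[of "(- c) *\<^sub>R (- nprt x)" "(- c) *\<^sub>R pprt x" \<phi>] False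
      by (metis le_minus_iff linorder_le_cases minus_zero neg_0_le_iff_le nprt_le_zero
          scaleR_nonneg_nonneg zero_le_pprt)
    thus ?thesis
      using False pos_val_scaleR[of "- nprt x" "- c" \<phi>] pos_val_scaleR[of "pprt x" "- c" \<phi>]
      by (simp add: pos_fun_def algebra_simps)
  qed
  show "norm (pos_fun \<phi> x) \<le> norm x * norm \<phi>" for x
  proof -
    have le: "pos_val \<phi> u \<le> norm \<phi> * norm x" if "0 \<le> u" "u \<le> \<bar>x\<bar>" for u
      using functional_le_norm[of _ "\<bar>x\<bar>" \<phi>] that
      by (intro pos_val_least) (auto simp: norm_abs_lattice intro: order.trans)
    have "pos_val \<phi> (pprt x) \<le> norm \<phi> * norm x" "pos_val \<phi> (- nprt x) \<le> norm \<phi> * norm x"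
      by (intro le; simp add: abs_prts)+
    moreover have "0 \<le> pos_val \<phi> (pprt x)" "0 \<le> pos_val \<phi> (- nprt x)"
      by (simp_all add: pos_val_nonneg)
    ultimately show ?thesis
      by (simp add: pos_fun_def abs_le_iff mult.commute)
  qed
qed

text \<open>The order is the pointwise order on the positive cone; suprema are given by the
  Riesz-Kantorovich formula $\varphi^+(x) = \sup_{0 \le y \le x} \varphi(y)$ for $x \ge 0$.\<close>

instantiation dual :: (banach_lattice) banach_lattice
begin

lift_definition less_eq_dual :: "'a dual \<Rightarrow> 'a dual \<Rightarrow> bool" is
  "\<lambda>\<phi> \<psi>. \<forall>x\<ge>0. blinfun_apply \<phi> x \<le> blinfun_apply \<psi> x" .

definition less_dual :: "'a dual \<Rightarrow> 'a dual \<Rightarrow> bool" where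
  "less_dual a b \<longleftrightarrow> a \<le> b \<and> \<not> b \<le> a"

lift_definition sup_dual :: "'a dual \<Rightarrow> 'a dual \<Rightarrow> 'a dual" is
  "\<lambda>\<phi> \<psi>. \<psi> + Blinfun (pos_fun (\<phi> - \<psi>))" .

definition inf_dual :: "'a dual \<Rightarrow> 'a dual \<Rightarrow> 'a dual" where
  "inf_dual a b = - sup (- a) (- b)"

definition abs_dual :: "'a dual \<Rightarrow> 'a dual" where
  "abs_dual a = sup a (- a)"

instance
proof
  fix a b c :: "'a dual" and r s :: real
  show "a < b \<longleftrightarrow> a \<le> b \<and> \<not> b \<le> a"
    by (rule less_dual_def)
  show "a \<le> a" by transfer simp
  show "a \<le> b \<Longrightarrow> b \<le> c \<Longrightarrow> a \<le> c" by transfer (meson order.trans)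
  show "a = b" if "a \<le> b" "b \<le> a"
    using that
  proof transfer
    fix \<phi> \<psi> :: "'a \<Rightarrow>\<^sub>L real"
    assume "\<forall>x\<ge>0. \<phi> x \<le> \<psi> x" "\<forall>x\<ge>0. \<psi> x \<le> \<phi> x"
    hence eq: "\<phi> x = \<psi> x" if "0 \<le> x" for x
      using that by (simp add: antisym)
    have "\<phi> x = \<psi> x" for x
      using eq[of "pprt x"] eq[of "- nprt x"] arg_cong[OF prts[of x], of \<phi>]
        arg_cong[OF prts[of x], of \<psi>]
      by (simp add: blinfun.minus_right blinfun.add_right)
    thus "\<phi> = \<psi>" by (rule blinfun_eqI)
  qed
  show "a \<le> b \<Longrightarrow> c + a \<le> c + b"
    by transfer (simp add: blinfun.add_left)
  show "a \<le> b \<Longrightarrow> 0 \<le> r \<Longrightarrow> r *\<^sub>R a \<le> r *\<^sub>R b"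
    by transfer (simp add: blinfun.scaleR_left mult_left_mono)
  show "r \<le> s \<Longrightarrow> 0 \<le> a \<Longrightarrow> r *\<^sub>R a \<le> s *\<^sub>R a"
    by transfer (simp add: blinfun.scaleR_left mult_right_mono)
  have neg: "- x \<le> - y \<longleftrightarrow> y \<le> x" for x y :: "'a dual"
    by transfer (simp add: blinfun.minus_left)
  have neg2: "- (- x) = x" for x :: "'a dual" by simp
  have sup1: "x \<le> sup x y" for x y :: "'a dual"
  proof transfer
    fix \<phi> \<psi> :: "'a \<Rightarrow>\<^sub>L real"
    show "\<forall>x\<ge>0. \<phi> x \<le> (\<psi> + Blinfun (pos_fun (\<phi> - \<psi>))) x"
      using pos_val_upper[of _ _ "\<phi> - \<psi>"]
      by (simp add: blinfun.add_left bounded_linear_Blinfun_apply bounded_linear_pos_fun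
          pos_fun_nonneg) (metis blinfun.diff_left diff_le_eq add.commute order_refl)
  qed
  have sup2: "y \<le> sup x y" for x y :: "'a dual"
    by transfer (simp add: blinfun.add_left bounded_linear_Blinfun_apply bounded_linear_pos_fun
        pos_fun_nonneg pos_val_nonneg)
  have sup3: "sup x y \<le> z" if "x \<le> z" "y \<le> z" for x y z :: "'a dual"
    using that
  proof transfer
    fix \<phi> \<psi> \<theta> :: "'a \<Rightarrow>\<^sub>L real"
    assume le: "\<forall>x\<ge>0. \<phi> x \<le> \<theta> x" "\<forall>x\<ge>0. \<psi> x \<le> \<theta> x"
    show "\<forall>x\<ge>0. (\<psi> + Blinfun (pos_fun (\<phi> - \<psi>))) x \<le> \<theta> x"
    proof (intro allI impI)
      fix x :: 'a assume x: "0 \<le> x"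
      have "pos_val (\<phi> - \<psi>) x \<le> \<theta> x - \<psi> x"
      proof (rule pos_val_least[OF x])
        fix y assume y: "0 \<le> y" "y \<le> x"
        have "\<phi> y \<le> \<theta> y" using le y by simp
        moreover have "\<psi> (x - y) \<le> \<theta> (x - y)" using le y by simp
        ultimately show "(\<phi> - \<psi>) y \<le> \<theta> x - \<psi> x"
          by (simp add: blinfun.diff_left blinfun.diff_right)
      qed
      thus "(\<psi> + Blinfun (pos_fun (\<phi> - \<psi>))) x \<le> \<theta> x"
        using x by (simp add: blinfun.add_left bounded_linear_Blinfun_apply bounded_linear_pos_fun
          pos_fun_nonneg)
    qed
  qed
  show "a \<le> sup a b" by (rule sup1)
  show "b \<le> sup a b" by (rule sup2)
  show "b \<le> a \<Longrightarrow> c \<le> a \<Longrightarrow> sup b c \<le> a" by (rule sup3)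
  show "inf a b \<le> a"
    using sup1[of "- a" "- b"] neg[of "sup (- a) (- b)" "- a"]
    by (simp only: inf_dual_def neg2)
  show "inf a b \<le> b"
    using sup2[of "- b" "- a"] neg[of "sup (- a) (- b)" "- b"]
    by (simp only: inf_dual_def neg2)
  show "a \<le> inf b c" if "a \<le> b" "a \<le> c"
    using sup3[of "- b" "- a" "- c"] that neg[of "- a" "sup (- b) (- c)"]
    by (simp only: inf_dual_def neg2 neg)
  show "\<bar>a\<bar> = sup a (- a)" by (rule abs_dual_def)
  show "norm a \<le> norm b" if ab: "\<bar>a\<bar> \<le> \<bar>b\<bar>"
  proof -
    define \<phi> \<psi> where "\<phi> = functional a" and "\<psi> = functional b"
    have le1: "\<phi> x \<le> functional \<bar>b\<bar> x" "- \<phi> x \<le> functional \<bar>b\<bar> x" if "0 \<le> x" for x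
    proof -
      have "functional a x \<le> functional \<bar>a\<bar> x"
        using sup1[of a "- a"] that by (simp add: abs_dual_def less_eq_dual.rep_eq)
      moreover have "functional (- a) x \<le> functional \<bar>a\<bar> x"
        using sup2[of "- a" a] that by (simp add: abs_dual_def less_eq_dual.rep_eq)
      moreover have "functional \<bar>a\<bar> x \<le> functional \<bar>b\<bar> x"
        using ab that by (simp add: less_eq_dual.rep_eq)
      ultimately show "\<phi> x \<le> functional \<bar>b\<bar> x" "- \<phi> x \<le> functional \<bar>b\<bar> x"
        by (simp_all add: \<phi>_def functional_simps blinfun.minus_left)
    qed
    have le2: "functional \<bar>b\<bar> x \<le> norm \<psi> * norm x" if x: "0 \<le> x" for x
    proof -
      have "functional \<bar>b\<bar> x = - \<psi> x + pos_val (\<psi> - - \<psi>) x"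
        using x by (simp add: abs_dual_def sup_dual.rep_eq uminus_dual.rep_eq \<psi>_def
            blinfun.add_left blinfun.diff_left blinfun.minus_left bounded_linear_Blinfun_apply
            bounded_linear_pos_fun pos_fun_nonneg)
      also have "pos_val (\<psi> - - \<psi>) x \<le> norm \<psi> * norm x + \<psi> x"
      proof (rule pos_val_least[OF x])
        fix y assume y: "0 \<le> y" "y \<le> x"
        have "\<bar>y - (x - y)\<bar> \<le> \<bar>x\<bar>"
        proof -
          have "y - (x - y) \<le> x" "- (y - (x - y)) \<le> x"
            using y by (simp_all add: algebra_simps add_mono)
          thus ?thesis using x by (simp add: abs_leI)
        qed
        hence "norm (y - (x - y)) \<le> norm x" by (rule norm_mono_abs)
        hence "norm \<psi> * norm (y - (x - y)) \<le> norm \<psi> * norm x"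
          by (intro mult_left_mono) simp_all
        moreover have "\<psi> (y - (x - y)) \<le> norm \<psi> * norm (y - (x - y))"
          using norm_blinfun[of \<psi> "y - (x - y)"] by simp
        ultimately show "(\<psi> - - \<psi>) y \<le> norm \<psi> * norm x + \<psi> x"
          by (simp add: blinfun.diff_right blinfun.add_left)
      qed
      finally show ?thesis by simp
    qed
    have "norm \<phi> \<le> norm \<psi>"
    proof (rule norm_blinfun_bound)
      fix x :: 'a
      have "x = pprt x + nprt x" by (rule prts)
      hence "\<phi> x = \<phi> (pprt x) + \<phi> (nprt x)" by (metis blinfun.add_right)
      moreover have "\<phi> (pprt x) \<le> functional \<bar>b\<bar> (pprt x)" "- \<phi> (pprt x) \<le> functional \<bar>b\<bar> (pprt x)"
        using le1[of "pprt x"] by simp_all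
      moreover have "- \<phi> (nprt x) \<le> functional \<bar>b\<bar> (- nprt x)" "\<phi> (nprt x) \<le> functional \<bar>b\<bar> (- nprt x)"
        using le1[of "- nprt x"] by (simp_all add: blinfun.minus_right)
      moreover have "functional \<bar>b\<bar> (pprt x) + functional \<bar>b\<bar> (- nprt x) = functional \<bar>b\<bar> \<bar>x\<bar>"
        by (simp add: abs_prts flip: blinfun.add_right)
      ultimately have "\<bar>\<phi> x\<bar> \<le> functional \<bar>b\<bar> \<bar>x\<bar>" by linarith
      also have "\<dots> \<le> norm \<psi> * norm x"
        using le2[of "\<bar>x\<bar>"] by (simp add: norm_abs_lattice)
      finally show "norm (\<phi> x) \<le> norm \<psi> * norm x" by simp
    qed simp
    thus ?thesis by (simp add: \<phi>_def \<psi>_def functional_simps)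
  qed
qed

end

section \<open>Banach sequence lattices\<close>

text \<open>A space of real sequences with a norm; the values of the norm outside the carrier are
  irrelevant.\<close>

record seq_space =
  seqs :: "(nat \<Rightarrow> real) set"
  seq_norm :: "(nat \<Rightarrow> real) \<Rightarrow> real"

definition banach_seq_lattice :: "seq_space \<Rightarrow> bool" where
  "banach_seq_lattice Y \<longleftrightarrow>
    (\<forall>f\<in>seqs Y. \<forall>g\<in>seqs Y. (\<lambda>k. f k + g k) \<in> seqs Y) \<and>
    (\<forall>c. \<forall>f\<in>seqs Y. (\<lambda>k. c * f k) \<in> seqs Y) \<and>
    (\<forall>n. (\<lambda>k. if k = n then 1 else 0) \<in> seqs Y) \<and>
    (\<forall>f\<in>seqs Y. 0 \<le> seq_norm Y f \<and> (seq_norm Y f = 0 \<longleftrightarrow> f = (\<lambda>k. 0))) \<and>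
    (\<forall>c. \<forall>f\<in>seqs Y. seq_norm Y (\<lambda>k. c * f k) = \<bar>c\<bar> * seq_norm Y f) \<and>
    (\<forall>f\<in>seqs Y. \<forall>g\<in>seqs Y. seq_norm Y (\<lambda>k. f k + g k) \<le> seq_norm Y f + seq_norm Y g) \<and>
    (\<forall>s. (\<forall>i. s i \<in> seqs Y) \<longrightarrow>
      (\<forall>e>0. \<exists>M. \<forall>m\<ge>M. \<forall>n\<ge>M. seq_norm Y (\<lambda>k. s m k - s n k) < e) \<longrightarrow>
      (\<exists>f\<in>seqs Y. (\<lambda>m. seq_norm Y (\<lambda>k. s m k - f k)) \<longlonglongrightarrow> 0)) \<and>
    (\<forall>f. \<forall>g\<in>seqs Y. (\<forall>k. \<bar>f k\<bar> \<le> \<bar>g k\<bar>) \<longrightarrow> f \<in> seqs Y \<and> seq_norm Y f \<le> seq_norm Y g)"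

definition kothe_dual :: "seq_space \<Rightarrow> seq_space" where
  "kothe_dual Y =
    \<lparr>seqs = {b. \<forall>a\<in>seqs Y. summable (\<lambda>n. \<bar>a n * b n\<bar>)},
     seq_norm = (\<lambda>b. SUP a\<in>{a \<in> seqs Y. seq_norm Y a \<le> 1}. \<Sum>n. \<bar>a n * b n\<bar>)\<rparr>"

text \<open>\<open>trunc n t\<close> is the sequence $(t_0, \dots, t_{n-1}, 0, 0, \dots)$; it is how the $n$-tuple of the
  first $n$ entries of \<open>t\<close> is viewed as a sequence.\<close>

definition trunc :: "nat \<Rightarrow> (nat \<Rightarrow> real) \<Rightarrow> nat \<Rightarrow> real" where
  "trunc n t = (\<lambda>k. if k < n then t k else 0)"

section \<open>Krivine's functional calculus\<close>

text \<open>The space $\mathcal{H}_n$. A function on $\mathbb{R}^n$ is represented by the function on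
  \<^typ>\<open>nat \<Rightarrow> real\<close> that reads the first \<open>n\<close> coordinates only. Continuity is with respect to the
  product topology on \<^typ>\<open>nat \<Rightarrow> real\<close>, which for such functions amounts to continuity on
  $\mathbb{R}^n$.\<close>

definition krivine_space :: "nat \<Rightarrow> ((nat \<Rightarrow> real) \<Rightarrow> real) set" where
  "krivine_space n =
    {h. (\<forall>s t. (\<forall>i<n. s i = t i) \<longrightarrow> h s = h t) \<and>
        continuous_on UNIV h \<and>
        (\<forall>c\<ge>0. \<forall>t. h (\<lambda>i. c * t i) = c * h t)}"

text \<open>An \<open>n\<close>-tuple in a set is a sequence of which only the first \<open>n\<close> entries are used. The maps are
  required to be extensional so that a map on \<^term>\<open>krivine_space n\<close> is determined as a HOL function
  by its values there.\<close>

definition is_krivine_calculus ::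
    "nat \<Rightarrow> (nat \<Rightarrow> 'x::banach_lattice) \<Rightarrow> (((nat \<Rightarrow> real) \<Rightarrow> real) \<Rightarrow> 'x) \<Rightarrow> bool" where
  "is_krivine_calculus n x \<tau> \<longleftrightarrow>
    \<tau> \<in> extensional (krivine_space n) \<and>
    (\<forall>h\<in>krivine_space n. \<forall>g\<in>krivine_space n. \<tau> (\<lambda>t. h t + g t) = \<tau> h + \<tau> g) \<and>
    (\<forall>c. \<forall>h\<in>krivine_space n. \<tau> (\<lambda>t. c * h t) = c *\<^sub>R \<tau> h) \<and>
    (\<forall>j<n. \<tau> (\<lambda>t. t j) = x j) \<and>
    (\<forall>h\<in>krivine_space n. \<forall>g\<in>krivine_space n. \<tau> (\<lambda>t. sup (h t) (g t)) = sup (\<tau> h) (\<tau> g))"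

definition krivine_calculus ::
    "nat \<Rightarrow> (nat \<Rightarrow> 'x::banach_lattice) \<Rightarrow> ((nat \<Rightarrow> real) \<Rightarrow> real) \<Rightarrow> 'x" where
  "krivine_calculus n x = (THE \<tau>. is_krivine_calculus n x \<tau>)"

section \<open>Convex and concave operators\<close>

definition lattice_tuple_norm :: "seq_space \<Rightarrow> nat \<Rightarrow> (nat \<Rightarrow> 'x::banach_lattice) \<Rightarrow> real" where
  "lattice_tuple_norm Y n x = norm (krivine_calculus n x (\<lambda>t. seq_norm Y (trunc n t)))"

definition tuple_norm :: "seq_space \<Rightarrow> nat \<Rightarrow> (nat \<Rightarrow> 'e::real_normed_vector) \<Rightarrow> real" where
  "tuple_norm Y n w = seq_norm Y (trunc n (\<lambda>i. norm (w i)))"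

definition convex_consts ::
    "seq_space \<Rightarrow> ('e::real_normed_vector \<Rightarrow> 'x::banach_lattice) \<Rightarrow> real set" where
  "convex_consts Y T =
    {C. C > 0 \<and> (\<forall>n w. lattice_tuple_norm Y n (\<lambda>i. T (w i)) \<le> C * tuple_norm Y n w)}"

definition convex_op ::
    "seq_space \<Rightarrow> ('e::real_normed_vector \<Rightarrow> 'x::banach_lattice) \<Rightarrow> bool" where
  "convex_op Y T \<longleftrightarrow> linear T \<and> convex_consts Y T \<noteq> {}"

definition convexity_const ::
    "seq_space \<Rightarrow> ('e::real_normed_vector \<Rightarrow> 'x::banach_lattice) \<Rightarrow> real" where
  "convexity_const Y T = Inf (convex_consts Y T)"

definition concave_consts ::
    "seq_space \<Rightarrow> ('x::banach_lattice \<Rightarrow> 'e::real_normed_vector) \<Rightarrow> real set" where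
  "concave_consts Y S =
    {K. K > 0 \<and> (\<forall>n x. tuple_norm Y n (\<lambda>i. S (x i)) \<le> K * lattice_tuple_norm Y n x)}"

definition concave_op ::
    "seq_space \<Rightarrow> ('x::banach_lattice \<Rightarrow> 'e::real_normed_vector) \<Rightarrow> bool" where
  "concave_op Y S \<longleftrightarrow> linear S \<and> concave_consts Y S \<noteq> {}"

definition concavity_const ::
    "seq_space \<Rightarrow> ('x::banach_lattice \<Rightarrow> 'e::real_normed_vector) \<Rightarrow> real" where
  "concavity_const Y S = Inf (concave_consts Y S)"

end

(* Only finite tuples matter, so Y enters through the norms N(t) = |(t_1,...,t_n,0,...)|_Y on R^n,
   and the Koethe norm restricted to R^n is the dual norm N' of N. For x in X^n and tuples
   phi from the dual of X write N(x), N'(phi) for the elements given by the Krivine calculus. The theorem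
   follows from the isometric duality of the norms |N(x)| and |N'(phi)| under the pairing
   sum_i phi_i(x_i), together with the elementary analogue for E, because T and its transpose are adjoint for
   these pairings; the admissible constants on both sides then coincide.

   Existence and uniqueness of the calculus: a lattice term that is nonnegative on R^n is
   nonnegative in every vector lattice (by distributivity it is an infimum of suprema of linear
   forms, and Fourier-Motzkin elimination treats each supremum). A partition of unity (u_k) made of
   lattice terms approximates every homogeneous continuous h by sum_k h(a_k) u_k, which is again a
   term. The same partition of unity gives the Hoelder inequality
   sum_i phi_i(x_i) <= N'(phi)(N(x)): up to small errors x_i = sum_k a_k(i) u_k(x) with u_k(x) >= 0
   and N(x) = sum_k N(a_k) u_k(x), while sum_i a_k(i) phi_i <= N(a_k) N'(phi). That the resulting
   norm inequality is sharp on both sides follows from the Hahn-Banach theorem and the fact that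
   N(x) is the supremum of sum_i b_i x_i over N'(b) <= 1. *)
theory Submission
  imports Defs
begin

section \<open>Inequalities between lattice terms\<close>

text \<open>No representation of \<open>X\<close> as a function space is used. Inequalities reach
  \<open>X\<close> only as syntactic lattice terms, and errors are measured against the supremum of
  the moduli of the \<open>x i\<close>, which acts as an order unit. \<open>X\<close> need not be
  order complete, so the supremum formula for N(x) is not a matter of forming a supremum: it holds
  because finitely many linear forms already come uniformly close to N on the unit cube. The
  delicate estimate is the upper bound for the norm of N'(phi). This element is a supremum in the
  dual lattice, and the norms of the members of a set do not control the norm of its supremum. One
  functional of norm at most c that dominates all members at once has to be produced; Hahn-Banach
  yields it for a sublinear functional built from positive parts. Applying (i) to the transpose in
  order to get (ii) would lead to biduals. Instead both parts are read off from the same pairing,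
  each with its own choice of norming tuples. On R^n the roles of N and N' can be exchanged, so
  every fact about N(x) is also available for N'(phi).\<close>

definition lin :: "nat \<Rightarrow> (nat \<Rightarrow> 'v::real_vector) \<Rightarrow> (nat \<Rightarrow> real) \<Rightarrow> 'v" where
  "lin n x a = (\<Sum>i<n. a i *\<^sub>R x i)"

lemma lin_0 [simp]: "lin 0 x a = 0"
  by (simp add: lin_def)

lemma lin_Suc [simp]: "lin (Suc n) x a = lin n x a + a n *\<^sub>R x n"
  by (simp add: lin_def)

lemma lin_cong: "(\<And>i. i < n \<Longrightarrow> a i = b i) \<Longrightarrow> (\<And>i. i < n \<Longrightarrow> x i = y i) \<Longrightarrow> lin n x a = lin n y b"
  by (simp add: lin_def)

lemma lin_add: "lin n x (\<lambda>i. a i + b i) = lin n x a + lin n x b"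
  by (simp add: lin_def scaleR_left_distrib sum.distrib)

lemma lin_scale: "lin n x (\<lambda>i. c * a i) = c *\<^sub>R lin n x a"
  by (simp add: lin_def scaleR_sum_right)

lemma lin_zero: "lin n x (\<lambda>i. 0) = 0"
  by (simp add: lin_def)

lemma lin_uminus: "lin n x (\<lambda>i. - a i) = - lin n x a"
  by (simp add: lin_def sum_negf)

lemma lin_unit: "i < n \<Longrightarrow> lin n x (\<lambda>j. if j = i then 1 else 0) = x i"
  by (simp add: lin_def if_distrib[of "\<lambda>c. c *\<^sub>R _"] cong: if_cong)

text \<open>Supplies the value of the eliminated coordinate: \<open>A\<close> collects strict upper
  bounds for it and \<open>B\<close> strict lower bounds. \<open>Max\<close> and \<open>Min\<close>
  say nothing on empty sets, hence the case distinction.\<close>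

lemma finite_sets_between:
  fixes A B :: "real set"
  assumes "finite A" "finite B" "\<And>a b. a \<in> A \<Longrightarrow> b \<in> B \<Longrightarrow> b < a"
  shows "\<exists>r. (\<forall>a\<in>A. r < a) \<and> (\<forall>b\<in>B. b < r)"
proof (cases "A = {} \<or> B = {}")
  case True
  thus ?thesis
  proof
    assume "A = {}"
    moreover have "b < Max (insert 0 B) + 1" if "b \<in> B" for b
      by (rule le_less_trans[OF Max_ge less_add_one]) (use that assms(2) in simp_all)
    ultimately show ?thesis by blast
  next
    assume "B = {}"
    moreover have "Min (insert 0 A) - 1 < a" if "a \<in> A" for a
    proof -
      have "Min (insert 0 A) \<le> a" using that assms(1) by (intro Min_le) simp_all
      thus ?thesis by linarith
    qed
    ultimately show ?thesis by blast
  qed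
next
  case False
  hence "Max B < Min A" using assms by simp
  then obtain r where "Max B < r" "r < Min A" using dense by blast
  thus ?thesis using False assms by (auto intro!: exI[of _ r])
qed

text \<open>Fourier--Motzkin elimination: the pairs of \<open>L\<close> with coefficients of opposite sign at the last
  coordinate are combined so that this coordinate vanishes; upper bounds survive because the
  combinations are convex.\<close>

lemma upper_bound_nonneg:
  fixes x :: "nat \<Rightarrow> 'v::ordered_real_vector"
  assumes "finite L" "\<And>t::nat \<Rightarrow> real. \<exists>l\<in>L. 0 \<le> lin n t l" "\<And>l. l \<in> L \<Longrightarrow> lin n x l \<le> z"
  shows "0 \<le> z"
  using assms
proof (induction n arbitrary: L)
  case 0
  thus ?case by fastforce
next
  case (Suc n)
  define comb :: "(nat \<Rightarrow> real) \<times> (nat \<Rightarrow> real) \<Rightarrow> nat \<Rightarrow> real"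
    where "comb = (\<lambda>(p, q) i. p n / (p n - q n) * q i + (- q n / (p n - q n)) * p i)"
  define P where "P = {l \<in> L. 0 < l n}"
  define Q where "Q = {l \<in> L. l n < 0}"
  define L' where "L' = {l \<in> L. l n = 0} \<union> comb ` (P \<times> Q)"
  have lin_comb: "lin m v (comb (p, q)) =
      (p n / (p n - q n)) *\<^sub>R lin m v q + (- q n / (p n - q n)) *\<^sub>R lin m v p"
    for m and v :: "nat \<Rightarrow> 'w::real_vector" and p q
    unfolding comb_def prod.case by (simp only: lin_add lin_scale)
  have fin: "finite P" "finite Q" "finite L'"
    using Suc.prems(1) by (auto simp: P_def Q_def L'_def)
  show ?case
  proof (rule Suc.IH[of L'])
    show "finite L'" by fact
    show "\<exists>l\<in>L'. 0 \<le> lin n t l" for t :: "nat \<Rightarrow> real"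
    proof (rule ccontr)
      assume "\<not> ?thesis"
      hence neg: "lin n t l < 0" if "l \<in> L'" for l using that by force
      \<comment> \<open>A last coordinate \<open>r\<close> makes \<open>p\<close> negative iff it
        lies below the right side and makes \<open>q\<close> negative iff it lies above the left
        side. Negativity of \<open>comb (p, q)\<close> says that these conditions are compatible, so
        some \<open>r\<close> makes every member of \<open>L\<close> negative at
        \<open>t(n := r)\<close>, which contradicts the assumption on \<open>L\<close>.\<close>
      have "- lin n t q / q n < - lin n t p / p n" if "p \<in> P" "q \<in> Q" for p q
      proof -
        have "comb (p, q) \<in> L'" using that by (auto simp: L'_def)
        hence "p n / (p n - q n) * lin n t q + (- q n / (p n - q n)) * lin n t p < 0"
          using neg lin_comb[of n t p q] by fastforce
        hence "(p n * lin n t q - q n * lin n t p) / (p n - q n) < 0"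
          by (simp add: diff_divide_distrib)
        moreover have "0 < p n" "q n < 0" using that by (auto simp: P_def Q_def)
        ultimately have "p n * lin n t q - q n * lin n t p < 0"
          by (auto simp only: divide_less_0_iff)
        hence "0 < (lin n t p * q n - lin n t q * p n) / (- (q n * p n))"
          using \<open>0 < p n\<close> \<open>q n < 0\<close>
          by (intro divide_pos_pos) (simp_all add: mult.commute mult_pos_neg)
        also have "\<dots> = lin n t q / q n - lin n t p / p n"
          using \<open>0 < p n\<close> \<open>q n < 0\<close> by (simp add: divide_simps)
        finally show ?thesis by simp
      qed
      hence sep: "b < a" if "a \<in> (\<lambda>p. - lin n t p / p n) ` P" "b \<in> (\<lambda>q. - lin n t q / q n) ` Q"
        for a b using that by blast
      from finite_sets_between[OF finite_imageI[OF fin(1)] finite_imageI[OF fin(2)] sep]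
      obtain r where r': "(\<forall>a\<in>(\<lambda>p. - lin n t p / p n) ` P. r < a) \<and>
          (\<forall>b\<in>(\<lambda>q. - lin n t q / q n) ` Q. b < r)" ..
      have r: "p \<in> P \<Longrightarrow> r < - lin n t p / p n" "q \<in> Q \<Longrightarrow> - lin n t q / q n < r" for p q
        using r' by auto
      obtain l where l: "l \<in> L" "0 \<le> lin (Suc n) (t(n := r)) l"
        using Suc.prems(2) by blast
      have "lin n (t(n := r)) l = lin n t l" by (rule lin_cong) auto
      hence ge: "0 \<le> lin n t l + l n * r" using l by simp
      consider "l n = 0" | "l \<in> P" | "l \<in> Q" using l by (force simp: P_def Q_def)
      thus False
      proof cases
        case 1
        hence "lin n t l < 0" using neg l by (simp add: L'_def)
        thus False using ge 1 by simp
      next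
        case 2
        moreover from this have "0 < l n" by (simp add: P_def)
        ultimately show False
          using ge r(1)[of l] pos_less_divide_eq[of "l n" r "- lin n t l"]
          by (simp add: mult.commute)
      next
        case 3
        moreover from this have "l n < 0" by (simp add: Q_def)
        ultimately show False
          using ge r(2)[of l] neg_divide_less_eq[of "l n" "- lin n t l" r]
          by (simp add: mult.commute)
      qed
    qed
    show "lin n x l \<le> z" if l: "l \<in> L'" for l
    proof (cases "l \<in> L \<and> l n = 0")
      case True
      thus ?thesis using Suc.prems(3)[of l] by simp
    next
      case False
      then obtain p q where pq: "p \<in> P" "q \<in> Q" "l = comb (p, q)"
        using l by (auto simp: L'_def)
      hence *: "0 < p n" "q n < 0" "lin (Suc n) x p \<le> z" "lin (Suc n) x q \<le> z"
        using Suc.prems(3) by (auto simp: P_def Q_def)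
      have "l n = 0" by (simp add: pq comb_def)
      hence "lin n x l = lin (Suc n) x l" by simp
      also have "\<dots> \<le> (p n / (p n - q n)) *\<^sub>R z + (- q n / (p n - q n)) *\<^sub>R z"
        unfolding pq(3) lin_comb using *
        by (intro add_mono scaleR_left_mono) (simp_all add: divide_nonpos_pos)
      also have "\<dots> = (p n / (p n - q n) + - q n / (p n - q n)) *\<^sub>R z"
        by (rule scaleR_left_distrib[symmetric])
      also have "p n / (p n - q n) + - q n / (p n - q n) = 1"
        using * by (simp flip: diff_divide_distrib)
      also have "1 *\<^sub>R z = z" by simp
      finally show ?thesis .
    qed
  qed
qed

section \<open>Distributivity and the normal form of lattice terms\<close>

lemma sup_inf_distrib_l_group:
  fixes a b c :: "'a::lattice_ab_group_add"
  shows "sup (inf a b) c = inf (sup a c) (sup b c)"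
proof (rule antisym)
  let ?m = "inf a b"
  \<comment> \<open>Raising \<open>m\<close> to \<open>d\<close> raises the supremum with
    \<open>c\<close> by at most \<open>d - m\<close>. For \<open>d = a\<close> and
    \<open>d = b\<close> these excesses have infimum \<open>0\<close>, because \<open>m\<close> is
    the infimum of \<open>a\<close> and \<open>b\<close>.\<close>
  have "sup d c \<le> sup m c + (d - m)" if "m \<le> d" for d m
  proof (rule sup_least)
    show "d \<le> sup m c + (d - m)"
      using add_right_mono[OF sup_ge1[of m c], of "d - m"] by simp
    show "c \<le> sup m c + (d - m)"
      using add_mono[OF sup_ge2[of c m], of 0 "d - m"] that by simp
  qed
  from this[OF inf_le1] this[OF inf_le2]
  have "inf (sup a c) (sup b c) \<le> inf (sup ?m c + (a - ?m)) (sup ?m c + (b - ?m))"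
    by (rule inf_mono)
  also have "\<dots> = sup ?m c + inf (a - ?m) (b - ?m)"
    by (simp add: add_inf_distrib_left)
  also have "inf (a - ?m) (b - ?m) = 0"
    using add_inf_distrib_right[of a b "- ?m"] by (simp only: diff_conv_add_uminus right_minus)
  finally show "inf (sup a c) (sup b c) \<le> sup ?m c" by simp
qed (simp add: le_infI1 le_infI2 le_supI1)

lemma sup_inf_distrib_l_group2:
  fixes a b c :: "'a::lattice_ab_group_add"
  shows "sup c (inf a b) = inf (sup c a) (sup c b)"
  using sup_inf_distrib_l_group[of a b c] by (simp only: sup_commute)

lemma scaleR_sup:
  fixes a b :: "'a::{lattice,ordered_real_vector}"
  assumes "0 \<le> c"
  shows "c *\<^sub>R sup a b = sup (c *\<^sub>R a) (c *\<^sub>R b)"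
proof (cases "c = 0")
  case False
  hence c: "0 < c" using assms by simp
  have "a \<le> inverse c *\<^sub>R sup (c *\<^sub>R a) (c *\<^sub>R b)" "b \<le> inverse c *\<^sub>R sup (c *\<^sub>R a) (c *\<^sub>R b)"
    using c scaleR_left_mono[of "c *\<^sub>R a" "sup (c *\<^sub>R a) (c *\<^sub>R b)" "inverse c"]
      scaleR_left_mono[of "c *\<^sub>R b" "sup (c *\<^sub>R a) (c *\<^sub>R b)" "inverse c"] by simp_all
  hence "c *\<^sub>R sup a b \<le> c *\<^sub>R (inverse c *\<^sub>R sup (c *\<^sub>R a) (c *\<^sub>R b))"
    using c by (intro scaleR_left_mono) simp_all
  thus ?thesis using c by (intro antisym) (simp_all add: scaleR_left_mono)
qed simp

lemma scaleR_inf: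
  fixes a b :: "'a::{lattice_ab_group_add,ordered_real_vector}"
  assumes "0 \<le> c"
  shows "c *\<^sub>R inf a b = inf (c *\<^sub>R a) (c *\<^sub>R b)"
  using scaleR_sup[OF assms, of "- a" "- b"]
  by (simp only: inf_eq_neg_sup[of a b] inf_eq_neg_sup[of "c *\<^sub>R a"] scaleR_minus_right)

text \<open>Syntax is separated from evaluation because one and the same expression has to be
  compared at real tuples and then evaluated in a vector lattice. Infimum and modulus are obtained
  through \<open>Scale (- 1)\<close>.\<close>

datatype lterm = Lin "nat \<Rightarrow> real" | Add lterm lterm | Scale real lterm | Join lterm lterm

fun ev :: "nat \<Rightarrow> (nat \<Rightarrow> 'v::{lattice_ab_group_add,ordered_real_vector}) \<Rightarrow> lterm \<Rightarrow> 'v" where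
  "ev n x (Lin a) = lin n x a"
| "ev n x (Add s t) = ev n x s + ev n x t"
| "ev n x (Scale c s) = c *\<^sub>R ev n x s"
| "ev n x (Join s t) = sup (ev n x s) (ev n x t)"

text \<open>Finite suprema of linear forms, and below finite infima of those: the shape to which
  Fourier-Motzkin elimination applies. Both are nonempty by construction, as a vector lattice has no
  bottom or top to stand for an empty one.\<close>

datatype sup_term = Leaf "nat \<Rightarrow> real" | SJoin sup_term sup_term

datatype inf_sup_term = Node sup_term | IMeet inf_sup_term inf_sup_term

fun sev :: "nat \<Rightarrow> (nat \<Rightarrow> 'v::{lattice_ab_group_add,ordered_real_vector}) \<Rightarrow> sup_term \<Rightarrow> 'v" where
  "sev n x (Leaf a) = lin n x a"
| "sev n x (SJoin s t) = sup (sev n x s) (sev n x t)"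

fun iev :: "nat \<Rightarrow> (nat \<Rightarrow> 'v::{lattice_ab_group_add,ordered_real_vector}) \<Rightarrow> inf_sup_term \<Rightarrow> 'v" where
  "iev n x (Node s) = sev n x s"
| "iev n x (IMeet s t) = inf (iev n x s) (iev n x t)"

fun sadd where
  "sadd (Leaf a) (Leaf b) = Leaf (\<lambda>i. a i + b i)"
| "sadd (Leaf a) (SJoin p q) = SJoin (sadd (Leaf a) p) (sadd (Leaf a) q)"
| "sadd (SJoin p q) r = SJoin (sadd p r) (sadd q r)"

fun iadd where
  "iadd (Node a) (Node b) = Node (sadd a b)"
| "iadd (Node a) (IMeet p q) = IMeet (iadd (Node a) p) (iadd (Node a) q)"
| "iadd (IMeet p q) r = IMeet (iadd p r) (iadd q r)"

fun ijoin where
  "ijoin (Node a) (Node b) = Node (SJoin a b)"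
| "ijoin (Node a) (IMeet p q) = IMeet (ijoin (Node a) p) (ijoin (Node a) q)"
| "ijoin (IMeet p q) r = IMeet (ijoin p r) (ijoin q r)"

fun sneg where
  "sneg (Leaf a) = Node (Leaf (\<lambda>i. - a i))"
| "sneg (SJoin p q) = IMeet (sneg p) (sneg q)"

fun ineg where
  "ineg (Node a) = sneg a"
| "ineg (IMeet p q) = ijoin (ineg p) (ineg q)"

fun sscale where
  "sscale c (Leaf a) = Leaf (\<lambda>i. c * a i)"
| "sscale c (SJoin p q) = SJoin (sscale c p) (sscale c q)"

fun iscale where
  "iscale c (Node a) = Node (sscale c a)"
| "iscale c (IMeet p q) = IMeet (iscale c p) (iscale c q)"

fun normal_form :: "lterm \<Rightarrow> inf_sup_term" where
  "normal_form (Lin a) = Node (Leaf a)"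
| "normal_form (Add s t) = iadd (normal_form s) (normal_form t)"
| "normal_form (Scale c s) =
    (if 0 \<le> c then iscale c (normal_form s) else ineg (iscale (- c) (normal_form s)))"
| "normal_form (Join s t) = ijoin (normal_form s) (normal_form t)"

lemma sev_sadd: "sev n x (sadd s t) = sev n x s + sev n x t"
  by (induction s t rule: sadd.induct)
    (simp_all add: lin_add add_sup_distrib_left add_sup_distrib_right)

lemma iev_iadd: "iev n x (iadd s t) = iev n x s + iev n x t"
  by (induction s t rule: iadd.induct)
    (simp_all add: sev_sadd add_inf_distrib_left add_inf_distrib_right)

lemma iev_ijoin: "iev n x (ijoin s t) = sup (iev n x s) (iev n x t)"
  by (induction s t rule: ijoin.induct)
    (simp_all add: sup_inf_distrib_l_group sup_inf_distrib_l_group2)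

lemma iev_sneg: "iev n x (sneg s) = - sev n x s"
  by (induction s) (simp_all add: lin_uminus neg_sup_eq_inf)

lemma iev_ineg: "iev n x (ineg s) = - iev n x s"
  by (induction s) (simp_all add: iev_sneg iev_ijoin neg_inf_eq_sup)

lemma sev_sscale: "0 \<le> c \<Longrightarrow> sev n x (sscale c s) = c *\<^sub>R sev n x s"
  by (induction s) (simp_all add: lin_scale scaleR_sup)

lemma iev_iscale: "0 \<le> c \<Longrightarrow> iev n x (iscale c s) = c *\<^sub>R iev n x s"
  by (induction s) (simp_all add: sev_sscale scaleR_inf)

lemma iev_normal_form: "iev n x (normal_form s) = ev n x s"
  by (induction s) (simp_all add: iev_iadd iev_ijoin iev_ineg iev_iscale)

fun leaves where
  "leaves (Leaf a) = {a}"
| "leaves (SJoin s t) = leaves s \<union> leaves t"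

lemma finite_leaves: "finite (leaves s)"
  by (induction s) auto

lemma lin_le_sev: "a \<in> leaves s \<Longrightarrow> lin n x a \<le> sev n x s"
  by (induction s) (auto intro: le_supI1 le_supI2)

lemma sev_real_attained:
  fixes t :: "nat \<Rightarrow> real"
  shows "\<exists>a\<in>leaves s. lin n t a = sev n t s"
  by (induction s) (auto simp: sup_max max_def)

text \<open>Among real numbers a finite supremum is attained at a leaf, so at each \<open>t\<close>
  some leaf is nonnegative; in a vector lattice the supremum is at least an upper bound of its
  leaves. These are the two hypotheses of \<open>upper_bound_nonneg\<close>.\<close>

lemma sev_nonneg:
  assumes "\<And>t::nat \<Rightarrow> real. 0 \<le> sev n t s"
  shows "0 \<le> sev n x s"
  by (rule upper_bound_nonneg[OF finite_leaves[of s], of n x])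
    (metis assms sev_real_attained, rule lin_le_sev)

lemma iev_nonneg: "(\<And>t::nat \<Rightarrow> real. 0 \<le> iev n t s) \<Longrightarrow> 0 \<le> iev n x s"
  by (induction s) (simp_all add: sev_nonneg)

text \<open>Transfer principle from the reals to every vector lattice: the difference of the two
  terms has a normal form, and an infimum is nonnegative iff each of its members is.\<close>

lemma ev_mono:
  fixes x :: "nat \<Rightarrow> 'v::{lattice_ab_group_add,ordered_real_vector}"
  assumes "\<And>t::nat \<Rightarrow> real. ev n t r \<le> ev n t s"
  shows "ev n x r \<le> ev n x s"
proof -
  have "0 \<le> iev n x (normal_form (Add s (Scale (- 1) r)))"
    by (rule iev_nonneg) (use assms in \<open>simp only: iev_normal_form, simp\<close>)
  thus ?thesis by (simp only: iev_normal_form) simp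
qed

section \<open>Existence and uniqueness of Krivine's calculus\<close>

lemma krivine_space_cong: "h \<in> krivine_space n \<Longrightarrow> (\<And>i. i < n \<Longrightarrow> s i = t i) \<Longrightarrow> h s = h t"
  and krivine_space_continuous: "h \<in> krivine_space n \<Longrightarrow> continuous_on UNIV h"
  and krivine_space_scale: "h \<in> krivine_space n \<Longrightarrow> 0 \<le> c \<Longrightarrow> h (\<lambda>i. c * t i) = c * h t"
  unfolding krivine_space_def by blast+

lemma krivine_space_add:
  "h \<in> krivine_space n \<Longrightarrow> g \<in> krivine_space n \<Longrightarrow> (\<lambda>t. h t + g t) \<in> krivine_space n"
  unfolding krivine_space_def
  by (auto intro!: continuous_intros arg_cong2[of _ _ _ _ "(+)"] simp: algebra_simps)

lemma krivine_space_mult: "h \<in> krivine_space n \<Longrightarrow> (\<lambda>t. c * h t) \<in> krivine_space n"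
  unfolding krivine_space_def
  by (auto intro!: continuous_intros arg_cong2[of _ _ _ _ "(*)"] simp: algebra_simps)

lemma krivine_space_sup:
  "h \<in> krivine_space n \<Longrightarrow> g \<in> krivine_space n \<Longrightarrow> (\<lambda>t. sup (h t) (g t)) \<in> krivine_space n"
  unfolding krivine_space_def sup_max
  by (auto intro!: continuous_on_max arg_cong2[of _ _ _ _ max] simp: max_mult_distrib_left)

lemma krivine_space_coordinate: "j < n \<Longrightarrow> (\<lambda>t. t j) \<in> krivine_space n"
  by (simp add: krivine_space_def)

lemma krivine_space_zero: "(\<lambda>t. 0) \<in> krivine_space n"
  by (simp add: krivine_space_def)

lemma lin_mem_krivine_space: "m \<le> n \<Longrightarrow> (\<lambda>t. lin m t a) \<in> krivine_space n"
  by (induction m) (auto intro!: krivine_space_add krivine_space_mult krivine_space_coordinate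
      krivine_space_zero)

lemma ev_mem_krivine_space: "(\<lambda>t. ev n t s) \<in> krivine_space n"
  by (induction s) (auto intro: lin_mem_krivine_space krivine_space_add krivine_space_mult
      krivine_space_sup)

section \<open>A partition of unity made of lattice terms\<close>

abbreviation coord :: "nat \<Rightarrow> lterm" where
  "coord i \<equiv> Lin (\<lambda>j. if j = i then 1 else 0)"

fun max_term :: "nat \<Rightarrow> (nat \<Rightarrow> lterm) \<Rightarrow> lterm" where
  "max_term 0 f = Lin (\<lambda>_. 0)"
| "max_term (Suc m) f = Join (max_term m f) (Join (f m) (Scale (- 1) (f m)))"

lemma max_term_nonneg: "0 \<le> ev n x (max_term m f)"
  by (induction m) (auto simp: lin_zero intro: le_supI1)

lemma max_term_ge:
  fixes t :: "nat \<Rightarrow> real"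
  shows "i < m \<Longrightarrow> \<bar>ev n t (f i)\<bar> \<le> ev n t (max_term m f)"
  by (induction m) (auto simp: less_Suc_eq sup_max)

lemma max_term_le:
  fixes t :: "nat \<Rightarrow> real"
  shows "0 \<le> c \<Longrightarrow> (\<And>i. i < m \<Longrightarrow> \<bar>ev n t (f i)\<bar> \<le> c) \<Longrightarrow> ev n t (max_term m f) \<le> c"
  by (induction m) (auto simp: less_Suc_eq sup_max lin_zero abs_le_iff)

text \<open>At real tuples this is the maximum norm; in a Banach lattice it is the supremum of the
  moduli of the \<open>x i\<close>, the unit in which all approximation errors are
  expressed.\<close>

definition maxabs :: "nat \<Rightarrow> lterm" where
  "maxabs n = max_term n coord"

lemma maxabs_nonneg: "0 \<le> ev n x (maxabs n)"
  by (simp add: maxabs_def max_term_nonneg)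

lemma maxabs_ge:
  fixes t :: "nat \<Rightarrow> real"
  shows "i < n \<Longrightarrow> \<bar>t i\<bar> \<le> ev n t (maxabs n)"
  using max_term_ge[of i n n t coord] by (simp add: maxabs_def lin_unit)

lemma maxabs_le:
  fixes t :: "nat \<Rightarrow> real"
  shows "0 \<le> c \<Longrightarrow> (\<And>i. i < n \<Longrightarrow> \<bar>t i\<bar> \<le> c) \<Longrightarrow> ev n t (maxabs n) \<le> c"
  unfolding maxabs_def by (rule max_term_le) (simp_all add: lin_unit)

text \<open>Distance in the maximum norm from \<open>t\<close> to the point with the same norm on
  the ray through \<open>a\<close>, when \<open>a\<close> has norm one. Multiplying \<open>a\<close>
  by \<open>maxabs\<close> keeps the expression positively homogeneous, as a lattice term must
  be.\<close>

definition dist_term :: "nat \<Rightarrow> (nat \<Rightarrow> real) \<Rightarrow> lterm" where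
  "dist_term n a = max_term n (\<lambda>i. Add (coord i) (Scale (- a i) (maxabs n)))"

lemma dist_term_ge:
  fixes t :: "nat \<Rightarrow> real"
  shows "i < n \<Longrightarrow> \<bar>t i - a i * ev n t (maxabs n)\<bar> \<le> ev n t (dist_term n a)"
  using max_term_ge[of i n n t "\<lambda>i. Add (coord i) (Scale (- a i) (maxabs n))"]
  by (simp add: dist_term_def lin_unit)

lemma dist_term_le:
  fixes t :: "nat \<Rightarrow> real"
  shows "0 \<le> c \<Longrightarrow> (\<And>i. i < n \<Longrightarrow> \<bar>t i - a i * ev n t (maxabs n)\<bar> \<le> c) \<Longrightarrow> ev n t (dist_term n a) \<le> c"
  unfolding dist_term_def by (rule max_term_le) (simp_all add: lin_unit)

definition Meet :: "lterm \<Rightarrow> lterm \<Rightarrow> lterm" where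
  "Meet r s = Scale (- 1) (Join (Scale (- 1) r) (Scale (- 1) s))"

lemma ev_Meet [simp]: "ev n x (Meet r s) = inf (ev n x r) (ev n x s)"
  by (simp add: Meet_def neg_sup_eq_inf)

text \<open>On the unit sphere of the maximum norm, \<open>bump n \<delta> a\<close> is a continuous cut-off that is \<open>1\<close>
  where the distance to \<open>a\<close> is at most \<open>\<delta>\<close> and \<open>0\<close> where it is at least \<open>2\<delta>\<close>. The increments of
  the successive maxima \<open>cover\<close> form a partition of unity made of lattice terms, and \<open>interp\<close>
  interpolates \<open>h\<close> with respect to it.\<close>

definition bump :: "nat \<Rightarrow> real \<Rightarrow> (nat \<Rightarrow> real) \<Rightarrow> lterm" where
  "bump n \<delta> a = Join (Lin (\<lambda>_. 0)) (Meet (maxabs n) (Add (Scale 2 (maxabs n)) (Scale (- inverse \<delta>) (dist_term n a))))"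

fun cover :: "nat \<Rightarrow> real \<Rightarrow> (nat \<Rightarrow> real) list \<Rightarrow> lterm" where
  "cover n \<delta> [] = Lin (\<lambda>_. 0)"
| "cover n \<delta> (a # as) = Join (bump n \<delta> a) (cover n \<delta> as)"

fun interp :: "nat \<Rightarrow> real \<Rightarrow> ((nat \<Rightarrow> real) \<Rightarrow> real) \<Rightarrow> (nat \<Rightarrow> real) list \<Rightarrow> lterm" where
  "interp n \<delta> h [] = Lin (\<lambda>_. 0)"
| "interp n \<delta> h (a # as) =
    Add (Scale (h a) (Add (cover n \<delta> (a # as)) (Scale (- 1) (cover n \<delta> as)))) (interp n \<delta> h as)"

lemma bump_bounds:
  fixes t :: "nat \<Rightarrow> real"
  shows "0 \<le> ev n t (bump n \<delta> a)" "ev n t (bump n \<delta> a) \<le> ev n t (maxabs n)"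
  using maxabs_nonneg[of n t] by (auto simp: bump_def sup_max inf_min lin_zero)

lemma bump_eq:
  fixes t :: "nat \<Rightarrow> real"
  assumes "0 < \<delta>" "ev n t (dist_term n a) \<le> \<delta> * ev n t (maxabs n)"
  shows "ev n t (bump n \<delta> a) = ev n t (maxabs n)"
proof -
  have "inverse \<delta> * ev n t (dist_term n a) \<le> ev n t (maxabs n)"
    using assms by (simp add: field_simps)
  thus ?thesis using maxabs_nonneg[of n t] by (simp add: bump_def sup_max inf_min lin_zero)
qed

lemma bump_nonzero:
  fixes t :: "nat \<Rightarrow> real"
  assumes "0 < \<delta>" "ev n t (bump n \<delta> a) \<noteq> 0"
  shows "ev n t (dist_term n a) < 2 * \<delta> * ev n t (maxabs n)" "0 < ev n t (maxabs n)"
proof -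
  have "\<not> 2 * ev n t (maxabs n) - inverse \<delta> * ev n t (dist_term n a) \<le> 0 \<and> ev n t (maxabs n) \<noteq> 0"
    using assms(2) maxabs_nonneg[of n t]
    by (auto simp: bump_def sup_max inf_min lin_zero max_def min_def split: if_splits)
  thus "ev n t (dist_term n a) < 2 * \<delta> * ev n t (maxabs n)" "0 < ev n t (maxabs n)"
    using assms(1) maxabs_nonneg[of n t] by (simp_all add: field_simps)
qed

lemma cover_bounds:
  fixes t :: "nat \<Rightarrow> real"
  shows "0 \<le> ev n t (cover n \<delta> as)" "ev n t (cover n \<delta> as) \<le> ev n t (maxabs n)"
  using bump_bounds[of n t \<delta>] maxabs_nonneg[of n t]
  by (induction as) (auto simp: lin_zero sup_max max_def)

lemma bump_le_cover:
  fixes t :: "nat \<Rightarrow> real"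
  shows "a \<in> set as \<Longrightarrow> ev n t (bump n \<delta> a) \<le> ev n t (cover n \<delta> as)"
  by (induction as) (auto intro: le_supI1 le_supI2)

text \<open>The increments of \<open>cover\<close> are nonnegative and add up to
  \<open>cover\<close>, and an increment differs from zero only where its bump does. Thus the
  interpolation is a weighted sum of values \<open>h a\<close> that are all close to
  \<open>c\<close>.\<close>

lemma interp_near:
  fixes t :: "nat \<Rightarrow> real"
  assumes "\<And>a. a \<in> set as \<Longrightarrow> ev n t (bump n \<delta> a) \<noteq> 0 \<Longrightarrow> \<bar>h a - c\<bar> \<le> \<epsilon>"
  shows "\<bar>ev n t (interp n \<delta> h as) - c * ev n t (cover n \<delta> as)\<bar> \<le> \<epsilon> * ev n t (cover n \<delta> as)"
  using assms
proof (induction as)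
  case Nil
  thus ?case by (simp add: lin_zero)
next
  case (Cons a as)
  define w s I where "w = ev n t (bump n \<delta> a)" and "s = ev n t (cover n \<delta> as)"
    and "I = ev n t (interp n \<delta> h as)"
  have IH: "\<bar>I - c * s\<bar> \<le> \<epsilon> * s" using Cons by (simp add: I_def s_def)
  have "0 \<le> s" using cover_bounds by (simp add: s_def)
  show ?case
  proof (cases "w \<le> s")
    case True
    thus ?thesis using IH by (simp add: sup_absorb2 flip: w_def s_def I_def)
  next
    case False
    hence "\<bar>h a - c\<bar> \<le> \<epsilon>" using Cons.prems[of a] \<open>0 \<le> s\<close> by (simp add: w_def)
    hence "\<bar>(h a - c) * (w - s)\<bar> \<le> \<epsilon> * (w - s)"
      using False by (simp add: abs_mult mult_right_mono)
    with IH have "\<bar>(h a - c) * (w - s) + (I - c * s)\<bar> \<le> \<epsilon> * (w - s) + \<epsilon> * s"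
      by linarith
    moreover have "(h a - c) * (w - s) + (I - c * s) = h a * (w - s) + I - c * w"
      by (simp add: algebra_simps)
    moreover have "\<epsilon> * (w - s) + \<epsilon> * s = \<epsilon> * w" by (simp add: algebra_simps)
    ultimately show ?thesis using False by (simp add: sup_absorb1 flip: w_def s_def I_def)
  qed
qed

section \<open>Nets of the cube and uniform approximation by terms\<close>

definition cube_net :: "nat \<Rightarrow> real \<Rightarrow> (nat \<Rightarrow> real) list \<Rightarrow> bool" where
  "cube_net n \<delta> as \<longleftrightarrow> (\<forall>a\<in>set as. \<forall>i<n. \<bar>a i\<bar> \<le> 1) \<and>
    (\<forall>t. (\<forall>i<n. \<bar>t i\<bar> \<le> 1) \<longrightarrow> (\<exists>a\<in>set as. \<forall>i<n. \<bar>t i - a i\<bar> \<le> \<delta>))"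

text \<open>Products of points of a finite net of the interval from -1 to 1, which is totally
  bounded.\<close>

lemma ex_cube_net:
  assumes "0 < \<delta>"
  shows "\<exists>as. cube_net n \<delta> as"
proof -
  obtain G where G: "finite G" "G \<subseteq> {-1..1::real}" "{-1..1} \<subseteq> (\<Union>g\<in>G. ball g \<delta>)"
    using seq_compact_imp_totally_bounded[OF compact_imp_seq_compact[OF compact_Icc[of "-1::real" 1]],
        rule_format, OF assms] by auto
  obtain as where as: "set as = PiE {..<n} (\<lambda>_. G)"
    using finite_list[OF finite_PiE[of "{..<n}" "\<lambda>_. G"]] G(1) by auto
  have "\<exists>a\<in>set as. \<forall>i<n. \<bar>t i - a i\<bar> \<le> \<delta>" if t: "\<forall>i<n. \<bar>t i\<bar> \<le> 1" for t :: "nat \<Rightarrow> real"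
  proof -
    have "\<exists>g\<in>G. \<bar>t i - g\<bar> \<le> \<delta>" if "i < n" for i
    proof -
      have "t i \<in> {-1..1}" using t that by (simp add: abs_le_iff minus_le_iff)
      then obtain g where "g \<in> G" "t i \<in> ball g \<delta>" using G(3) by blast
      thus ?thesis by (intro bexI[of _ g]) (simp_all add: dist_real_def abs_minus_commute)
    qed
    then obtain g where g: "\<And>i. i < n \<Longrightarrow> g i \<in> G \<and> \<bar>t i - g i\<bar> \<le> \<delta>" by metis
    show ?thesis by (rule bexI[of _ "restrict g {..<n}"]) (use g in \<open>auto simp: as\<close>)
  qed
  moreover have "\<bar>a i\<bar> \<le> 1" if "a \<in> set as" "i < n" for a i
  proof -
    have "a i \<in> G" using that by (auto simp: as PiE_def)
    hence "a i \<in> {-1..1}" using G(2) by blast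
    thus ?thesis by (simp add: abs_le_iff minus_le_iff)
  qed
  ultimately show ?thesis unfolding cube_net_def by blast
qed

lemma cube_net_scaled:
  assumes "cube_net n \<delta> as" and t_le: "\<And>i. i < n \<Longrightarrow> \<bar>t i\<bar> \<le> m" and "0 \<le> m"
  shows "\<exists>a\<in>set as. \<forall>i<n. \<bar>t i - a i * m\<bar> \<le> \<delta> * m"
proof -
  \<comment> \<open>For \<open>m = 0\<close> the quotient is \<open>0\<close> by the convention on
    division, so a net point is found in this case too.\<close>
  have le1: "\<bar>t i / m\<bar> \<le> 1" if "i < n" for i
    using t_le[OF that] \<open>0 \<le> m\<close> by (simp add: abs_divide divide_le_eq)
  then obtain a where a: "a \<in> set as" "\<And>i. i < n \<Longrightarrow> \<bar>t i / m - a i\<bar> \<le> \<delta>"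
    using assms(1)[unfolded cube_net_def, THEN conjunct2, rule_format, of "\<lambda>i. t i / m"] by blast
  have "\<bar>t i - a i * m\<bar> \<le> \<delta> * m" if "i < n" for i
  proof (cases "m = 0")
    case False
    hence "t i - a i * m = (t i / m - a i) * m" by (simp add: left_diff_distrib)
    thus ?thesis using a(2)[OF that] \<open>0 \<le> m\<close> by (simp add: abs_mult mult_right_mono)
  qed (use t_le[OF that] in simp)
  thus ?thesis using a(1) by blast
qed

text \<open>Some net point is so close to the direction of \<open>t\<close> that its bump attains
  the common upper bound \<open>maxabs\<close>; hence the increments of \<open>cover\<close> add up
  to the unit.\<close>

lemma cover_eq:
  fixes t :: "nat \<Rightarrow> real"
  assumes "0 < \<delta>" "cube_net n \<delta> as"
  shows "ev n t (cover n \<delta> as) = ev n t (maxabs n)"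
proof -
  have "\<exists>a\<in>set as. \<forall>i<n. \<bar>t i - a i * ev n t (maxabs n)\<bar> \<le> \<delta> * ev n t (maxabs n)"
    by (rule cube_net_scaled[OF assms(2) maxabs_ge maxabs_nonneg])
  then obtain a where a: "a \<in> set as" "\<forall>i<n. \<bar>t i - a i * ev n t (maxabs n)\<bar> \<le> \<delta> * ev n t (maxabs n)" ..
  hence "ev n t (dist_term n a) \<le> \<delta> * ev n t (maxabs n)"
    using assms(1) by (intro dist_term_le) (simp_all add: maxabs_nonneg)
  hence "ev n t (bump n \<delta> a) = ev n t (maxabs n)"
    by (rule bump_eq[OF assms(1)])
  thus ?thesis using bump_le_cover[OF a(1), of n t \<delta>] cover_bounds(2)[of n t \<delta> as] by simp
qed

text \<open>Uniform continuity on the cube by compactness. The cube \<open>K\<close> in the full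
  product is compact, and so is the set \<open>A\<close> of pairs whose values differ by at least
  \<open>\<epsilon>\<close>. The distance \<open>f\<close> in the first \<open>n\<close> coordinates
  has no zero on \<open>A\<close>, so it has a positive minimum there, and half of it serves as
  \<open>\<eta>\<close>.\<close>

lemma krivine_space_modulus:
  assumes h: "h \<in> krivine_space n" and "0 < \<epsilon>"
  shows "\<exists>\<eta>>0. \<forall>s t. (\<forall>i<n. \<bar>s i\<bar> \<le> 1 \<and> \<bar>t i\<bar> \<le> 1 \<and> \<bar>s i - t i\<bar> \<le> \<eta>) \<longrightarrow> \<bar>h s - h t\<bar> \<le> \<epsilon>"
proof -
  define K where "K = PiE UNIV (\<lambda>_::nat. {-1..1::real})"
  have "compactin (product_topology (\<lambda>i. euclidean) UNIV) K"
    unfolding K_def by (subst compactin_PiE) (simp add: compactin_euclidean_iff)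
  hence "compact K" by (simp add: euclidean_product_topology compactin_euclidean_iff)
  have cont: "continuous_on UNIV (\<lambda>p. h (fst p))" "continuous_on UNIV (\<lambda>p. h (snd p))"
    by (rule continuous_on_compose2[OF krivine_space_continuous[OF h]]; auto intro: continuous_intros)+
  define A where "A = (K \<times> K) \<inter> {p. \<epsilon> \<le> \<bar>h (fst p) - h (snd p)\<bar>}"
  have "compact A"
    unfolding A_def using \<open>compact K\<close>
    by (intro compact_Int_closed compact_Times closed_Collect_le continuous_intros cont)
  define f where "f p = ev n (\<lambda>i. fst p i - snd p i) (maxabs n)" for p :: "(nat \<Rightarrow> real) \<times> (nat \<Rightarrow> real)"
  have comp: "continuous_on UNIV (\<lambda>p. fst p i)" "continuous_on UNIV (\<lambda>p. snd p i)"
    for i and p :: "(nat \<Rightarrow> real) \<times> (nat \<Rightarrow> real)"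
    by (rule continuous_on_compose2[OF continuous_on_product_coordinates[of i]];
        auto intro: continuous_intros)+
  have "continuous_on UNIV f"
    unfolding f_def
    by (rule continuous_on_compose2[OF krivine_space_continuous[OF ev_mem_krivine_space]])
      (auto intro!: continuous_on_coordinatewise_then_product continuous_intros comp)
  have "\<exists>\<eta>>0. \<forall>p\<in>A. \<eta> < f p"
  proof (cases "A = {}")
    case False
    then obtain p where p: "p \<in> A" "\<And>q. q \<in> A \<Longrightarrow> f p \<le> f q"
      using continuous_attains_inf[OF \<open>compact A\<close> False continuous_on_subset[OF \<open>continuous_on UNIV f\<close>]]
      by auto
    have "f p \<noteq> 0"
    proof
      assume "f p = 0"
      hence "fst p i = snd p i" if "i < n" for i
        using maxabs_ge[OF that, of "\<lambda>i. fst p i - snd p i"] by (simp add: f_def)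
      hence "h (fst p) = h (snd p)" by (rule krivine_space_cong[OF h])
      thus False using p(1) \<open>0 < \<epsilon>\<close> by (simp add: A_def)
    qed
    hence "0 < f p" using maxabs_nonneg[of n "\<lambda>i. fst p i - snd p i"] by (simp add: f_def)
    thus ?thesis using p(2) by (intro exI[of _ "f p / 2"]) force
  qed (auto intro: exI[of _ 1])
  then obtain \<eta> where \<eta>: "0 < \<eta>" "\<And>p. p \<in> A \<Longrightarrow> \<eta> < f p" by blast
  have "\<bar>h s - h t\<bar> \<le> \<epsilon>" if st: "\<forall>i<n. \<bar>s i\<bar> \<le> 1 \<and> \<bar>t i\<bar> \<le> 1 \<and> \<bar>s i - t i\<bar> \<le> \<eta>" for s t
  proof -
    \<comment> \<open>The hypotheses restrict only the first \<open>n\<close> coordinates, while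
      membership in \<open>K\<close> restricts all of them; truncation closes this gap without
      changing the values of \<open>h\<close>.\<close>
    have "f (trunc n s, trunc n t) \<le> \<eta>"
      unfolding f_def using st \<eta>(1) by (intro maxabs_le) (simp_all add: trunc_def)
    hence "(trunc n s, trunc n t) \<notin> A" using \<eta>(2) by force
    moreover have "trunc n s \<in> K" "trunc n t \<in> K"
      using st by (auto simp: K_def trunc_def abs_le_iff minus_le_iff)
    moreover have "h (trunc n s) = h s" "h (trunc n t) = h t"
      by (rule krivine_space_cong[OF h]; simp add: trunc_def)+
    ultimately show ?thesis by (simp add: A_def)
  qed
  thus ?thesis using \<eta>(1) by blast
qed

text \<open>The threshold depends on \<open>h\<close> and \<open>\<epsilon>\<close> alone and serves
  all finer nets and all \<open>t\<close>. After scaling \<open>t\<close> to norm one, uniform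
  continuity compares \<open>h\<close> with its values at the centres of the active bumps;
  homogeneity restores the factor \<open>maxabs\<close>.\<close>

lemma interp_close:
  assumes h: "h \<in> krivine_space n" and \<epsilon>: "0 < \<epsilon>"
  shows "\<exists>\<eta>>0. \<forall>\<delta> as t. 0 < \<delta> \<longrightarrow> \<delta> \<le> \<eta> \<longrightarrow> cube_net n \<delta> as \<longrightarrow>
    \<bar>ev n t (interp n \<delta> h as) - h t\<bar> \<le> \<epsilon> * ev n t (maxabs n)"
proof -
  obtain \<eta> where \<eta>: "0 < \<eta>"
    "\<And>s t. (\<And>i. i < n \<Longrightarrow> \<bar>s i\<bar> \<le> 1 \<and> \<bar>t i\<bar> \<le> 1 \<and> \<bar>s i - t i\<bar> \<le> \<eta>) \<Longrightarrow> \<bar>h s - h t\<bar> \<le> \<epsilon>"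
    using krivine_space_modulus[OF assms] by blast
  \<comment> \<open>A bump is supported within distance \<open>2 * \<delta>\<close> of its centre,
    hence the bound \<open>\<eta> / 2\<close> on the mesh.\<close>
  have "\<bar>ev n t (interp n \<delta> h as) - h t\<bar> \<le> \<epsilon> * ev n t (maxabs n)"
    if \<delta>: "0 < \<delta>" "\<delta> \<le> \<eta> / 2" and net: "cube_net n \<delta> as" for \<delta> as t
  proof -
    define m where "m = ev n t (maxabs n)"
    define c where "c = h (\<lambda>i. inverse m * t i)"
    have "0 \<le> m" by (simp add: m_def maxabs_nonneg)
    have t_le: "\<bar>t i\<bar> \<le> m" if "i < n" for i using maxabs_ge[OF that] by (simp add: m_def)
    have ht: "h t = c * m"
    proof (cases "m = 0")
      case True
      have "h t = h (\<lambda>i. 0 * t i)"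
        by (rule krivine_space_cong[OF h]) (use t_le True in force)
      also have "\<dots> = 0" using krivine_space_scale[OF h, of 0 t] by simp
      finally show ?thesis using True by simp
    next
      case False
      have "h (\<lambda>i. m * (inverse m * t i)) = m * c"
        unfolding c_def by (rule krivine_space_scale[OF h \<open>0 \<le> m\<close>])
      moreover have "(\<lambda>i. m * (inverse m * t i)) = t" using False by (simp flip: mult.assoc)
      ultimately show ?thesis by (simp add: mult.commute)
    qed
    have "\<bar>h a - c\<bar> \<le> \<epsilon>" if a: "a \<in> set as" "ev n t (bump n \<delta> a) \<noteq> 0" for a
      unfolding c_def
    proof (rule \<eta>(2))
      fix i assume i: "i < n"
      have m: "0 < m" and d: "ev n t (dist_term n a) < 2 * \<delta> * m"
        using bump_nonzero[OF \<delta>(1) a(2)] by (simp_all add: m_def)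
      have "\<bar>t i - a i * m\<bar> \<le> 2 * \<delta> * m"
        using dist_term_ge[OF i, of t a] d by (simp add: m_def)
      also have "\<dots> \<le> \<eta> * m" using \<delta>(2) m by (simp add: mult_right_mono)
      finally have le: "\<bar>t i - a i * m\<bar> \<le> \<eta> * m" .
      have "\<bar>a i - inverse m * t i\<bar> * m = \<bar>(a i - inverse m * t i) * m\<bar>"
        using m by (simp add: abs_mult)
      also have "(a i - inverse m * t i) * m = a i * m - t i"
        using m by (simp add: field_simps)
      finally have "\<bar>a i - inverse m * t i\<bar> * m \<le> \<eta> * m"
        using le by (simp add: abs_minus_commute)
      hence "\<bar>a i - inverse m * t i\<bar> \<le> \<eta>" using m by simp
      moreover have "\<bar>a i\<bar> \<le> 1" using net a(1) i by (simp add: cube_net_def)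
      moreover have "\<bar>inverse m * t i\<bar> \<le> 1"
        using t_le[OF i] m by (simp add: abs_mult field_simps)
      ultimately show "\<bar>a i\<bar> \<le> 1 \<and> \<bar>inverse m * t i\<bar> \<le> 1 \<and> \<bar>a i - inverse m * t i\<bar> \<le> \<eta>"
        by blast
    qed
    from interp_near[of as n t \<delta> h c \<epsilon>, OF this]
    show ?thesis using cover_eq[OF \<delta>(1) net, of t] by (simp add: ht flip: m_def)
  qed
  thus ?thesis using \<eta>(1) by (intro exI[of _ "\<eta> / 2"]) simp
qed

text \<open>The net depends on \<open>n\<close> and \<open>m\<close> but not on \<open>h\<close>.
  The coordinates and the norm are therefore interpolated with one and the same partition of unity,
  which the Hoelder inequality relies on.\<close>

definition approx :: "nat \<Rightarrow> ((nat \<Rightarrow> real) \<Rightarrow> real) \<Rightarrow> nat \<Rightarrow> lterm" where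
  "approx n h m = interp n (inverse (real (Suc m))) h (SOME as. cube_net n (inverse (real (Suc m))) as)"

lemma approx_close:
  assumes h: "h \<in> krivine_space n" and \<epsilon>: "0 < \<epsilon>"
  shows "\<forall>\<^sub>F m in sequentially. \<forall>t. \<bar>ev n t (approx n h m) - h t\<bar> \<le> \<epsilon> * ev n t (maxabs n)"
proof -
  obtain \<eta> where \<eta>: "0 < \<eta>" "\<And>\<delta> as t. 0 < \<delta> \<Longrightarrow> \<delta> \<le> \<eta> \<Longrightarrow> cube_net n \<delta> as \<Longrightarrow>
      \<bar>ev n t (interp n \<delta> h as) - h t\<bar> \<le> \<epsilon> * ev n t (maxabs n)"
    using interp_close[OF assms] by blast
  have "\<forall>\<^sub>F m in sequentially. inverse (real (Suc m)) < \<eta>"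
    using LIMSEQ_inverse_real_of_nat \<eta>(1) by (rule order_tendstoD)
  thus ?thesis
  proof eventually_elim
    case (elim m)
    have "cube_net n (inverse (real (Suc m))) (SOME as. cube_net n (inverse (real (Suc m))) as)"
      by (rule someI_ex[OF ex_cube_net]) simp
    thus ?case unfolding approx_def using elim by (intro allI \<eta>(2)) simp_all
  qed
qed

section \<open>Norm estimates and limits in a Banach lattice\<close>

lemma abs_ev_diff_le:
  fixes x :: "nat \<Rightarrow> 'x::banach_lattice"
  assumes "\<And>t::nat \<Rightarrow> real. \<bar>ev n t r - ev n t s\<bar> \<le> \<epsilon> * ev n t (maxabs n)"
  shows "\<bar>ev n x r - ev n x s\<bar> \<le> \<epsilon> *\<^sub>R ev n x (maxabs n)"
proof (rule abs_leI)
  have "ev n x r \<le> ev n x (Add s (Scale \<epsilon> (maxabs n)))"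
  proof (rule ev_mono)
    show "ev n t r \<le> ev n t (Add s (Scale \<epsilon> (maxabs n)))" for t :: "nat \<Rightarrow> real"
      using abs_le_D1[OF assms[of t]] by simp
  qed
  thus "ev n x r - ev n x s \<le> \<epsilon> *\<^sub>R ev n x (maxabs n)" by (simp add: diff_le_eq add.commute)
  have "ev n x s \<le> ev n x (Add r (Scale \<epsilon> (maxabs n)))"
  proof (rule ev_mono)
    show "ev n t s \<le> ev n t (Add r (Scale \<epsilon> (maxabs n)))" for t :: "nat \<Rightarrow> real"
      using abs_le_D2[OF assms[of t]] by simp
  qed
  thus "- (ev n x r - ev n x s) \<le> \<epsilon> *\<^sub>R ev n x (maxabs n)" by (simp add: diff_le_eq add.commute)
qed

lemma norm_le_of_abs_le:
  fixes u v :: "'x::banach_lattice"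
  assumes "\<bar>u\<bar> \<le> v"
  shows "norm u \<le> norm v"
  using assms by (intro norm_mono_abs) (meson abs_ge_self order_trans)

lemma norm_ev_diff_le:
  fixes x :: "nat \<Rightarrow> 'x::banach_lattice"
  assumes "0 \<le> \<epsilon>" "\<And>t::nat \<Rightarrow> real. \<bar>ev n t r - ev n t s\<bar> \<le> \<epsilon> * ev n t (maxabs n)"
  shows "norm (ev n x r - ev n x s) \<le> \<epsilon> * norm (ev n x (maxabs n))"
  using norm_le_of_abs_le[OF abs_ev_diff_le[OF assms(2)]] assms(1) by simp

lemma abs_sup_diff_le:
  fixes a b c d :: "'a::lattice_ab_group_add_abs"
  shows "\<bar>sup a b - sup c d\<bar> \<le> \<bar>a - c\<bar> + \<bar>b - d\<bar>"
proof -
  have "sup a b \<le> sup c d + (\<bar>a - c\<bar> + \<bar>b - d\<bar>)" for a b c d :: 'a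
  proof (rule sup_least)
    have "a \<le> c + (\<bar>a - c\<bar> + 0)"
      using abs_ge_self[of "a - c"] by (simp add: diff_le_eq add.commute)
    also have "\<dots> \<le> sup c d + (\<bar>a - c\<bar> + \<bar>b - d\<bar>)"
      by (intro add_mono) simp_all
    finally show "a \<le> sup c d + (\<bar>a - c\<bar> + \<bar>b - d\<bar>)" .
    have "b \<le> d + (0 + \<bar>b - d\<bar>)"
      using abs_ge_self[of "b - d"] by (simp add: diff_le_eq add.commute)
    also have "\<dots> \<le> sup c d + (\<bar>a - c\<bar> + \<bar>b - d\<bar>)"
      by (intro add_mono) simp_all
    finally show "b \<le> sup c d + (\<bar>a - c\<bar> + \<bar>b - d\<bar>)" .
  qed
  from this[of a b c d] this[of c d a b] show ?thesis
    by (intro abs_leI)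
      (simp_all only: minus_diff_eq diff_le_eq add.commute abs_minus_commute[of c] abs_minus_commute[of d])
qed

lemma norm_sup_diff_le:
  fixes a b c d :: "'x::banach_lattice"
  shows "norm (sup a b - sup c d) \<le> norm (a - c) + norm (b - d)"
  using norm_le_of_abs_le[OF abs_sup_diff_le[of a b c d]]
    norm_triangle_ineq[of "\<bar>a - c\<bar>" "\<bar>b - d\<bar>"]
  by (simp add: norm_abs_lattice)

lemma tendsto_sup_banach_lattice:
  fixes a b :: "'x::banach_lattice"
  assumes "(f \<longlongrightarrow> a) F" "(g \<longlongrightarrow> b) F"
  shows "((\<lambda>m. sup (f m) (g m)) \<longlongrightarrow> sup a b) F"
proof (rule LIM_zero_cancel, rule Lim_null_comparison)
  show "\<forall>\<^sub>F m in F. norm (sup (f m) (g m) - sup a b) \<le> norm (f m - a) + norm (g m - b)"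
    by (intro always_eventually allI norm_sup_diff_le)
  show "((\<lambda>m. norm (f m - a) + norm (g m - b)) \<longlongrightarrow> 0) F"
    using assms by (intro tendsto_add_zero tendsto_norm_zero LIM_zero)
qed

text \<open>The order is closed because \<open>a \<le> b\<close> means \<open>sup a b = b\<close>
  and the supremum is continuous.\<close>

lemma tendsto_le_banach_lattice:
  fixes a b :: "'x::banach_lattice"
  assumes "f \<longlonglongrightarrow> a" "g \<longlonglongrightarrow> b" "\<And>m. f m \<le> g m"
  shows "a \<le> b"
proof -
  have "(\<lambda>m. sup (f m) (g m)) \<longlonglongrightarrow> sup a b"
    using assms by (intro tendsto_sup_banach_lattice)
  moreover have "(\<lambda>m. sup (f m) (g m)) = g" using assms(3) by (simp add: sup_absorb2)
  ultimately have "sup a b = b" using assms(2) LIMSEQ_unique by metis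
  thus ?thesis by (simp add: le_iff_sup)
qed

text \<open>The Archimedean property, a consequence of the closedness of the order.\<close>

lemma le_of_le_add_scaleR:
  fixes a b e :: "'x::banach_lattice"
  assumes "\<And>\<epsilon>. 0 < \<epsilon> \<Longrightarrow> a \<le> b + \<epsilon> *\<^sub>R e"
  shows "a \<le> b"
proof (rule tendsto_le_banach_lattice)
  have "(\<lambda>m. b + inverse (real (Suc m)) *\<^sub>R e) \<longlonglongrightarrow> b + 0 *\<^sub>R e"
    by (intro tendsto_intros LIMSEQ_inverse_real_of_nat)
  thus "(\<lambda>m. b + inverse (real (Suc m)) *\<^sub>R e) \<longlonglongrightarrow> b" by simp
  show "a \<le> b + inverse (real (Suc m)) *\<^sub>R e" for m by (rule assms) simp
qed (rule tendsto_const)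

lemma tendsto_of_eventually_le:
  fixes f :: "nat \<Rightarrow> 'a::real_normed_vector"
  assumes "\<And>\<epsilon>. 0 < \<epsilon> \<Longrightarrow> \<forall>\<^sub>F m in sequentially. norm (f m - l) \<le> \<epsilon> * B"
  shows "f \<longlonglongrightarrow> l"
proof (rule tendstoI)
  fix e :: real assume "0 < e"
  define \<epsilon> where "\<epsilon> = e / (\<bar>B\<bar> + 1)"
  have \<epsilon>: "0 < \<epsilon>" "\<epsilon> * \<bar>B\<bar> < e"
    using \<open>0 < e\<close> by (simp_all add: \<epsilon>_def field_simps add_pos_nonneg)
  have "\<epsilon> * B \<le> \<epsilon> * \<bar>B\<bar>" using \<epsilon>(1) by (intro mult_left_mono) simp_all
  hence "\<epsilon> * B < e" using \<epsilon>(2) by linarith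
  with assms[OF \<epsilon>(1)] show "\<forall>\<^sub>F m in sequentially. dist (f m) l < e"
    by (auto simp: dist_norm elim: eventually_mono)
qed

section \<open>Uniqueness of the calculus\<close>

context
  fixes n and x :: "nat \<Rightarrow> 'x::banach_lattice" and \<tau>
  assumes \<tau>: "is_krivine_calculus n x \<tau>"
begin

lemma calculus_extensional: "\<tau> \<in> extensional (krivine_space n)"
  and calculus_add: "h \<in> krivine_space n \<Longrightarrow> g \<in> krivine_space n \<Longrightarrow> \<tau> (\<lambda>t. h t + g t) = \<tau> h + \<tau> g"
  and calculus_scale: "h \<in> krivine_space n \<Longrightarrow> \<tau> (\<lambda>t. c * h t) = c *\<^sub>R \<tau> h"
  and calculus_coordinate: "j < n \<Longrightarrow> \<tau> (\<lambda>t. t j) = x j"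
  and calculus_sup: "h \<in> krivine_space n \<Longrightarrow> g \<in> krivine_space n \<Longrightarrow>
    \<tau> (\<lambda>t. sup (h t) (g t)) = sup (\<tau> h) (\<tau> g)"
  using \<tau> unfolding is_krivine_calculus_def by blast+

lemma calculus_zero: "\<tau> (\<lambda>t. 0) = 0"
  using calculus_scale[OF krivine_space_zero, of 0] by simp

lemma calculus_lin: "m \<le> n \<Longrightarrow> \<tau> (\<lambda>t. lin m t a) = lin m x a"
proof (induction m)
  case (Suc m)
  hence "(\<lambda>t. lin m t a) \<in> krivine_space n" "(\<lambda>t. t m) \<in> krivine_space n"
    by (auto intro: lin_mem_krivine_space krivine_space_coordinate)
  thus ?case using Suc
    by (simp add: calculus_add krivine_space_mult calculus_scale calculus_coordinate)
qed (simp add: calculus_zero)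

lemma calculus_ev: "\<tau> (\<lambda>t. ev n t s) = ev n x s"
  by (induction s) (simp_all add: calculus_lin calculus_add calculus_scale calculus_sup
      ev_mem_krivine_space)

lemma calculus_mono:
  assumes "h \<in> krivine_space n" "g \<in> krivine_space n" "\<And>t. h t \<le> g t"
  shows "\<tau> h \<le> \<tau> g"
proof -
  have "(\<lambda>t. sup (h t) (g t)) = g" using assms(3) by (simp add: sup_absorb2)
  thus ?thesis using calculus_sup[OF assms(1,2)] by (simp add: le_iff_sup)
qed

text \<open>Preserving suprema makes \<open>\<tau>\<close> monotone, so \<open>\<tau> h\<close> is
  squeezed between the values of two terms, and these are forced by the axioms. Monotonicity thus
  does the work of continuity, and \<open>calculus_limit\<close> expresses \<open>\<tau> h\<close>
  by \<open>x\<close> alone.\<close>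

lemma calculus_close:
  assumes h: "h \<in> krivine_space n" and "0 \<le> \<epsilon>"
    and le: "\<And>t. \<bar>ev n t s - h t\<bar> \<le> \<epsilon> * ev n t (maxabs n)"
  shows "norm (ev n x s - \<tau> h) \<le> \<epsilon> * norm (ev n x (maxabs n))"
proof -
  have "\<bar>ev n x s - \<tau> h\<bar> \<le> \<epsilon> *\<^sub>R ev n x (maxabs n)"
  proof (rule abs_leI)
    have "\<tau> (\<lambda>t. ev n t (Add s (Scale (- \<epsilon>) (maxabs n)))) \<le> \<tau> h"
    proof (intro calculus_mono h ev_mem_krivine_space)
      show "ev n t (Add s (Scale (- \<epsilon>) (maxabs n))) \<le> h t" for t
        using abs_le_D1[OF le[of t]] by simp
    qed
    thus "ev n x s - \<tau> h \<le> \<epsilon> *\<^sub>R ev n x (maxabs n)"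
      unfolding calculus_ev by (simp add: diff_le_eq add.commute)
    have "\<tau> h \<le> \<tau> (\<lambda>t. ev n t (Add s (Scale \<epsilon> (maxabs n))))"
    proof (intro calculus_mono h ev_mem_krivine_space)
      show "h t \<le> ev n t (Add s (Scale \<epsilon> (maxabs n)))" for t
        using abs_le_D2[OF le[of t]] by simp
    qed
    thus "- (ev n x s - \<tau> h) \<le> \<epsilon> *\<^sub>R ev n x (maxabs n)"
      unfolding calculus_ev by (simp add: diff_le_eq add.commute)
  qed
  from norm_le_of_abs_le[OF this] show ?thesis using \<open>0 \<le> \<epsilon>\<close> by simp
qed

lemma calculus_limit:
  assumes h: "h \<in> krivine_space n"
  shows "(\<lambda>m. ev n x (approx n h m)) \<longlonglongrightarrow> \<tau> h"
proof (rule tendsto_of_eventually_le)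
  fix \<epsilon> :: real assume "0 < \<epsilon>"
  show "\<forall>\<^sub>F m in sequentially.
      norm (ev n x (approx n h m) - \<tau> h) \<le> \<epsilon> * norm (ev n x (maxabs n))"
    using approx_close[OF h \<open>0 < \<epsilon>\<close>]
    by eventually_elim (use \<open>0 < \<epsilon>\<close> in \<open>intro calculus_close h, simp_all\<close>)
qed

end

lemma is_krivine_calculus_unique:
  assumes "is_krivine_calculus n x \<tau>" "is_krivine_calculus n x \<tau>'"
  shows "\<tau> = \<tau>'"
proof
  fix h
  show "\<tau> h = \<tau>' h"
    using assms[THEN calculus_limit, of h] assms[THEN calculus_extensional]
    by (cases "h \<in> krivine_space n") (auto dest: LIMSEQ_unique simp: extensional_def)
qed

text \<open>The value at \<open>h\<close> is the limit of the approximating terms evaluated at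
  \<open>x\<close>. Any other sequence of terms that \<open>converges\<close> to \<open>h\<close>
  must have the same limit (\<open>limI\<close>), so each axiom is checked on a convenient sequence,
  such as the sums of the approximations for additivity.\<close>

lemma ex_is_krivine_calculus:
  fixes x :: "nat \<Rightarrow> 'x::banach_lattice"
  shows "\<exists>\<tau>. is_krivine_calculus n x \<tau>"
proof -
  let ?H = "krivine_space n"
  define B where "B = norm (ev n x (maxabs n))"
  define converges :: "(nat \<Rightarrow> lterm) \<Rightarrow> ((nat \<Rightarrow> real) \<Rightarrow> real) \<Rightarrow> bool" where
    "converges f h \<longleftrightarrow> (\<forall>\<epsilon>>0. \<forall>\<^sub>F m in sequentially. \<forall>t. \<bar>ev n t (f m) - h t\<bar> \<le> \<epsilon> * ev n t (maxabs n))"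
    for f h
  have conv_approx: "converges (approx n h) h" if "h \<in> ?H" for h
    using approx_close[OF that] by (simp add: converges_def)
  have same_limit: "\<forall>\<^sub>F p in sequentially \<times>\<^sub>F sequentially.
      norm (ev n x (f (fst p)) - ev n x (g (snd p))) \<le> \<epsilon> * (2 * B)"
    if "converges f h" "converges g h" "0 < \<epsilon>" for f g h \<epsilon>
  proof -
    have "\<forall>\<^sub>F m in sequentially. \<forall>t. \<bar>ev n t (f m) - h t\<bar> \<le> \<epsilon> * ev n t (maxabs n)"
        "\<forall>\<^sub>F m in sequentially. \<forall>t. \<bar>ev n t (g m) - h t\<bar> \<le> \<epsilon> * ev n t (maxabs n)"
      using that unfolding converges_def by blast+
    hence "\<forall>\<^sub>F p in sequentially \<times>\<^sub>F sequentially.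
        (\<forall>t. \<bar>ev n t (f (fst p)) - h t\<bar> \<le> \<epsilon> * ev n t (maxabs n)) \<and>
        (\<forall>t. \<bar>ev n t (g (snd p)) - h t\<bar> \<le> \<epsilon> * ev n t (maxabs n))"
      by (rule eventually_prodI)
    thus ?thesis
    proof eventually_elim
      case (elim p)
      have "\<bar>ev n t (f (fst p)) - ev n t (g (snd p))\<bar> \<le> 2 * \<epsilon> * ev n t (maxabs n)" for t
        using conjunct1[OF elim, THEN spec, of t] conjunct2[OF elim, THEN spec, of t] by linarith
      from norm_ev_diff_le[OF _ this] show ?case using \<open>0 < \<epsilon>\<close> by (simp add: B_def mult_ac)
    qed
  qed
  define \<tau> where "\<tau> = restrict (\<lambda>h. lim (\<lambda>m. ev n x (approx n h m))) ?H"
  have lim: "(\<lambda>m. ev n x (approx n h m)) \<longlonglongrightarrow> \<tau> h" if h: "h \<in> ?H" for h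
  proof -
    have "Cauchy (\<lambda>m. ev n x (approx n h m))"
    proof (rule metric_CauchyI)
      fix e :: real assume "0 < e"
      define \<epsilon> where "\<epsilon> = e / (2 * B + 1)"
      have \<epsilon>: "0 < \<epsilon>" "\<epsilon> * (2 * B) < e"
        using \<open>0 < e\<close> by (simp_all add: \<epsilon>_def B_def field_simps add_pos_nonneg)
      from same_limit[OF conv_approx conv_approx, OF h h \<epsilon>(1)]
      obtain M where M: "\<forall>m\<ge>M. \<forall>k\<ge>M.
          norm (ev n x (approx n h k) - ev n x (approx n h m)) \<le> \<epsilon> * (2 * B)"
        unfolding eventually_prod_sequentially fst_conv snd_conv ..
      show "\<exists>M. \<forall>m\<ge>M. \<forall>k\<ge>M. dist (ev n x (approx n h m)) (ev n x (approx n h k)) < e"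
        unfolding dist_norm
        by (intro exI[of _ M] allI impI le_less_trans[OF M[rule_format] \<epsilon>(2)])
    qed
    thus ?thesis
      using h by (simp add: \<tau>_def Cauchy_convergent_iff convergent_LIMSEQ_iff)
  qed
  have limI: "\<tau> h = y" if h: "h \<in> ?H" and f: "converges f h" "(\<lambda>m. ev n x (f m)) \<longlonglongrightarrow> y" for h f y
  proof -
    have "(\<lambda>m. ev n x (f m) - ev n x (approx n h m)) \<longlonglongrightarrow> 0"
    proof (rule tendsto_of_eventually_le)
      fix \<epsilon> :: real assume "0 < \<epsilon>"
      from same_limit[OF f(1) conv_approx[OF h] this]
      obtain M where M: "\<forall>k\<ge>M. \<forall>m\<ge>M.
          norm (ev n x (f m) - ev n x (approx n h k)) \<le> \<epsilon> * (2 * B)"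
        unfolding eventually_prod_sequentially fst_conv snd_conv ..
      show "\<forall>\<^sub>F m in sequentially.
          norm (ev n x (f m) - ev n x (approx n h m) - 0) \<le> \<epsilon> * (2 * B)"
        unfolding eventually_sequentially diff_0_right
        by (intro exI[of _ M] allI impI M[rule_format])
    qed
    hence "(\<lambda>m. ev n x (f m) - (ev n x (f m) - ev n x (approx n h m))) \<longlonglongrightarrow> y - 0"
      using f(2) by (intro tendsto_diff)
    thus ?thesis using lim[OF h] LIMSEQ_unique by force
  qed
  have "is_krivine_calculus n x \<tau>"
    unfolding is_krivine_calculus_def
  proof (intro conjI ballI allI impI)
    show "\<tau> \<in> extensional ?H" by (simp add: \<tau>_def)
    show "\<tau> (\<lambda>t. t j) = x j" if "j < n" for j
      by (rule limI[of _ "\<lambda>_. coord j"])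
        (use that in \<open>simp_all add: krivine_space_coordinate converges_def lin_unit maxabs_nonneg\<close>)
    fix h assume h: "h \<in> ?H"
    show "\<tau> (\<lambda>t. c * h t) = c *\<^sub>R \<tau> h" for c
    proof (rule limI[of _ "\<lambda>m. Scale c (approx n h m)"])
      show "converges (\<lambda>m. Scale c (approx n h m)) (\<lambda>t. c * h t)"
        unfolding converges_def
      proof (intro allI impI)
        fix \<epsilon> :: real assume "0 < \<epsilon>"
        hence "\<forall>\<^sub>F m in sequentially. \<forall>t. \<bar>ev n t (approx n h m) - h t\<bar> \<le> \<epsilon> / (\<bar>c\<bar> + 1) * ev n t (maxabs n)"
          by (intro approx_close[OF h]) (simp add: add_nonneg_pos)
        thus "\<forall>\<^sub>F m in sequentially. \<forall>t. \<bar>ev n t (Scale c (approx n h m)) - c * h t\<bar> \<le> \<epsilon> * ev n t (maxabs n)"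
        proof eventually_elim
          case (elim m)
          show ?case
          proof
            fix t
            have "\<bar>c * ev n t (approx n h m) - c * h t\<bar> = \<bar>c\<bar> * \<bar>ev n t (approx n h m) - h t\<bar>"
              by (simp add: abs_mult flip: right_diff_distrib)
            also have "\<dots> \<le> (\<bar>c\<bar> + 1) * (\<epsilon> / (\<bar>c\<bar> + 1) * ev n t (maxabs n))"
              using elim by (intro mult_mono) simp_all
            also have "\<dots> = \<epsilon> * ev n t (maxabs n)"
              by (simp add: add_nonneg_eq_0_iff)
            finally show "\<bar>ev n t (Scale c (approx n h m)) - c * h t\<bar> \<le> \<epsilon> * ev n t (maxabs n)"
              by simp
          qed
        qed
      qed
    qed (simp_all add: krivine_space_mult h tendsto_scaleR lim)
    fix g assume g: "g \<in> ?H"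
    have both: "\<forall>\<^sub>F m in sequentially. \<forall>t. \<bar>ev n t (approx n h m) - h t\<bar> \<le> \<epsilon> * ev n t (maxabs n) / 2 \<and>
        \<bar>ev n t (approx n g m) - g t\<bar> \<le> \<epsilon> * ev n t (maxabs n) / 2" if "0 < \<epsilon>" for \<epsilon>
      using approx_close[OF h, of "\<epsilon> / 2"] approx_close[OF g, of "\<epsilon> / 2"] that
      by (simp add: eventually_conj_iff all_conj_distrib)
    show "\<tau> (\<lambda>t. h t + g t) = \<tau> h + \<tau> g"
    proof (rule limI[of _ "\<lambda>m. Add (approx n h m) (approx n g m)"])
      show "converges (\<lambda>m. Add (approx n h m) (approx n g m)) (\<lambda>t. h t + g t)"
        unfolding converges_def
      proof (intro allI impI)
        fix \<epsilon> :: real assume "0 < \<epsilon>"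
        from both[OF this]
        show "\<forall>\<^sub>F m in sequentially. \<forall>t.
            \<bar>ev n t (Add (approx n h m) (approx n g m)) - (h t + g t)\<bar> \<le> \<epsilon> * ev n t (maxabs n)"
        proof (eventually_elim, intro allI)
          fix m t
          assume "\<forall>t. \<bar>ev n t (approx n h m) - h t\<bar> \<le> \<epsilon> * ev n t (maxabs n) / 2 \<and>
            \<bar>ev n t (approx n g m) - g t\<bar> \<le> \<epsilon> * ev n t (maxabs n) / 2"
          hence "\<bar>ev n t (approx n h m) - h t\<bar> + \<bar>ev n t (approx n g m) - g t\<bar>
              \<le> \<epsilon> * ev n t (maxabs n) / 2 + \<epsilon> * ev n t (maxabs n) / 2"
            by (intro add_mono) blast+
          with abs_diff_triangle_ineq[of "ev n t (approx n h m)" "ev n t (approx n g m)" "h t" "g t"]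
          show "\<bar>ev n t (Add (approx n h m) (approx n g m)) - (h t + g t)\<bar> \<le> \<epsilon> * ev n t (maxabs n)"
            unfolding ev.simps field_sum_of_halves by (rule order_trans)
        qed
      qed
    qed (simp_all add: krivine_space_add h g tendsto_add lim)
    show "\<tau> (\<lambda>t. sup (h t) (g t)) = sup (\<tau> h) (\<tau> g)"
    proof (rule limI[of _ "\<lambda>m. Join (approx n h m) (approx n g m)"])
      show "converges (\<lambda>m. Join (approx n h m) (approx n g m)) (\<lambda>t. sup (h t) (g t))"
        unfolding converges_def
      proof (intro allI impI)
        fix \<epsilon> :: real assume "0 < \<epsilon>"
        from both[OF this]
        show "\<forall>\<^sub>F m in sequentially. \<forall>t.
            \<bar>ev n t (Join (approx n h m) (approx n g m)) - sup (h t) (g t)\<bar> \<le> \<epsilon> * ev n t (maxabs n)"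
        proof (eventually_elim, intro allI)
          fix m t
          assume "\<forall>t. \<bar>ev n t (approx n h m) - h t\<bar> \<le> \<epsilon> * ev n t (maxabs n) / 2 \<and>
            \<bar>ev n t (approx n g m) - g t\<bar> \<le> \<epsilon> * ev n t (maxabs n) / 2"
          hence "\<bar>ev n t (approx n h m) - h t\<bar> + \<bar>ev n t (approx n g m) - g t\<bar>
              \<le> \<epsilon> * ev n t (maxabs n) / 2 + \<epsilon> * ev n t (maxabs n) / 2"
            by (intro add_mono) blast+
          with abs_sup_diff_le[of "ev n t (approx n h m)" "ev n t (approx n g m)" "h t" "g t"]
          show "\<bar>ev n t (Join (approx n h m) (approx n g m)) - sup (h t) (g t)\<bar> \<le> \<epsilon> * ev n t (maxabs n)"
            unfolding ev.simps field_sum_of_halves by (rule order_trans)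
        qed
      qed
    qed (simp_all add: krivine_space_sup h g tendsto_sup_banach_lattice lim)
  qed
  thus ?thesis by blast
qed

lemma krivine_calculus: "is_krivine_calculus n x (krivine_calculus n x)"
  unfolding krivine_calculus_def
  using ex_is_krivine_calculus is_krivine_calculus_unique by (metis (no_types, lifting) theI)

lemmas krivine_calculus_mono = calculus_mono[OF krivine_calculus]
  and krivine_calculus_ev = calculus_ev[OF krivine_calculus]
  and krivine_calculus_coordinate = calculus_coordinate[OF krivine_calculus]
  and krivine_calculus_limit = calculus_limit[OF krivine_calculus]

section \<open>The Hahn--Banach theorem\<close>

text \<open>One inequality for positive scalars is enough: applied to the inverse scalar as well, it
  gives equality, see \<open>sublinear_scaleR\<close>.\<close>

definition sublinear :: "('a::real_vector \<Rightarrow> real) \<Rightarrow> bool" where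
  "sublinear p \<longleftrightarrow> (\<forall>x y. p (x + y) \<le> p x + p y) \<and> (\<forall>c>0. \<forall>x. p (c *\<^sub>R x) \<le> c * p x)"

lemma sublinear_add: "sublinear p \<Longrightarrow> p (x + y) \<le> p x + p y"
  and sublinear_scaleR_le: "sublinear p \<Longrightarrow> 0 < c \<Longrightarrow> p (c *\<^sub>R x) \<le> c * p x"
  unfolding sublinear_def by blast+

lemma sublinear_zero:
  assumes "sublinear p"
  shows "p 0 = 0"
  using sublinear_scaleR_le[OF assms, of 2 0] sublinear_scaleR_le[OF assms, of "1/2" 0] by simp

lemma sublinear_scaleR:
  assumes p: "sublinear p" and c: "0 \<le> c"
  shows "p (c *\<^sub>R x) = c * p x"
proof (cases "c = 0")
  case False
  hence "0 < c" using c by simp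
  hence "p (inverse c *\<^sub>R (c *\<^sub>R x)) \<le> inverse c * p (c *\<^sub>R x)"
    by (intro sublinear_scaleR_le[OF p]) simp
  hence "c * p x \<le> p (c *\<^sub>R x)" using \<open>0 < c\<close> by (simp add: field_simps)
  with sublinear_scaleR_le[OF p \<open>0 < c\<close>, of x] show ?thesis by simp
qed (simp add: sublinear_zero[OF p])

lemma sublinear_minus:
  assumes "sublinear p"
  shows "- p (- x) \<le> p x"
  using sublinear_add[OF assms, of x "- x"] sublinear_zero[OF assms] by simp

text \<open>The directional derivative of \<open>q\<close> at \<open>z\<close> is sublinear, lies below \<open>q\<close>, and is linear on
  the line through \<open>z\<close>. Hence a minimal sublinear functional is linear.\<close>

definition dir :: "('a::real_vector \<Rightarrow> real) \<Rightarrow> 'a \<Rightarrow> 'a \<Rightarrow> real" where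
  "dir q z x = (INF l\<in>{0..}. q (x + l *\<^sub>R z) - l * q z)"

context
  fixes q :: "'a::real_vector \<Rightarrow> real" and z :: 'a
  assumes q: "sublinear q"
begin

lemma dir_lower:
  assumes "0 \<le> l"
  shows "dir q z x \<le> q (x + l *\<^sub>R z) - l * q z"
  unfolding dir_def
proof (rule cINF_lower)
  have "- q (- x) \<le> q (x + l *\<^sub>R z) - l * q z" if "0 \<le> l" for l
    using sublinear_add[OF q, of "x + l *\<^sub>R z" "- x"] sublinear_scaleR[OF q that, of z] by simp
  thus "bdd_below ((\<lambda>l. q (x + l *\<^sub>R z) - l * q z) ` {0..})"
    by (intro bdd_belowI2[of _ "- q (- x)"]) simp
qed (use assms in simp)

lemma dir_greatest: "(\<And>l. 0 \<le> l \<Longrightarrow> c \<le> q (x + l *\<^sub>R z) - l * q z) \<Longrightarrow> c \<le> dir q z x"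
  unfolding dir_def by (rule cINF_greatest) auto

lemma dir_le: "dir q z x \<le> q x"
  using dir_lower[of 0 x] by simp

lemma dir_minus: "dir q z (- z) \<le> - q z"
  using dir_lower[of 1 "- z"] sublinear_zero[OF q] by simp

lemma sublinear_dir: "sublinear (dir q z)"
  unfolding sublinear_def
proof (intro conjI allI impI)
  fix x y
  have "dir q z (x + y) - dir q z x \<le> dir q z y"
  proof (rule dir_greatest)
    fix m :: real assume m: "0 \<le> m"
    have "dir q z (x + y) - (q (y + m *\<^sub>R z) - m * q z) \<le> dir q z x"
    proof (rule dir_greatest)
      fix l :: real assume l: "0 \<le> l"
      have "dir q z (x + y) \<le> q (x + y + (l + m) *\<^sub>R z) - (l + m) * q z"
        using l m by (intro dir_lower) simp
      also have "x + y + (l + m) *\<^sub>R z = (x + l *\<^sub>R z) + (y + m *\<^sub>R z)"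
        by (simp add: scaleR_left_distrib)
      also have "q \<dots> \<le> q (x + l *\<^sub>R z) + q (y + m *\<^sub>R z)" by (rule sublinear_add[OF q])
      finally show "dir q z (x + y) - (q (y + m *\<^sub>R z) - m * q z) \<le> q (x + l *\<^sub>R z) - l * q z"
        by (simp add: algebra_simps)
    qed
    thus "dir q z (x + y) - dir q z x \<le> q (y + m *\<^sub>R z) - m * q z" by linarith
  qed
  thus "dir q z (x + y) \<le> dir q z x + dir q z y" by linarith
next
  fix c :: real and x assume c: "0 < c"
  have "dir q z (c *\<^sub>R x) / c \<le> dir q z x"
  proof (rule dir_greatest)
    fix l :: real assume l: "0 \<le> l"
    have "dir q z (c *\<^sub>R x) \<le> q (c *\<^sub>R x + (c * l) *\<^sub>R z) - c * l * q z"
      using l c by (intro dir_lower) simp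
    also have "c *\<^sub>R x + (c * l) *\<^sub>R z = c *\<^sub>R (x + l *\<^sub>R z)" by (simp add: scaleR_right_distrib)
    also have "q \<dots> = c * q (x + l *\<^sub>R z)" using c by (intro sublinear_scaleR[OF q]) simp
    finally have "dir q z (c *\<^sub>R x) \<le> c * (q (x + l *\<^sub>R z) - l * q z)"
      by (simp add: algebra_simps)
    thus "dir q z (c *\<^sub>R x) / c \<le> q (x + l *\<^sub>R z) - l * q z"
      using c by (simp add: divide_le_eq mult.commute)
  qed
  thus "dir q z (c *\<^sub>R x) \<le> c * dir q z x" using c by (simp add: divide_le_eq mult.commute)
qed

end

text \<open>Zorn's lemma for the reversed pointwise order. The pointwise infimum of a chain is
  finite since every sublinear \<open>b\<close> below \<open>p\<close> satisfies
  \<open>b x \<ge> - p (- x)\<close>.\<close>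

lemma ex_minimal_sublinear:
  fixes p :: "'a::real_vector \<Rightarrow> real"
  assumes p: "sublinear p"
  shows "\<exists>m. sublinear m \<and> m \<le> p \<and> (\<forall>q. sublinear q \<longrightarrow> q \<le> m \<longrightarrow> q = m)"
proof -
  define A where "A = {q. sublinear q \<and> q \<le> p}"
  have "\<exists>m\<in>A. \<forall>q\<in>A. q \<le> m \<longrightarrow> q = m"
  proof (rule predicate_Zorn)
    show "partial_order_on A (relation_of (\<lambda>a b. b \<le> a) A)"
      by (rule partial_order_on_relation_ofI) auto
    fix C assume "C \<in> Chains (relation_of (\<lambda>a b. b \<le> a) A)"
    hence C: "C \<subseteq> A" "\<And>a b. a \<in> C \<Longrightarrow> b \<in> C \<Longrightarrow> a \<le> b \<or> b \<le> a"
      unfolding Chains_def relation_of_def by auto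
    show "\<exists>u\<in>A. \<forall>a\<in>C. u \<le> a"
    proof (cases "C = {}")
      case True
      thus ?thesis using p by (auto simp: A_def)
    next
      case False
      define u where "u x = (INF a\<in>C. a x)" for x
      have sub: "sublinear a" "a x \<le> p x" if "a \<in> C" for a x
        using that C(1) by (auto simp: A_def le_fun_def)
      have lower: "u x \<le> a x" if "a \<in> C" for a x
        unfolding u_def
      proof (rule cINF_lower[OF bdd_belowI2 that])
        show "- p (- x) \<le> b x" if "b \<in> C" for b
          using sublinear_minus[OF sub(1)[OF that], of x] sub(2)[OF that, of "- x"] by linarith
      qed
      have greatest: "c \<le> u x" if "\<And>a. a \<in> C \<Longrightarrow> c \<le> a x" for c x
        unfolding u_def using False that by (intro cINF_greatest)
      have "sublinear u"
        unfolding sublinear_def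
      proof (intro conjI allI impI)
        fix x y
        have "u (x + y) - u x \<le> u y"
        proof (rule greatest)
          fix b assume b: "b \<in> C"
          have "u (x + y) - b y \<le> u x"
          proof (rule greatest)
            fix a assume a: "a \<in> C"
            \<comment> \<open>In a chain the smaller of \<open>a\<close> and \<open>b\<close> lies
              below both, so its subadditivity handles the two infima together.\<close>
            obtain d where d: "d \<in> C" "d \<le> a" "d \<le> b" using C(2)[OF a b] a b by blast
            have "u (x + y) \<le> d x + d y"
              using lower[OF d(1)] sublinear_add[OF sub(1)[OF d(1)]] order_trans by blast
            also have "\<dots> \<le> a x + b y" using d by (intro add_mono) (simp_all add: le_fun_def)
            finally show "u (x + y) - b y \<le> a x" by simp
          qed
          thus "u (x + y) - u x \<le> b y" by linarith
        qed
        thus "u (x + y) \<le> u x + u y" by linarith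
      next
        fix c :: real and x assume c: "0 < c"
        have "u (c *\<^sub>R x) / c \<le> u x"
        proof (rule greatest)
          fix a assume a: "a \<in> C"
          have "u (c *\<^sub>R x) \<le> c * a x"
            using lower[OF a] sublinear_scaleR_le[OF sub(1)[OF a] c] order_trans by blast
          thus "u (c *\<^sub>R x) / c \<le> a x" using c by (simp add: divide_le_eq mult.commute)
        qed
        thus "u (c *\<^sub>R x) \<le> c * u x" using c by (simp add: divide_le_eq mult.commute)
      qed
      moreover obtain a where "a \<in> C" using False by blast
      hence "u \<le> p" using lower sub(2) by (meson le_funI order_trans)
      ultimately show ?thesis using lower by (auto simp: A_def le_fun_def)
    qed
  qed
  then obtain m where m: "m \<in> A" "\<forall>q\<in>A. q \<le> m \<longrightarrow> q = m" by blast
  have "q = m" if "sublinear q" "q \<le> m" for q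
    using m that order_trans[of q m p] by (auto simp: A_def)
  thus ?thesis using m(1) by (auto simp: A_def)
qed

text \<open>Minimality gives \<open>dir m y = m\<close> for every \<open>y\<close>, which yields
  additivity. Minimising below \<open>dir p z\<close> instead of \<open>p\<close> forces
  \<open>m (- z) \<le> - p z\<close>, so that equality holds at \<open>z\<close>.\<close>

theorem hahn_banach:
  assumes p: "sublinear p"
  shows "\<exists>f. linear f \<and> (\<forall>x. f x \<le> p x) \<and> f z = p z"
proof -
  obtain m where m: "sublinear m" "m \<le> dir p z" "\<And>q. sublinear q \<Longrightarrow> q \<le> m \<Longrightarrow> q = m"
    using ex_minimal_sublinear[OF sublinear_dir[OF p, of z]] by blast
  have "dir m y = m" for y
    by (rule m(3)[OF sublinear_dir[OF m(1)]]) (simp add: le_fun_def dir_le[OF m(1)])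
  hence "m x \<le> m (x + y) - m y" for x y
    using dir_lower[OF m(1), of 1 y x] by simp
  hence add: "m (x + y) = m x + m y" for x y
    using sublinear_add[OF m(1), of x y] by (simp add: antisym le_diff_eq)
  have minus: "m (- x) = - m x" for x
    using add[of x "- x"] sublinear_zero[OF m(1)] by simp
  have "linear m"
  proof (rule linearI)
    show "m (c *\<^sub>R x) = c *\<^sub>R m x" for c x
      using sublinear_scaleR[OF m(1), of c x] sublinear_scaleR[OF m(1), of "- c" x] minus[of "c *\<^sub>R x"]
      by (cases "0 \<le> c") simp_all
  qed (rule add)
  moreover have "m x \<le> p x" for x
    using m(2) dir_le[OF p] by (meson le_funD order_trans)
  moreover have "p z \<le> m z"
    using le_funD[OF m(2), of "- z"] dir_minus[OF p, of z] minus[of z] by linarith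
  ultimately show ?thesis by (metis order_antisym)
qed

lemma bounded_linear_of_le:
  fixes f :: "'a::real_normed_vector \<Rightarrow> real"
  assumes f: "linear f" and le: "\<And>x. f x \<le> c * norm x"
  shows "bounded_linear f" "\<And>x. \<bar>f x\<bar> \<le> c * norm x"
proof -
  show *: "\<bar>f x\<bar> \<le> c * norm x" for x
    using le[of x] le[of "- x"] linear_neg[OF f, of x] by simp
  show "bounded_linear f"
    by (rule bounded_linear_intro[where K = c])
      (use * in \<open>simp_all add: linear_add[OF f] linear_scale[OF f] mult.commute\<close>)
qed

text \<open>Tuples are viewed as elements of the vector space \<^typ>\<open>nat \<Rightarrow>\<^sub>C 'e\<close> since \<^typ>\<open>nat \<Rightarrow> 'e\<close> is not an instance of \<^class>\<open>real_vector\<close>.\<close>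

theorem hahn_banach_tuple:
  fixes p :: "(nat \<Rightarrow> 'e::real_normed_vector) \<Rightarrow> real"
  assumes cong: "\<And>v w. (\<And>i. i < n \<Longrightarrow> v i = w i) \<Longrightarrow> p v = p w"
    and add: "\<And>v w. p (\<lambda>i. v i + w i) \<le> p v + p w"
    and scale: "\<And>c v. 0 < c \<Longrightarrow> p (\<lambda>i. c *\<^sub>R v i) \<le> c * p v"
    and bound: "\<And>i y. i < n \<Longrightarrow> p (\<lambda>j. if j = i then y else 0) \<le> B i * norm y"
  shows "\<exists>\<phi>. (\<forall>v. (\<Sum>i<n. functional (\<phi> i) (v i)) \<le> p v) \<and> (\<Sum>i<n. functional (\<phi> i) (w i)) = p w"
proof -
  define e :: "nat \<Rightarrow> 'e \<Rightarrow> nat \<Rightarrow>\<^sub>C 'e" where "e i y = Bcontfun (\<lambda>j. if j = i then y else 0)" for i y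
  have e: "apply_bcontfun (e i y) j = (if j = i then y else 0)" for i y j
    unfolding e_def by (subst Bcontfun_inverse) (auto intro!: bcontfun_normI[of _ "norm y"])
  have e_add: "e i (y + y') = e i y + e i y'" for i y y'
    by (rule bcontfun_eqI) (simp add: e plus_bcontfun.rep_eq)
  have e_scale: "e i (c *\<^sub>R y) = c *\<^sub>R e i y" for i c y
    by (rule bcontfun_eqI) (simp add: e scaleR_bcontfun.rep_eq)
  have e_sum: "apply_bcontfun (\<Sum>i<m. e i (v i)) j = (if j < m then v j else 0)" for v m j
    by (induction m) (auto simp: e plus_bcontfun.rep_eq zero_bcontfun.rep_eq)
  have "sublinear (\<lambda>g. p (apply_bcontfun g))"
    unfolding sublinear_def plus_bcontfun.rep_eq scaleR_bcontfun.rep_eq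
    using add scale by blast
  from hahn_banach[OF this, of "\<Sum>i<n. e i (w i)"]
  obtain f where f: "linear f" "\<And>g. f g \<le> p (apply_bcontfun g)"
    "f (\<Sum>i<n. e i (w i)) = p (apply_bcontfun (\<Sum>i<n. e i (w i)))" by blast
  have p_eq: "p (apply_bcontfun (\<Sum>i<n. e i (v i))) = p v" for v
    by (rule cong) (simp add: e_sum)
  define \<phi> where "\<phi> i = Dual (Blinfun (\<lambda>y. f (e i y)))" for i
  have \<phi>: "functional (\<phi> i) y = f (e i y)" if "i < n" for i y
  proof -
    have "linear (\<lambda>y. f (e i y))"
      by (rule linearI) (simp_all add: e_add e_scale linear_add[OF f(1)] linear_scale[OF f(1)])
    moreover have "f (e i y) \<le> B i * norm y" for y
      using f(2)[of "e i y"] bound[OF that, of y] unfolding e[abs_def] by (rule order_trans)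
    ultimately have "bounded_linear (\<lambda>y. f (e i y))" by (rule bounded_linear_of_le)
    thus ?thesis by (simp add: \<phi>_def Dual_inverse bounded_linear_Blinfun_apply)
  qed
  have sum: "(\<Sum>i<n. functional (\<phi> i) (v i)) = f (\<Sum>i<n. e i (v i))" for v
    by (simp add: \<phi> linear_sum[OF f(1)])
  have "f (\<Sum>i<n. e i (v i)) \<le> p v" for v
    using f(2)[of "\<Sum>i<n. e i (v i)"] by (simp add: p_eq)
  thus ?thesis using f(3) by (auto simp: sum p_eq intro!: exI[of _ \<phi>])
qed

section \<open>Duality of lattice norms\<close>

lemma krivine_calculus_cong:
  "(\<And>i. i < n \<Longrightarrow> x i = y i) \<Longrightarrow> krivine_calculus n x = krivine_calculus n y"
  unfolding krivine_calculus_def is_krivine_calculus_def by (simp cong: conj_cong)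

text \<open>The last clause does two things: it makes \<open>N\<close> monotone in the moduli, and
  it makes \<open>N\<close> ignore all coordinates from \<open>n\<close> on. Because of the latter,
  \<open>N\<close> can only be a seminorm on sequences.\<close>

definition lattice_seminorm :: "nat \<Rightarrow> ((nat \<Rightarrow> real) \<Rightarrow> real) \<Rightarrow> bool" where
  "lattice_seminorm n N \<longleftrightarrow>
    (\<forall>s t. N (\<lambda>i. s i + t i) \<le> N s + N t) \<and>
    (\<forall>c t. N (\<lambda>i. c * t i) = \<bar>c\<bar> * N t) \<and>
    (\<forall>s t. (\<forall>i<n. \<bar>s i\<bar> \<le> \<bar>t i\<bar>) \<longrightarrow> N s \<le> N t)"

context
  fixes n N
  assumes N: "lattice_seminorm n N"
begin

lemma seminorm_add: "N (\<lambda>i. s i + t i) \<le> N s + N t"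
  and seminorm_scale: "N (\<lambda>i. c * t i) = \<bar>c\<bar> * N t"
  and seminorm_mono: "(\<And>i. i < n \<Longrightarrow> \<bar>s i\<bar> \<le> \<bar>t i\<bar>) \<Longrightarrow> N s \<le> N t"
  using N unfolding lattice_seminorm_def by blast+

lemma seminorm_cong: "(\<And>i. i < n \<Longrightarrow> \<bar>s i\<bar> = \<bar>t i\<bar>) \<Longrightarrow> N s = N t"
  by (intro antisym seminorm_mono) simp_all

lemma seminorm_zero: "N (\<lambda>i. 0) = 0"
  using seminorm_scale[of 0 "\<lambda>_. 0"] by simp

lemma seminorm_nonneg: "0 \<le> N t"
  using seminorm_mono[of "\<lambda>_. 0" t] by (simp add: seminorm_zero)

lemma seminorm_le_const: "(\<And>i. i < n \<Longrightarrow> \<bar>t i\<bar> \<le> c) \<Longrightarrow> 0 \<le> c \<Longrightarrow> N t \<le> c * N (\<lambda>_. 1)"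
  using seminorm_mono[of t "\<lambda>i. c * 1"] seminorm_scale[of c "\<lambda>_. 1"] by simp

lemma seminorm_diff_le: "N s \<le> N t + N (\<lambda>i. s i - t i)"
  using seminorm_add[of t "\<lambda>i. s i - t i"] by simp

lemma seminorm_diff_commute: "N (\<lambda>i. s i - t i) = N (\<lambda>i. t i - s i)"
  by (rule seminorm_cong) (simp add: abs_minus_commute)

text \<open>Continuity holds because \<open>N\<close> is Lipschitz for the maximum norm, with
  constant \<open>N (\<lambda>_. 1)\<close>.\<close>

lemma seminorm_mem_krivine_space: "N \<in> krivine_space n"
  unfolding krivine_space_def
proof (intro CollectI conjI allI impI)
  show "N s = N t" if "\<forall>i<n. s i = t i" for s t
    using that by (intro seminorm_cong) simp
  show "N (\<lambda>i. c * t i) = c * N t" if "0 \<le> c" for c t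
    using that by (simp add: seminorm_scale)
  show "continuous_on UNIV N"
    unfolding continuous_on_def
  proof (intro ballI, rule LIM_zero_cancel, rule Lim_null_comparison)
    fix t :: "nat \<Rightarrow> real"
    have "\<bar>N s - N t\<bar> \<le> ev n (\<lambda>i. s i - t i) (maxabs n) * N (\<lambda>_. 1)" for s
    proof -
      have "N (\<lambda>i. s i - t i) \<le> ev n (\<lambda>i. s i - t i) (maxabs n) * N (\<lambda>_. 1)"
        using maxabs_ge[of _ n "\<lambda>i. s i - t i"] maxabs_nonneg by (intro seminorm_le_const)
      thus ?thesis
        using seminorm_diff_le[of s t] seminorm_diff_le[of t s] seminorm_diff_commute[of s t]
        by linarith
    qed
    thus "\<forall>\<^sub>F s in at t within UNIV. norm (N s - N t) \<le> ev n (\<lambda>i. s i - t i) (maxabs n) * N (\<lambda>_. 1)"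
      by simp
    have "continuous_on UNIV (\<lambda>s. ev n (\<lambda>i. s i - t i) (maxabs n))"
      by (rule continuous_on_compose2[OF krivine_space_continuous[OF ev_mem_krivine_space]])
        (auto intro!: continuous_on_coordinatewise_then_product continuous_intros)
    hence "((\<lambda>s. ev n (\<lambda>i. s i - t i) (maxabs n)) \<longlongrightarrow> ev n (\<lambda>i. t i - t i) (maxabs n)) (at t within UNIV)"
      unfolding continuous_on_def by blast
    moreover have "ev n (\<lambda>i. t i - t i) (maxabs n) = 0"
      using maxabs_le[of 0 n "\<lambda>i. t i - t i"] maxabs_nonneg[of n "\<lambda>i. t i - t i"] by simp
    ultimately show "((\<lambda>s. ev n (\<lambda>i. s i - t i) (maxabs n) * N (\<lambda>_. 1)) \<longlongrightarrow> 0) (at t within UNIV)"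
      by (intro tendsto_mult_left_zero) simp
  qed
qed

end

lemma functional_sum: "functional (\<Sum>i\<in>A. \<phi> i) u = (\<Sum>i\<in>A. functional (\<phi> i) u)"
  by (induction A rule: infinite_finite_induct)
    (simp_all add: functional_simps blinfun.add_left)

lemma functional_lin: "functional (lin n \<phi> a) u = (\<Sum>i<n. a i * functional (\<phi> i) u)"
  by (simp add: lin_def functional_sum functional_simps blinfun.scaleR_left)

lemma functional_le: "functional \<phi> u \<le> norm \<phi> * norm u"
  using norm_blinfun[of "functional \<phi>" u] by (simp add: functional_simps)

lemma scaleR_le_abs:
  fixes y :: "'v::{lattice_ab_group_add_abs,ordered_real_vector}"
  shows "c *\<^sub>R y \<le> \<bar>c\<bar> *\<^sub>R \<bar>y\<bar>"
proof (cases "0 \<le> c")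
  case False
  hence "(- c) *\<^sub>R (- y) \<le> (- c) *\<^sub>R \<bar>y\<bar>" by (intro scaleR_left_mono abs_ge_minus_self) simp
  thus ?thesis using False by simp
qed (simp add: scaleR_left_mono[OF abs_ge_self])

text \<open>The join of \<open>F\<close> enters through two properties: it dominates
  \<open>F\<close> at real tuples, and it is below every upper bound at the given \<open>x\<close>.
  These are what \<open>K_least\<close> combines.\<close>

lemma ex_join:
  fixes x :: "nat \<Rightarrow> 'v::{lattice_ab_group_add,ordered_real_vector}"
  assumes "finite F" "F \<noteq> {}"
  shows "\<exists>s. (\<forall>t::nat \<Rightarrow> real. \<forall>b\<in>F. lin n t b \<le> ev n t s) \<and> (\<forall>z. (\<forall>b\<in>F. lin n x b \<le> z) \<longrightarrow> ev n x s \<le> z)"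
  using assms
proof (induction rule: finite_ne_induct)
  case (singleton b)
  show ?case by (rule exI[of _ "Lin b"]) simp
next
  case (insert b F)
  then obtain s where "\<forall>t::nat \<Rightarrow> real. \<forall>b\<in>F. lin n t b \<le> ev n t s"
    "\<forall>z. (\<forall>b\<in>F. lin n x b \<le> z) \<longrightarrow> ev n x s \<le> z" by blast
  thus ?case by (intro exI[of _ "Join (Lin b) s"]) (auto intro: le_supI2)
qed

section \<open>Dual pairs of seminorms and the supremum formula\<close>

locale norm_pair =
  fixes n :: nat and N N' :: "(nat \<Rightarrow> real) \<Rightarrow> real"
  assumes N: "lattice_seminorm n N" and N': "lattice_seminorm n N'"
    and pairing: "\<And>b t. lin n t b \<le> N' b * N t"
    and norming: "\<And>t c. 0 \<le> c \<Longrightarrow> (\<And>b. N' b \<le> 1 \<Longrightarrow> lin n t b \<le> c) \<Longrightarrow> N t \<le> c"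
    and norming': "\<And>b c. 0 \<le> c \<Longrightarrow> (\<And>t. N t \<le> 1 \<Longrightarrow> lin n t b \<le> c) \<Longrightarrow> N' b \<le> c"
begin

lemma lin_commute: "lin n t b = lin n b (t :: nat \<Rightarrow> real)"
  by (simp add: lin_def mult.commute)

text \<open>With norming assumed in both directions the situation is symmetric, so all facts about
  \<open>K\<close> also hold for \<open>N'\<close> and tuples of the dual lattice, where they appear
  as \<open>swap.K\<close>.\<close>

lemma swap: "norm_pair n N' N"
proof
  show "lin n t b \<le> N b * N' t" for b t
    using pairing[of b t] by (simp add: lin_commute[of t] mult.commute)
  show "N' t \<le> c" if "0 \<le> c" "\<And>b. N b \<le> 1 \<Longrightarrow> lin n t b \<le> c" for t c
    using norming'[OF that(1), of t] that(2) by (simp add: lin_commute[of t])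
  show "N b \<le> c" if "0 \<le> c" "\<And>t. N' t \<le> 1 \<Longrightarrow> lin n t b \<le> c" for b c
    using norming[OF that(1), of b] that(2) by (simp add: lin_commute[of _ b])
qed (fact N N')+

lemma ex_nearly_norming:
  assumes "0 < \<epsilon>"
  shows "\<exists>b. N' b \<le> 1 \<and> N t - \<epsilon> \<le> lin n t b"
proof (rule ccontr)
  assume "\<not> ?thesis"
  hence *: "lin n t b \<le> N t - \<epsilon>" if "N' b \<le> 1" for b using that by force
  have "0 \<le> N t - \<epsilon>" using *[of "\<lambda>_. 0"] by (simp add: seminorm_zero[OF N'] lin_zero)
  from norming[OF this *] show False using assms by simp
qed

abbreviation K :: "(nat \<Rightarrow> 'x::banach_lattice) \<Rightarrow> 'x" where
  "K x \<equiv> krivine_calculus n x N"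

lemma lin_le_K: "lin n x b \<le> N' b *\<^sub>R K x"
proof -
  have "krivine_calculus n x (\<lambda>t. ev n t (Lin b)) \<le> krivine_calculus n x (\<lambda>t. N' b * N t)"
    using pairing
    by (intro krivine_calculus_mono ev_mem_krivine_space krivine_space_mult
        seminorm_mem_krivine_space[OF N]) simp
  thus ?thesis
    unfolding krivine_calculus_ev calculus_scale[OF krivine_calculus seminorm_mem_krivine_space[OF N]]
    by simp
qed

lemma K_nonneg: "0 \<le> K x"
proof -
  have "krivine_calculus n x (\<lambda>t. ev n t (Lin (\<lambda>_. 0))) \<le> K x"
    using seminorm_nonneg[OF N]
    by (intro krivine_calculus_mono ev_mem_krivine_space seminorm_mem_krivine_space[OF N])
      (simp add: lin_zero)
  thus ?thesis unfolding krivine_calculus_ev by (simp add: lin_zero)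
qed

lemma lin_le_K1: "N' b \<le> 1 \<Longrightarrow> lin n x b \<le> K x"
  using lin_le_K[of x b] scaleR_right_mono[OF _ K_nonneg[of x], of "N' b" 1] by simp

text \<open>With \<open>lin_le_K1\<close> this says that \<open>K x\<close> is the supremum of the
  forms \<open>lin n x b\<close>. Choosing a nearly norming \<open>b\<close> for each point of a
  finite net gives a finite join that reaches \<open>N\<close> up to \<open>\<epsilon>\<close> times
  \<open>maxabs\<close>; monotonicity of the calculus carries this to \<open>x\<close>, where
  \<open>z\<close> bounds the join.\<close>

lemma K_least:
  assumes z: "\<And>b. N' b \<le> 1 \<Longrightarrow> lin n x b \<le> z"
  shows "K x \<le> z"
proof (rule le_of_le_add_scaleR)
  fix \<epsilon> :: real assume "0 < \<epsilon>"
  \<comment> \<open>Replacing \<open>t\<close> by \<open>m\<close> times a net point costs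
    \<open>d\<close> twice, together at most half of \<open>\<epsilon> * m\<close>; the other half
    is spent on nearly norming the net point. The added \<open>1\<close> covers
    \<open>N (\<lambda>_. 1) = 0\<close>.\<close>
  define \<eta> where "\<eta> = \<epsilon> / (4 * (N (\<lambda>_. 1) + 1))"
  have N1: "0 \<le> N (\<lambda>_. 1)" by (rule seminorm_nonneg[OF N])
  hence \<eta>: "0 < \<eta>" using \<open>0 < \<epsilon>\<close> by (simp add: \<eta>_def)
  have "4 * (\<eta> * (N (\<lambda>_. 1) + 1)) = \<epsilon>" using N1 by (simp add: \<eta>_def field_simps)
  moreover have "\<eta> * N (\<lambda>_. 1) \<le> \<eta> * (N (\<lambda>_. 1) + 1)" using \<eta> by (intro mult_left_mono) simp_all
  ultimately have \<eta>N: "2 * (\<eta> * N (\<lambda>_. 1)) \<le> \<epsilon> / 2" by linarith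
  obtain as where as: "cube_net n \<eta> as" using ex_cube_net[OF \<eta>] by blast
  have "\<forall>a. \<exists>b. N' b \<le> 1 \<and> N a - \<epsilon> / 2 \<le> lin n a b"
    using \<open>0 < \<epsilon>\<close> by (intro allI ex_nearly_norming) simp
  then obtain \<beta> where \<beta>: "\<And>a. N' (\<beta> a) \<le> 1" "\<And>a. N a - \<epsilon> / 2 \<le> lin n a (\<beta> a)" by metis
  have "set as \<noteq> {}" using cube_net_scaled[OF as, of "\<lambda>_. 0" 0] by auto
  hence "\<beta> ` set as \<noteq> {}" by simp
  from ex_join[OF finite_imageI[OF finite_set] this, of n x]
  obtain s where s: "\<forall>t::nat \<Rightarrow> real. \<forall>b\<in>\<beta> ` set as. lin n t b \<le> ev n t s"
    "\<forall>z. (\<forall>b\<in>\<beta> ` set as. lin n x b \<le> z) \<longrightarrow> ev n x s \<le> z" by blast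
  have "K x \<le> krivine_calculus n x (\<lambda>t. ev n t (Add s (Scale \<epsilon> (maxabs n))))"
  proof (intro krivine_calculus_mono ev_mem_krivine_space seminorm_mem_krivine_space[OF N])
    fix t :: "nat \<Rightarrow> real"
    define m where "m = ev n t (maxabs n)"
    have m: "0 \<le> m" by (simp add: m_def maxabs_nonneg)
    have "\<exists>a\<in>set as. \<forall>i<n. \<bar>t i - a i * m\<bar> \<le> \<eta> * m"
      unfolding m_def by (rule cube_net_scaled[OF as maxabs_ge maxabs_nonneg])
    then obtain a where a: "a \<in> set as" "\<forall>i<n. \<bar>t i - a i * m\<bar> \<le> \<eta> * m" ..
    define d where "d = \<eta> * m * N (\<lambda>_. 1)"
    have d: "N (\<lambda>i. t i - m * a i) \<le> d" "N (\<lambda>i. m * a i - t i) \<le> d"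
      unfolding d_def using a(2) m \<eta>
      by (intro seminorm_le_const[OF N]; simp add: mult.commute abs_minus_commute)+
    have "lin n (\<lambda>i. m * a i - t i) (\<beta> a) \<le> N' (\<beta> a) * N (\<lambda>i. m * a i - t i)"
      by (rule pairing)
    also have "\<dots> \<le> 1 * N (\<lambda>i. m * a i - t i)"
      by (intro mult_right_mono \<beta> seminorm_nonneg[OF N])
    finally have "m * lin n a (\<beta> a) - lin n t (\<beta> a) \<le> d"
      using d(2) by (simp add: lin_def right_diff_distrib sum_subtractf sum_distrib_left mult_ac)
    moreover have "N t \<le> m * N a + d"
      using seminorm_diff_le[OF N, of t "\<lambda>i. m * a i"] d(1) m by (simp add: seminorm_scale[OF N])
    moreover have "m * N a \<le> m * (lin n a (\<beta> a) + \<epsilon> / 2)"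
      using \<beta>(2)[of a] m by (intro mult_left_mono) simp_all
    moreover have "2 * d \<le> m * (\<epsilon> / 2)"
      using mult_left_mono[OF \<eta>N m] by (simp add: d_def mult_ac)
    ultimately have "N t \<le> lin n t (\<beta> a) + \<epsilon> * m" by (simp add: algebra_simps)
    thus "N t \<le> ev n t (Add s (Scale \<epsilon> (maxabs n)))"
      using s(1)[THEN spec, of t, THEN bspec, OF imageI[OF a(1)]] by (simp add: m_def)
  qed
  also have "\<dots> = ev n x s + \<epsilon> *\<^sub>R ev n x (maxabs n)" 
    unfolding krivine_calculus_ev by simp
  also have "\<dots> \<le> z + \<epsilon> *\<^sub>R ev n x (maxabs n)"
    using s(2) z \<beta>(1) by (intro add_right_mono) blast
  finally show "K x \<le> z + \<epsilon> *\<^sub>R ev n x (maxabs n)" .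
qed

text \<open>The three values come from calculi of different tuples, which the axioms do not relate;
  the linear forms of the supremum formula do.\<close>

lemma K_add: "K (\<lambda>i. x i + y i) \<le> K x + K y"
proof (rule K_least)
  fix b assume b: "N' b \<le> 1"
  have "lin n (\<lambda>i. x i + y i) b = lin n x b + lin n y b"
    by (simp add: lin_def scaleR_right_distrib sum.distrib)
  also have "\<dots> \<le> K x + K y" using b by (intro add_mono lin_le_K1)
  finally show "lin n (\<lambda>i. x i + y i) b \<le> K x + K y" .
qed

lemma K_scale:
  assumes "0 \<le> c"
  shows "K (\<lambda>i. c *\<^sub>R x i) \<le> c *\<^sub>R K x"
proof (rule K_least)
  fix b assume b: "N' b \<le> 1"
  have "lin n (\<lambda>i. c *\<^sub>R x i) b = c *\<^sub>R lin n x b"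
    by (simp add: lin_def scaleR_sum_right mult.commute)
  also have "\<dots> \<le> c *\<^sub>R K x" using b assms by (intro scaleR_left_mono lin_le_K1)
  finally show "lin n (\<lambda>i. c *\<^sub>R x i) b \<le> c *\<^sub>R K x" .
qed

text \<open>Used to test a functional on the tuples \<open>a i *\<^sub>R u\<close>, whose calculus
  stays below \<open>u\<close> when \<open>N a \<le> 1\<close>.\<close>

lemma K_ray:
  assumes "0 \<le> u"
  shows "K (\<lambda>i. a i *\<^sub>R u) \<le> N a *\<^sub>R u"
proof (rule K_least)
  fix b assume b: "N' b \<le> 1"
  have "lin n (\<lambda>i. a i *\<^sub>R u) b = lin n a b *\<^sub>R u"
    by (simp add: lin_def scaleR_sum_left)
  also have "lin n a b \<le> 1 * N a"
    using pairing[of a b] mult_right_mono[OF b seminorm_nonneg[OF N, of a]] by linarith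
  hence "lin n a b *\<^sub>R u \<le> N a *\<^sub>R u" using assms by (intro scaleR_right_mono) simp
  finally show "lin n (\<lambda>i. a i *\<^sub>R u) b \<le> N a *\<^sub>R u" .
qed

text \<open>The continuity bound that \<open>hahn_banach_tuple\<close> asks for when the seminorm is
  the norm of \<open>K\<close>.\<close>

lemma norm_K_single:
  assumes "i < n"
  shows "norm (K (\<lambda>j. if j = i then y else 0)) \<le> N (\<lambda>j. if j = i then 1 else 0) * norm y"
proof -
  let ?e = "\<lambda>j. if j = i then 1 else 0 :: real"
  have "K (\<lambda>j. if j = i then y else 0) \<le> N ?e *\<^sub>R \<bar>y\<bar>"
  proof (rule K_least)
    fix b assume b: "N' b \<le> 1"
    have "N' b * N ?e \<le> 1 * N ?e" by (intro mult_right_mono b seminorm_nonneg[OF N])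
    moreover have "b i \<le> N' b * N ?e"
      using pairing[of ?e b] lin_unit[OF assms, of b] by (simp add: lin_commute[of _ b])
    moreover have "- b i \<le> N' b * N (\<lambda>j. - 1 * ?e j)"
      using pairing[of "\<lambda>j. - 1 * ?e j" b] lin_scale[of n b "- 1" ?e] lin_unit[OF assms, of b]
      by (simp add: lin_commute[of _ b])
    ultimately have "\<bar>b i\<bar> \<le> N ?e"
      unfolding seminorm_scale[OF N, of "- 1" ?e] by simp
    have "lin n (\<lambda>j. if j = i then y else 0) b = b i *\<^sub>R y"
      using assms by (simp add: lin_def if_distrib[of "(*\<^sub>R) _"] cong: if_cong)
    also have "\<dots> \<le> \<bar>b i\<bar> *\<^sub>R \<bar>y\<bar>" by (rule scaleR_le_abs)
    also have "\<dots> \<le> N ?e *\<^sub>R \<bar>y\<bar>"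
      using \<open>\<bar>b i\<bar> \<le> N ?e\<close> by (intro scaleR_right_mono) simp_all
    finally show "lin n (\<lambda>j. if j = i then y else 0) b \<le> N ?e *\<^sub>R \<bar>y\<bar>" .
  qed
  from norm_mono_pos[OF K_nonneg this] show ?thesis
    using seminorm_nonneg[OF N, of ?e] by (simp add: norm_abs_lattice)
qed

end

section \<open>The Hoelder inequality and its sharpness\<close>

lemma real_le_of_le_add_mult:
  fixes a b c :: real
  assumes "\<And>\<delta>. 0 < \<delta> \<Longrightarrow> a \<le> b + \<delta> * c"
  shows "a \<le> b"
proof (rule field_le_epsilon)
  fix e :: real assume "0 < e"
  have "a \<le> b + e / (\<bar>c\<bar> + 1) * c" using \<open>0 < e\<close> by (intro assms) (simp add: add_nonneg_pos)
  also have "e / (\<bar>c\<bar> + 1) * c \<le> e / (\<bar>c\<bar> + 1) * (\<bar>c\<bar> + 1)"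
    using \<open>0 < e\<close> by (intro mult_left_mono) simp_all
  also have "\<dots> = e" by (simp add: add_nonneg_eq_0_iff)
  finally show "a \<le> b + e" by simp
qed

context norm_pair
begin

lemma functional_lin_le:
  assumes "0 \<le> u"
  shows "(\<Sum>i<n. a i * functional (\<phi> i) u) \<le> N a * functional (krivine_calculus n \<phi> N') u"
proof -
  interpret swap: norm_pair n N' N by (rule swap)
  have "functional (lin n \<phi> a) u \<le> functional (N a *\<^sub>R swap.K \<phi>) u"
    using swap.lin_le_K[of \<phi> a] assms by (simp add: less_eq_dual.rep_eq)
  thus ?thesis by (simp add: functional_lin functional_simps blinfun.scaleR_left)
qed

text \<open>Coordinates and \<open>N\<close> are interpolated with the same increments
  \<open>u\<close>. These are nonnegative in the lattice since \<open>cover\<close> grows by joins,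
  so \<open>functional_lin_le\<close> applies to each summand.\<close>

lemma holder_interp:
  "(\<Sum>i<n. functional (\<phi> i) (ev n x (interp n \<delta> (\<lambda>t. t i) as)))
    \<le> functional (krivine_calculus n \<phi> N') (ev n x (interp n \<delta> N as))"
proof (induction as)
  case Nil
  show ?case by (simp add: lin_zero blinfun.zero_right)
next
  case (Cons a as)
  define u where "u = ev n x (cover n \<delta> (a # as)) - ev n x (cover n \<delta> as)"
  have "0 \<le> u" by (simp add: u_def)
  have step: "ev n x (interp n \<delta> h (a # as)) = h a *\<^sub>R u + ev n x (interp n \<delta> h as)" for h
    by (simp add: u_def)
  have "(\<Sum>i<n. functional (\<phi> i) (ev n x (interp n \<delta> (\<lambda>t. t i) (a # as)))) =
      (\<Sum>i<n. a i * functional (\<phi> i) u) + (\<Sum>i<n. functional (\<phi> i) (ev n x (interp n \<delta> (\<lambda>t. t i) as)))"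
    by (simp only: step blinfun.add_right blinfun.scaleR_right sum.distrib real_scaleR_def)
  also have "\<dots> \<le> N a * functional (krivine_calculus n \<phi> N') u +
      functional (krivine_calculus n \<phi> N') (ev n x (interp n \<delta> N as))"
    by (intro add_mono functional_lin_le \<open>0 \<le> u\<close> Cons.IH)
  also have "\<dots> = functional (krivine_calculus n \<phi> N') (ev n x (interp n \<delta> N (a # as)))"
    by (simp only: step blinfun.add_right blinfun.scaleR_right real_scaleR_def)
  finally show ?case .
qed

lemma holder:
  "(\<Sum>i<n. functional (\<phi> i) (x i)) \<le> functional (krivine_calculus n \<phi> N') (K x)"
proof (rule LIMSEQ_le)
  show "(\<lambda>m. \<Sum>i<n. functional (\<phi> i) (ev n x (approx n (\<lambda>t. t i) m))) \<longlonglongrightarrow>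
      (\<Sum>i<n. functional (\<phi> i) (x i))"
  proof (rule tendsto_sum)
    fix i assume "i \<in> {..<n}"
    hence "(\<lambda>m. ev n x (approx n (\<lambda>t. t i) m)) \<longlonglongrightarrow> x i"
      using krivine_calculus_limit[OF krivine_space_coordinate, of i n x]
      by (simp add: krivine_calculus_coordinate)
    thus "(\<lambda>m. functional (\<phi> i) (ev n x (approx n (\<lambda>t. t i) m))) \<longlonglongrightarrow> functional (\<phi> i) (x i)"
      by (rule bounded_linear.tendsto[OF blinfun.bounded_linear_right])
  qed
  show "(\<lambda>m. functional (krivine_calculus n \<phi> N') (ev n x (approx n N m))) \<longlonglongrightarrow>
      functional (krivine_calculus n \<phi> N') (K x)"
    by (intro bounded_linear.tendsto[OF blinfun.bounded_linear_right] krivine_calculus_limit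
        seminorm_mem_krivine_space[OF N])
  show "\<exists>M. \<forall>m\<ge>M. (\<Sum>i<n. functional (\<phi> i) (ev n x (approx n (\<lambda>t. t i) m)))
      \<le> functional (krivine_calculus n \<phi> N') (ev n x (approx n N m))"
    unfolding approx_def using holder_interp by blast
qed

lemma holder_norm:
  "(\<Sum>i<n. functional (\<phi> i) (x i)) \<le> norm (krivine_calculus n \<phi> N') * norm (K x)"
  using holder functional_le by (rule order_trans)

text \<open>The sublinear functional is chosen such that every linear \<open>\<rho>\<close> below it is positive, has norm
  at most \<open>c\<close> and satisfies \<open>\<Sum>i<n. \<phi> i (x i) \<le> \<rho> (K x)\<close>; such a \<open>\<rho>\<close> dominates the calculus of \<open>\<phi>\<close>.\<close>

lemma norm_krivine_dual_le:
  fixes \<phi> :: "nat \<Rightarrow> 'x::banach_lattice dual"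
  assumes le: "\<And>x. (\<Sum>i<n. functional (\<phi> i) (x i)) \<le> c * norm (K x)" and c: "0 \<le> c"
  shows "norm (krivine_calculus n \<phi> N') \<le> c"
proof -
  define \<Phi> where "\<Phi> x = (\<Sum>i<n. functional (\<phi> i) (x i))" for x
  have \<Phi>_add: "\<Phi> (\<lambda>i. x i + y i) = \<Phi> x + \<Phi> y" for x y
    by (simp add: \<Phi>_def blinfun.add_right sum.distrib)
  have \<Phi>_scale: "\<Phi> (\<lambda>i. r *\<^sub>R x i) = r * \<Phi> x" for r x
    by (simp add: \<Phi>_def blinfun.scaleR_right sum_distrib_left)
  have pprt_mono': "norm (pprt a) \<le> norm (pprt b)" if "a \<le> b" for a b :: 'x
    using that by (intro norm_mono_pos pprt_mono) simp_all
  \<comment> \<open>Two choices of \<open>x\<close> and \<open>u\<close> show the purpose. For a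
    linear \<open>\<rho>\<close> below \<open>P\<close>, taking \<open>x = 0\<close> gives
    \<open>\<rho> u \<le> c * norm (pprt u)\<close>, hence positivity and the norm bound; taking
    \<open>u = - K x\<close> removes the positive part and gives
    \<open>\<Phi> x \<le> \<rho> (K x)\<close>.\<close>
  define P where "P u = (INF x. c * norm (pprt (u + K x)) - \<Phi> x)" for u
  \<comment> \<open>The infimum is finite: \<open>le\<close> bounds \<open>\<Phi> x\<close> by
    \<open>c * norm (K x)\<close>, and removing \<open>u\<close> from \<open>u + K x\<close> costs
    at most \<open>norm u\<close>, so \<open>- (c * norm u)\<close> is a lower bound.\<close>
  have lower: "P u \<le> c * norm (pprt (u + K x)) - \<Phi> x" for u x
    unfolding P_def
  proof (rule cINF_lower[OF bdd_belowI2])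
    fix x
    have "K x \<le> pprt (u + K x) + \<bar>u\<bar>"
    proof -
      have "(u + K x) + (- u) \<le> pprt (u + K x) + \<bar>u\<bar>"
        by (intro add_mono abs_ge_minus_self) (simp add: pprt_def)
      thus ?thesis by simp
    qed
    from norm_mono_pos[OF K_nonneg this]
    have "norm (K x) \<le> norm (pprt (u + K x)) + norm u"
      using norm_triangle_ineq[of "pprt (u + K x)" "\<bar>u\<bar>"] by (simp add: norm_abs_lattice)
    from mult_left_mono[OF this c] le[of x]
    show "- (c * norm u) \<le> c * norm (pprt (u + K x)) - \<Phi> x"
      by (simp add: \<Phi>_def distrib_left)
  qed simp
  have greatest: "r \<le> P u" if "\<And>x. r \<le> c * norm (pprt (u + K x)) - \<Phi> x" for r u
    unfolding P_def using that by (intro cINF_greatest) simp_all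
  have "sublinear P"
    unfolding sublinear_def
  proof (intro conjI allI impI)
    fix u v
    have "P (u + v) - P u \<le> P v"
    proof (rule greatest)
      fix y
      have "P (u + v) - (c * norm (pprt (v + K y)) - \<Phi> y) \<le> P u"
      proof (rule greatest)
        fix x
        have "u + v + K (\<lambda>i. x i + y i) \<le> (u + K x) + (v + K y)"
          using add_left_mono[OF K_add[of x y], of "u + v"] by (simp add: add_ac)
        also have "\<dots> \<le> pprt (u + K x) + pprt (v + K y)"
          by (intro add_mono) (simp_all add: pprt_def)
        finally have "norm (pprt (u + v + K (\<lambda>i. x i + y i))) \<le> norm (pprt (pprt (u + K x) + pprt (v + K y)))"
          by (rule pprt_mono')
        also have "\<dots> \<le> norm (pprt (u + K x)) + norm (pprt (v + K y))"
          by (simp add: norm_triangle_ineq add_nonneg_nonneg)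
        finally have "c * norm (pprt (u + v + K (\<lambda>i. x i + y i)))
            \<le> c * (norm (pprt (u + K x)) + norm (pprt (v + K y)))"
          using c by (rule mult_left_mono)
        with lower[of "u + v" "\<lambda>i. x i + y i"]
        show "P (u + v) - (c * norm (pprt (v + K y)) - \<Phi> y) \<le> c * norm (pprt (u + K x)) - \<Phi> x"
          by (simp add: \<Phi>_add distrib_left)
      qed
      thus "P (u + v) - P u \<le> c * norm (pprt (v + K y)) - \<Phi> y" by linarith
    qed
    thus "P (u + v) \<le> P u + P v" by linarith
  next
    fix r :: real and u :: 'x assume r: "0 < r"
    have "P (r *\<^sub>R u) / r \<le> P u"
    proof (rule greatest)
      fix x
      have "r *\<^sub>R u + K (\<lambda>i. r *\<^sub>R x i) \<le> r *\<^sub>R (u + K x)"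
        using r by (simp add: scaleR_right_distrib K_scale)
      also have "\<dots> \<le> r *\<^sub>R pprt (u + K x)"
        using r by (intro scaleR_left_mono) (simp_all add: pprt_def)
      finally have "norm (pprt (r *\<^sub>R u + K (\<lambda>i. r *\<^sub>R x i))) \<le> norm (pprt (r *\<^sub>R pprt (u + K x)))"
        by (rule pprt_mono')
      also have "\<dots> = r * norm (pprt (u + K x))"
        using r by (simp add: scaleR_nonneg_nonneg)
      finally have "c * norm (pprt (r *\<^sub>R u + K (\<lambda>i. r *\<^sub>R x i))) \<le> c * (r * norm (pprt (u + K x)))"
        using c by (rule mult_left_mono)
      with lower[of "r *\<^sub>R u" "\<lambda>i. r *\<^sub>R x i"]
      have "P (r *\<^sub>R u) \<le> (c * norm (pprt (u + K x)) - \<Phi> x) * r"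
        by (simp add: \<Phi>_scale algebra_simps)
      thus "P (r *\<^sub>R u) / r \<le> c * norm (pprt (u + K x)) - \<Phi> x"
        using r by (simp only: pos_divide_le_eq)
    qed
    thus "P (r *\<^sub>R u) \<le> r * P u" using r by (simp add: pos_divide_le_eq mult.commute)
  qed
  \<comment> \<open>The point \<open>0\<close> is arbitrary: any linear functional below
    \<open>P\<close> will do.\<close>
  from hahn_banach[OF this, of 0] obtain \<rho> where \<rho>: "linear \<rho>" "\<And>u. \<rho> u \<le> P u" by blast
  have "K (\<lambda>_. 0) \<le> 0" using K_ray[of 0 "\<lambda>_. 0"] by simp
  have \<rho>_le: "\<rho> u \<le> c * norm (pprt u)" for u
  proof -
    have "\<rho> u \<le> c * norm (pprt (u + K (\<lambda>_. 0)))"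
      using \<rho>(2)[of u] lower[of u "\<lambda>_. 0"] by (simp add: \<Phi>_def blinfun.zero_right)
    also have "\<dots> \<le> c * norm (pprt u)"
      using c add_left_mono[OF \<open>K (\<lambda>_. 0) \<le> 0\<close>, of u] by (intro mult_left_mono pprt_mono') simp_all
    finally show ?thesis .
  qed
  have \<rho>_norm: "\<rho> u \<le> c * norm u" for u
  proof -
    have "norm (pprt u) \<le> norm \<bar>u\<bar>"
      by (intro norm_mono_pos) (simp_all add: pprt_def abs_ge_self)
    hence "c * norm (pprt u) \<le> c * norm u" using c by (simp add: norm_abs_lattice mult_left_mono)
    with \<rho>_le[of u] show ?thesis by linarith
  qed
  have \<rho>_nonneg: "0 \<le> \<rho> u" if "0 \<le> u" for u
    using \<rho>_le[of "- u"] that by (simp add: linear_neg[OF \<rho>(1)])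
  have \<Phi>_le: "\<Phi> x \<le> \<rho> (K x)" for x
    using \<rho>(2)[of "- K x"] lower[of "- K x" x] by (simp add: linear_neg[OF \<rho>(1)])
  define R where "R = Dual (Blinfun \<rho>)"
  have R: "functional R u = \<rho> u" for u
    unfolding R_def
    by (simp add: Dual_inverse bounded_linear_Blinfun_apply bounded_linear_of_le(1)[OF \<rho>(1) \<rho>_norm])
  have "norm R \<le> c"
    unfolding norm_dual.rep_eq
    by (rule norm_blinfun_bound) (use c bounded_linear_of_le(2)[OF \<rho>(1) \<rho>_norm] in \<open>simp_all add: R\<close>)
  interpret swap: norm_pair n N' N by (rule swap)
  \<comment> \<open>By the supremum formula in the dual lattice, \<open>R\<close> has to dominate
    each form with \<open>N a \<le> 1\<close> on the positive cone. Testing \<open>\<Phi>_le\<close>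
    on the tuple \<open>a i *\<^sub>R u\<close> reduces this to \<open>K_ray\<close> and the
    positivity of \<open>\<rho>\<close>.\<close>
  have "krivine_calculus n \<phi> N' \<le> R"
  proof (rule swap.K_least)
    fix a assume a: "N a \<le> 1"
    have "functional (lin n \<phi> a) u \<le> functional R u" if u: "0 \<le> u" for u
    proof -
      have "functional (lin n \<phi> a) u = \<Phi> (\<lambda>i. a i *\<^sub>R u)"
        by (simp add: functional_lin \<Phi>_def blinfun.scaleR_right)
      also have "\<dots> \<le> \<rho> (K (\<lambda>i. a i *\<^sub>R u))" by (rule \<Phi>_le)
      also have "\<dots> \<le> \<rho> u"
      proof -
        have "K (\<lambda>i. a i *\<^sub>R u) \<le> u"
          using K_ray[OF u, of a] scaleR_right_mono[OF a u] by simp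
        thus ?thesis
          using \<rho>_nonneg[of "u - K (\<lambda>i. a i *\<^sub>R u)"] by (simp add: linear_diff[OF \<rho>(1)])
      qed
      finally show ?thesis by (simp add: R)
    qed
    thus "lin n \<phi> a \<le> R" by (simp add: less_eq_dual.rep_eq)
  qed
  hence "norm (krivine_calculus n \<phi> N') \<le> norm R"
    by (intro norm_mono_pos swap.K_nonneg)
  with \<open>norm R \<le> c\<close> show ?thesis by linarith
qed

text \<open>Hahn-Banach for the seminorm \<open>norm (K v)\<close> on tuples; the domination it
  provides is the hypothesis of \<open>norm_krivine_dual_le\<close> with
  \<open>c = 1\<close>.\<close>

lemma ex_norming_lattice_functionals:
  fixes x :: "nat \<Rightarrow> 'x::banach_lattice"
  shows "\<exists>\<phi>. norm (krivine_calculus n \<phi> N') \<le> 1 \<and> (\<Sum>i<n. functional (\<phi> i) (x i)) = norm (K x)"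
proof -
  have "\<exists>\<phi>. (\<forall>v. (\<Sum>i<n. functional (\<phi> i) (v i)) \<le> norm (K v)) \<and>
      (\<Sum>i<n. functional (\<phi> i) (x i)) = norm (K x)"
  proof (rule hahn_banach_tuple)
    show "norm (K v) = norm (K w)" if "\<And>i. i < n \<Longrightarrow> v i = w i" for v w :: "nat \<Rightarrow> 'x"
      using krivine_calculus_cong[OF that] by simp
    show "norm (K (\<lambda>i. v i + w i)) \<le> norm (K v) + norm (K w)" for v w :: "nat \<Rightarrow> 'x"
      using norm_mono_pos[OF K_nonneg K_add[of v w]] norm_triangle_ineq[of "K v" "K w"]
      by linarith
    show "norm (K (\<lambda>i. c *\<^sub>R v i)) \<le> c * norm (K v)" if "0 < c" for c and v :: "nat \<Rightarrow> 'x"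
      using norm_mono_pos[OF K_nonneg K_scale[of c v]] that by simp
  qed (rule norm_K_single)
  then obtain \<phi> where \<phi>: "\<And>v. (\<Sum>i<n. functional (\<phi> i) (v i)) \<le> norm (K v)"
    "(\<Sum>i<n. functional (\<phi> i) (x i)) = norm (K x)" by blast
  have "norm (krivine_calculus n \<phi> N') \<le> 1"
    by (rule norm_krivine_dual_le) (use \<phi>(1) in simp_all)
  thus ?thesis using \<phi>(2) by blast
qed

section \<open>Duality for tuples in a normed space\<close>

lemma holder_tuple:
  "(\<Sum>i<n. functional (f i) (w i)) \<le> N' (\<lambda>i. norm (f i)) * N (\<lambda>i. norm (w i))"
proof -
  have "(\<Sum>i<n. functional (f i) (w i)) \<le> lin n (\<lambda>i. norm (w i)) (\<lambda>i. norm (f i))"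
    unfolding lin_def real_scaleR_def by (intro sum_mono functional_le)
  thus ?thesis using pairing by (rule order_trans)
qed

text \<open>By \<open>norming'\<close> only the sums of \<open>\<bar>a i\<bar> * norm (f i)\<close>
  with \<open>N a \<le> 1\<close> need a bound. They are nearly attained at the tuple
  \<open>\<bar>a i\<bar> *\<^sub>R w i\<close>, where \<open>w i\<close> is a vector of the unit
  ball that nearly norms \<open>f i\<close>.\<close>

lemma norm_dual_tuple_le:
  fixes f :: "nat \<Rightarrow> 'e::real_normed_vector dual"
  assumes le: "\<And>w. (\<Sum>i<n. functional (f i) (w i)) \<le> c * N (\<lambda>i. norm (w i))" and c: "0 \<le> c"
  shows "N' (\<lambda>i. norm (f i)) \<le> c"
proof (rule norming'[OF c])
  fix a assume a: "N a \<le> 1"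
  have "(\<Sum>i<n. \<bar>a i\<bar> * norm (f i)) \<le> c"
  proof (rule real_le_of_le_add_mult)
    fix \<delta> :: real assume \<delta>: "0 < \<delta>"
    \<comment> \<open>Otherwise \<open>norm (f i) - \<delta>\<close> would bound \<open>f i\<close>
      on the unit ball and hence its norm; testing \<open>w = 0\<close> shows that this number is
      positive.\<close>
    have "\<exists>w. norm w \<le> 1 \<and> norm (f i) - \<delta> \<le> functional (f i) w" for i
    proof (rule ccontr)
      assume "\<not> ?thesis"
      hence *: "functional (f i) w < norm (f i) - \<delta>" if "norm w \<le> 1" for w using that by force
      have pos: "0 < norm (f i) - \<delta>" using *[of 0] by (simp add: blinfun.zero_right)
      have "functional (f i) w \<le> (norm (f i) - \<delta>) * norm w" for w
      proof (cases "w = 0")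
        case False
        have "functional (f i) (inverse (norm w) *\<^sub>R w) < norm (f i) - \<delta>"
          using False by (intro *) simp
        thus ?thesis using False by (simp add: blinfun.scaleR_right field_simps)
      qed (simp add: blinfun.zero_right)
      from bounded_linear_of_le(2)[OF bounded_linear.linear[OF blinfun.bounded_linear_right] this]
      have "norm (f i) \<le> norm (f i) - \<delta>"
        unfolding norm_dual.rep_eq[of "f i"] using pos
        by (intro norm_blinfun_bound) (simp_all add: norm_dual.rep_eq)
      thus False using \<delta> by simp
    qed
    then obtain w where w: "\<And>i. norm (w i) \<le> 1" "\<And>i. norm (f i) - \<delta> \<le> functional (f i) (w i)"
      by metis
    have "(\<Sum>i<n. \<bar>a i\<bar> * norm (f i)) - \<delta> * (\<Sum>i<n. \<bar>a i\<bar>) = (\<Sum>i<n. \<bar>a i\<bar> * (norm (f i) - \<delta>))"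
      by (simp add: right_diff_distrib sum_subtractf sum_distrib_left mult.commute)
    also have "\<dots> \<le> (\<Sum>i<n. functional (f i) (\<bar>a i\<bar> *\<^sub>R w i))"
      by (intro sum_mono) (simp add: blinfun.scaleR_right mult_left_mono w(2))
    also have "\<dots> \<le> c * N (\<lambda>i. norm (\<bar>a i\<bar> *\<^sub>R w i))" by (rule le)
    also have "\<dots> \<le> c * 1"
    proof (rule mult_left_mono[OF _ c])
      have "N (\<lambda>i. norm (\<bar>a i\<bar> *\<^sub>R w i)) \<le> N a"
        using w(1) by (intro seminorm_mono[OF N]) (simp add: abs_mult mult_left_le)
      thus "N (\<lambda>i. norm (\<bar>a i\<bar> *\<^sub>R w i)) \<le> 1" using a by linarith
    qed
    finally show "(\<Sum>i<n. \<bar>a i\<bar> * norm (f i)) \<le> c + \<delta> * (\<Sum>i<n. \<bar>a i\<bar>)" by simp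
  qed
  moreover have "lin n a (\<lambda>i. norm (f i)) \<le> (\<Sum>i<n. \<bar>a i\<bar> * norm (f i))"
    unfolding lin_def by (intro sum_mono) (simp add: mult.commute mult_right_mono)
  ultimately show "lin n a (\<lambda>i. norm (f i)) \<le> c" by linarith
qed

end

text \<open>Stated for a single seminorm since the proof of \<open>norm_pair_kothe\<close> uses it,
  with real entries, to recover \<open>N\<close> from \<open>N'\<close>.\<close>

lemma ex_norming_functionals:
  fixes w :: "nat \<Rightarrow> 'e::real_normed_vector"
  assumes N: "lattice_seminorm n N"
  shows "\<exists>f. (\<forall>v. (\<Sum>i<n. functional (f i) (v i)) \<le> N (\<lambda>i. norm (v i))) \<and>
    (\<Sum>i<n. functional (f i) (w i)) = N (\<lambda>i. norm (w i))"
proof (rule hahn_banach_tuple)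
  show "N (\<lambda>i. norm (v i)) = N (\<lambda>i. norm (v' i))" if "\<And>i. i < n \<Longrightarrow> v i = v' i" for v v' :: "nat \<Rightarrow> 'e"
    by (rule seminorm_cong[OF N]) (simp add: that)
  show "N (\<lambda>i. norm (v i + v' i)) \<le> N (\<lambda>i. norm (v i)) + N (\<lambda>i. norm (v' i))" for v v' :: "nat \<Rightarrow> 'e"
  proof -
    have "N (\<lambda>i. norm (v i + v' i)) \<le> N (\<lambda>i. norm (v i) + norm (v' i))"
      by (rule seminorm_mono[OF N]) (simp add: norm_triangle_ineq)
    thus ?thesis using seminorm_add[OF N] by (rule order_trans)
  qed
  show "N (\<lambda>i. norm (c *\<^sub>R v i)) \<le> c * N (\<lambda>i. norm (v i))" if "0 < c" for c and v :: "nat \<Rightarrow> 'e"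
    using seminorm_scale[OF N, of c "\<lambda>i. norm (v i)"] that by simp
  show "N (\<lambda>j. norm (if j = i then y else 0)) \<le> N (\<lambda>j. if j = i then 1 else 0) * norm y" for i and y :: 'e
  proof -
    have "N (\<lambda>j. norm (if j = i then y else 0)) = N (\<lambda>j. norm y * (if j = i then 1 else 0))"
      by (rule seminorm_cong[OF N]) simp
    thus ?thesis using seminorm_scale[OF N, of "norm y"] by (simp add: mult.commute)
  qed
qed

section \<open>Sequence lattices and their Koethe duals\<close>

lemma abs_mult_eq_mult_sgn: "\<bar>a * b\<bar> = b * (\<bar>a\<bar> * sgn b)" for a b :: real
  unfolding abs_mult abs_sgn[of b] by simp

context
  fixes Y :: seq_space
  assumes Y: "banach_seq_lattice Y"
begin

lemma seqs_add: "f \<in> seqs Y \<Longrightarrow> g \<in> seqs Y \<Longrightarrow> (\<lambda>k. f k + g k) \<in> seqs Y"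
  and seqs_mult: "f \<in> seqs Y \<Longrightarrow> (\<lambda>k. c * f k) \<in> seqs Y"
  and seqs_unit: "(\<lambda>k. if k = i then 1 else 0) \<in> seqs Y"
  and seq_norm_eq_0: "f \<in> seqs Y \<Longrightarrow> seq_norm Y f = 0 \<longleftrightarrow> f = (\<lambda>k. 0)"
  and seq_norm_nonneg: "f \<in> seqs Y \<Longrightarrow> 0 \<le> seq_norm Y f"
  and seq_norm_mult: "f \<in> seqs Y \<Longrightarrow> seq_norm Y (\<lambda>k. c * f k) = \<bar>c\<bar> * seq_norm Y f"
  and seq_norm_add: "f \<in> seqs Y \<Longrightarrow> g \<in> seqs Y \<Longrightarrow>
    seq_norm Y (\<lambda>k. f k + g k) \<le> seq_norm Y f + seq_norm Y g"
  and seq_norm_mono: "g \<in> seqs Y \<Longrightarrow> (\<And>k. \<bar>f k\<bar> \<le> \<bar>g k\<bar>) \<Longrightarrow> seq_norm Y f \<le> seq_norm Y g"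
  using Y unfolding banach_seq_lattice_def by blast+

lemma zero_mem_seqs: "(\<lambda>k. 0) \<in> seqs Y"
  using seqs_mult[OF seqs_unit, of 0] by simp

lemma trunc_mem_seqs: "trunc n t \<in> seqs Y"
proof (induction n)
  case 0
  show ?case by (simp add: trunc_def zero_mem_seqs)
next
  case (Suc n)
  have "trunc (Suc n) t = (\<lambda>k. trunc n t k + t n * (if k = n then 1 else 0))"
    by (auto simp: trunc_def less_Suc_eq)
  thus ?case using Suc by (simp only: seqs_add seqs_mult seqs_unit)
qed

lemma lattice_seminorm_seq_norm: "lattice_seminorm n (\<lambda>t. seq_norm Y (trunc n t))"
  unfolding lattice_seminorm_def
proof (intro conjI allI impI)
  fix s t :: "nat \<Rightarrow> real" and c :: real
  have "trunc n (\<lambda>i. s i + t i) = (\<lambda>k. trunc n s k + trunc n t k)" by (auto simp: trunc_def)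
  thus "seq_norm Y (trunc n (\<lambda>i. s i + t i)) \<le> seq_norm Y (trunc n s) + seq_norm Y (trunc n t)"
    by (simp add: seq_norm_add trunc_mem_seqs)
  have "trunc n (\<lambda>i. c * t i) = (\<lambda>k. c * trunc n t k)" by (auto simp: trunc_def)
  thus "seq_norm Y (trunc n (\<lambda>i. c * t i)) = \<bar>c\<bar> * seq_norm Y (trunc n t)"
    by (simp add: seq_norm_mult trunc_mem_seqs)
  show "seq_norm Y (trunc n s) \<le> seq_norm Y (trunc n t)" if "\<forall>i<n. \<bar>s i\<bar> \<le> \<bar>t i\<bar>"
    using that by (intro seq_norm_mono trunc_mem_seqs) (simp add: trunc_def)
qed

lemma kothe_norm_trunc:
  "seq_norm (kothe_dual Y) (trunc n b) =
    (SUP a\<in>{a \<in> seqs Y. seq_norm Y a \<le> 1}. \<Sum>k<n. \<bar>a k * b k\<bar>)"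
proof -
  have "(\<Sum>k. \<bar>a k * trunc n b k\<bar>) = (\<Sum>k<n. \<bar>a k * b k\<bar>)" for a
    by (subst suminf_finite[of "{..<n}"]) (simp_all add: trunc_def)
  thus ?thesis by (simp add: kothe_dual_def)
qed

text \<open>Truncating \<open>a\<close> does not increase its norm and leaves the finite sum
  unchanged, so the test may be phrased with the truncated norm alone.\<close>

lemma kothe_norm_least:
  assumes "\<And>a. seq_norm Y (trunc n a) \<le> 1 \<Longrightarrow> (\<Sum>k<n. \<bar>a k * b k\<bar>) \<le> c"
  shows "seq_norm (kothe_dual Y) (trunc n b) \<le> c"
  unfolding kothe_norm_trunc
proof (rule cSUP_least)
  have "(\<lambda>k. 0) \<in> {a \<in> seqs Y. seq_norm Y a \<le> 1}"
    using seq_norm_eq_0[OF zero_mem_seqs] by (simp add: zero_mem_seqs)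
  thus "{a \<in> seqs Y. seq_norm Y a \<le> 1} \<noteq> {}" by blast
  fix a assume a: "a \<in> {a \<in> seqs Y. seq_norm Y a \<le> 1}"
  hence "seq_norm Y (trunc n a) \<le> seq_norm Y a" by (intro seq_norm_mono) (auto simp: trunc_def)
  thus "(\<Sum>k<n. \<bar>a k * b k\<bar>) \<le> c" using a by (intro assms) simp
qed

text \<open>The supremum is meaningful because on the unit ball each coordinate is bounded by the
  reciprocal of the norm of the corresponding unit sequence.\<close>

lemma kothe_norm_upper:
  assumes a: "a \<in> seqs Y" "seq_norm Y a \<le> 1"
  shows "(\<Sum>k<n. \<bar>a k * b k\<bar>) \<le> seq_norm (kothe_dual Y) (trunc n b)"
  unfolding kothe_norm_trunc
proof (rule cSUP_upper)
  let ?e = "\<lambda>i k. if k = i then 1 else 0 :: real"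
  have pos: "0 < seq_norm Y (?e i)" for i
  proof -
    have "?e i \<noteq> (\<lambda>k. 0)" by (metis zero_neq_one)
    thus ?thesis using seq_norm_nonneg[OF seqs_unit] seq_norm_eq_0[OF seqs_unit]
      by (simp add: less_le)
  qed
  have le: "\<bar>a k\<bar> \<le> 1 / seq_norm Y (?e k)" if "a \<in> seqs Y" "seq_norm Y a \<le> 1" for a k
  proof -
    have "\<bar>a k\<bar> * seq_norm Y (?e k) = seq_norm Y (\<lambda>j. a k * ?e k j)"
      by (simp add: seq_norm_mult seqs_unit)
    also have "\<dots> \<le> seq_norm Y a" by (rule seq_norm_mono[OF that(1)]) simp
    finally show ?thesis using that(2) pos[of k] by (simp add: pos_le_divide_eq)
  qed
  show "bdd_above ((\<lambda>a. \<Sum>k<n. \<bar>a k * b k\<bar>) ` {a \<in> seqs Y. seq_norm Y a \<le> 1})"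
  proof (rule bdd_aboveI2)
    fix a assume "a \<in> {a \<in> seqs Y. seq_norm Y a \<le> 1}"
    thus "(\<Sum>k<n. \<bar>a k * b k\<bar>) \<le> (\<Sum>k<n. 1 / seq_norm Y (?e k) * \<bar>b k\<bar>)"
      unfolding abs_mult by (intro sum_mono mult_right_mono le) simp_all
  qed
qed (use a in simp)

lemma kothe_pairing:
  "(\<Sum>k<n. \<bar>a k * b k\<bar>) \<le> seq_norm (kothe_dual Y) (trunc n b) * seq_norm Y (trunc n a)"
proof (cases "seq_norm Y (trunc n a) = 0")
  case True
  hence *: "trunc n a = (\<lambda>k. 0)" using seq_norm_eq_0[OF trunc_mem_seqs] by simp
  have "a k = 0" if "k < n" for k
    using fun_cong[OF *, of k] that by (simp add: trunc_def)
  thus ?thesis using True by simp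
next
  case False
  define r where "r = seq_norm Y (trunc n a)"
  have r: "0 < r" using False seq_norm_nonneg[OF trunc_mem_seqs] by (simp add: r_def less_le)
  have "(\<Sum>k<n. \<bar>inverse r * trunc n a k * b k\<bar>) \<le> seq_norm (kothe_dual Y) (trunc n b)"
    using r by (intro kothe_norm_upper seqs_mult trunc_mem_seqs)
      (simp add: seq_norm_mult trunc_mem_seqs flip: r_def)
  also have "(\<Sum>k<n. \<bar>inverse r * trunc n a k * b k\<bar>) = inverse r * (\<Sum>k<n. \<bar>a k * b k\<bar>)"
    using r by (simp add: sum_distrib_left abs_mult trunc_def mult.assoc)
  finally show ?thesis using r by (simp add: field_simps flip: r_def)
qed

lemma kothe_norm_nonneg: "0 \<le> seq_norm (kothe_dual Y) (trunc n b)"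
  using kothe_norm_upper[OF zero_mem_seqs, where n = n and b = b] seq_norm_eq_0[OF zero_mem_seqs] by simp

lemma kothe_sum_le:
  assumes "seq_norm Y (trunc n a) \<le> 1"
  shows "(\<Sum>k<n. \<bar>a k * b k\<bar>) \<le> seq_norm (kothe_dual Y) (trunc n b)"
  using kothe_pairing[where n = n and a = a and b = b] mult_left_mono[OF assms kothe_norm_nonneg[of n b]] by simp

lemma lattice_seminorm_kothe_norm: "lattice_seminorm n (\<lambda>b. seq_norm (kothe_dual Y) (trunc n b))"
  unfolding lattice_seminorm_def
proof (intro conjI allI impI)
  let ?N = "\<lambda>b. seq_norm (kothe_dual Y) (trunc n b)"
  fix s t :: "nat \<Rightarrow> real" and c :: real
  show "?N (\<lambda>i. s i + t i) \<le> ?N s + ?N t"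
  proof (rule kothe_norm_least)
    fix a assume a: "seq_norm Y (trunc n a) \<le> 1"
    have "(\<Sum>k<n. \<bar>a k * (s k + t k)\<bar>) \<le> (\<Sum>k<n. \<bar>a k * s k\<bar>) + (\<Sum>k<n. \<bar>a k * t k\<bar>)"
      unfolding sum.distrib[symmetric] by (intro sum_mono) (simp add: distrib_left abs_triangle_ineq)
    also have "\<dots> \<le> ?N s + ?N t" by (intro add_mono kothe_sum_le a)
    finally show "(\<Sum>k<n. \<bar>a k * (s k + t k)\<bar>) \<le> ?N s + ?N t" .
  qed
  have le: "?N (\<lambda>i. c * t i) \<le> \<bar>c\<bar> * ?N t" for c t
  proof (rule kothe_norm_least)
    fix a assume a: "seq_norm Y (trunc n a) \<le> 1"
    have "(\<Sum>k<n. \<bar>a k * (c * t k)\<bar>) = \<bar>c\<bar> * (\<Sum>k<n. \<bar>a k * t k\<bar>)"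
      by (simp add: sum_distrib_left abs_mult mult_ac)
    also have "\<dots> \<le> \<bar>c\<bar> * ?N t" by (intro mult_left_mono kothe_sum_le a) simp
    finally show "(\<Sum>k<n. \<bar>a k * (c * t k)\<bar>) \<le> \<bar>c\<bar> * ?N t" .
  qed
  show "?N (\<lambda>i. c * t i) = \<bar>c\<bar> * ?N t"
  proof (cases "c = 0")
    case True
    thus ?thesis using le[of 0 t] kothe_norm_nonneg[of n "\<lambda>i. 0"] by simp
  next
    case False
    have "?N (\<lambda>i. inverse c * (c * t i)) \<le> \<bar>inverse c\<bar> * ?N (\<lambda>i. c * t i)" by (rule le)
    hence "\<bar>c\<bar> * ?N t \<le> ?N (\<lambda>i. c * t i)"
      using False by (simp add: field_simps flip: mult.assoc)
    with le[of c t] show ?thesis by simp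
  qed
  show "?N s \<le> ?N t" if "\<forall>i<n. \<bar>s i\<bar> \<le> \<bar>t i\<bar>"
  proof (rule kothe_norm_least)
    fix a assume a: "seq_norm Y (trunc n a) \<le> 1"
    have "(\<Sum>k<n. \<bar>a k * s k\<bar>) \<le> (\<Sum>k<n. \<bar>a k * t k\<bar>)"
      using that by (intro sum_mono) (simp add: abs_mult mult_left_mono)
    also have "\<dots> \<le> ?N t" by (rule kothe_sum_le[OF a])
    finally show "(\<Sum>k<n. \<bar>a k * s k\<bar>) \<le> ?N t" .
  qed
qed

text \<open>That \<open>N'\<close> is normed by the ball of \<open>N\<close> is the definition of
  the Koethe norm up to signs. The converse is finite-dimensional Hahn-Banach.\<close>

lemma norm_pair_kothe:
  "norm_pair n (\<lambda>t. seq_norm Y (trunc n t)) (\<lambda>b. seq_norm (kothe_dual Y) (trunc n b))"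
proof
  let ?N = "\<lambda>t. seq_norm Y (trunc n t)" and ?N' = "\<lambda>b. seq_norm (kothe_dual Y) (trunc n b)"
  note seminorm = lattice_seminorm_seq_norm[of n]
  show "lattice_seminorm n ?N" "lattice_seminorm n ?N'"
    by (rule lattice_seminorm_seq_norm lattice_seminorm_kothe_norm)+
  show "lin n t b \<le> ?N' b * ?N t" for b t :: "nat \<Rightarrow> real"
  proof -
    have "lin n t b \<le> (\<Sum>k<n. \<bar>t k * b k\<bar>)"
      unfolding lin_def by (intro sum_mono) (simp add: mult.commute[of "b _"])
    thus ?thesis using kothe_pairing by (rule order_trans)
  qed
  show norming': "?N' b \<le> c" if le: "\<And>t. ?N t \<le> 1 \<Longrightarrow> lin n t b \<le> c" for b c
  proof (rule kothe_norm_least)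
    fix a assume a: "?N a \<le> 1"
    \<comment> \<open>Adapting the signs of \<open>a\<close> to those of \<open>b\<close> turns the
      sum of absolute values into a linear form without leaving the unit ball.\<close>
    have "?N (\<lambda>k. \<bar>a k\<bar> * sgn (b k)) \<le> ?N a"
      by (rule seminorm_mono[OF seminorm]) (simp add: abs_mult abs_sgn_eq)
    hence "lin n (\<lambda>k. \<bar>a k\<bar> * sgn (b k)) b \<le> c" using a by (intro le) linarith
    thus "(\<Sum>k<n. \<bar>a k * b k\<bar>) \<le> c" by (simp add: lin_def abs_mult_eq_mult_sgn)
  qed
  show "?N t \<le> c" if le: "\<And>b. ?N' b \<le> 1 \<Longrightarrow> lin n t b \<le> c" for t c
  proof -
    obtain f where f: "\<And>v. (\<Sum>i<n. functional (f i) (v i)) \<le> ?N (\<lambda>i. norm (v i))"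
      "(\<Sum>i<n. functional (f i) (t i)) = ?N (\<lambda>i. norm (t i))"
      using ex_norming_functionals[OF seminorm, of t] by blast
    have abs: "?N (\<lambda>i. norm (v i)) = ?N v" for v :: "nat \<Rightarrow> real"
      by (rule seminorm_cong[OF seminorm]) simp
    \<comment> \<open>A functional on the reals is multiplication by its value at \<open>1\<close>,
      so the norming functionals amount to a real tuple \<open>b\<close>.\<close>
    define b where "b i = functional (f i) 1" for i
    have lin_b: "lin n v b = (\<Sum>i<n. functional (f i) (v i))" for v
    proof -
      have "functional (f i) (v i) = v i * b i" for i
        using blinfun.scaleR_right[of "functional (f i)" "v i" 1] by (simp add: b_def)
      thus ?thesis by (simp add: lin_def mult.commute)
    qed
    have "?N' b \<le> 1"
    proof (rule norming')
      show "lin n v b \<le> 1" if "?N v \<le> 1" for v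
        unfolding lin_b using f(1)[of v] that unfolding abs by (rule order_trans)
    qed
    from le[OF this] show ?thesis unfolding lin_b f(2) abs .
  qed
qed

end

section \<open>Transposes and the admissible constants\<close>

lemma linear_transpose_op: "linear (transpose_op T)"
proof (rule linearI)
  show "transpose_op T (\<phi> + \<psi>) = transpose_op T \<phi> + transpose_op T \<psi>" for \<phi> \<psi>
    unfolding transpose_op_def
    by (simp add: functional_inject[symmetric] functional_simps Dual_inverse)
      (rule blinfun_eqI, simp add: blinfun.add_left)
  show "transpose_op T (c *\<^sub>R \<phi>) = c *\<^sub>R transpose_op T \<phi>" for c \<phi>
    unfolding transpose_op_def
    by (simp add: functional_inject[symmetric] functional_simps Dual_inverse)
      (rule blinfun_eqI, simp add: blinfun.scaleR_left)
qed

lemma functional_transpose_op: "functional (transpose_op T \<phi>) w = functional \<phi> (T w)"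
  by (simp add: transpose_op_def Dual_inverse)

text \<open>Convexity bounds the pairing of \<open>\<phi>\<close> with \<open>T w\<close> through
  \<open>holder_norm\<close>, and \<open>norm_dual_tuple_le\<close> turns this into concavity.
  Conversely, the pairing with a norming tuple from \<open>ex_norming_lattice_functionals\<close> is
  bounded by \<open>holder_tuple\<close>.\<close>

lemma convex_consts_eq_concave_consts_transpose:
  fixes T :: "'e::real_normed_vector \<Rightarrow>\<^sub>L 'x::banach_lattice"
  assumes Y: "banach_seq_lattice Y"
  shows "convex_consts Y (blinfun_apply T) = concave_consts (kothe_dual Y) (transpose_op T)"
proof -
  have "(\<forall>w. lattice_tuple_norm Y n (\<lambda>i. T (w i)) \<le> C * tuple_norm Y n w) \<longleftrightarrow>
      (\<forall>\<phi>. tuple_norm (kothe_dual Y) n (\<lambda>i. transpose_op T (\<phi> i)) \<le>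
        C * lattice_tuple_norm (kothe_dual Y) n \<phi>)" if C: "0 < C" for C n
  proof -
    interpret norm_pair n "\<lambda>t. seq_norm Y (trunc n t)" "\<lambda>b. seq_norm (kothe_dual Y) (trunc n b)"
      by (rule norm_pair_kothe[OF Y])
    show ?thesis
      unfolding lattice_tuple_norm_def tuple_norm_def
    proof (intro iffI allI)
      fix \<phi> :: "nat \<Rightarrow> 'x dual"
      assume convex: "\<forall>w. norm (K (\<lambda>i. T (w i))) \<le> C * seq_norm Y (trunc n (\<lambda>i. norm (w i)))"
      let ?r = "norm (krivine_calculus n \<phi> (\<lambda>t. seq_norm (kothe_dual Y) (trunc n t)))"
      show "seq_norm (kothe_dual Y) (trunc n (\<lambda>i. norm (transpose_op T (\<phi> i)))) \<le> C * ?r"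
      proof (rule norm_dual_tuple_le)
        fix w :: "nat \<Rightarrow> 'e"
        have "(\<Sum>i<n. functional (\<phi> i) (T (w i))) \<le> ?r * norm (K (\<lambda>i. T (w i)))"
          by (rule holder_norm)
        also have "\<dots> \<le> ?r * (C * seq_norm Y (trunc n (\<lambda>i. norm (w i))))"
          using convex by (intro mult_left_mono) simp_all
        finally show "(\<Sum>i<n. functional (transpose_op T (\<phi> i)) (w i)) \<le>
            C * ?r * seq_norm Y (trunc n (\<lambda>i. norm (w i)))"
          by (simp add: functional_transpose_op mult_ac)
      qed (use C in simp)
    next
      fix w :: "nat \<Rightarrow> 'e"
      assume concave: "\<forall>\<phi>. seq_norm (kothe_dual Y) (trunc n (\<lambda>i. norm (transpose_op T (\<phi> i)))) \<le>
          C * norm (krivine_calculus n \<phi> (\<lambda>t. seq_norm (kothe_dual Y) (trunc n t)))"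
      let ?r = "seq_norm Y (trunc n (\<lambda>i. norm (w i)))"
      obtain \<phi> where \<phi>: "norm (krivine_calculus n \<phi> (\<lambda>t. seq_norm (kothe_dual Y) (trunc n t))) \<le> 1"
        "(\<Sum>i<n. functional (\<phi> i) (T (w i))) = norm (K (\<lambda>i. T (w i)))"
        using ex_norming_lattice_functionals[of "\<lambda>i. T (w i)"] by blast
      have "norm (K (\<lambda>i. T (w i))) = (\<Sum>i<n. functional (transpose_op T (\<phi> i)) (w i))"
        by (simp add: functional_transpose_op \<phi>(2))
      also have "\<dots> \<le> seq_norm (kothe_dual Y) (trunc n (\<lambda>i. norm (transpose_op T (\<phi> i)))) * ?r"
        by (rule holder_tuple)
      also have "\<dots> \<le> C * ?r"
        using concave[THEN spec, of \<phi>] mult_left_mono[OF \<phi>(1) less_imp_le[OF C]]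
        by (intro mult_right_mono seminorm_nonneg[OF N]) simp
      finally show "norm (K (\<lambda>i. T (w i))) \<le> C * ?r" .
    qed
  qed
  thus ?thesis unfolding convex_consts_def concave_consts_def by blast
qed

text \<open>The two sides exchange roles: \<open>holder_tuple\<close> with
  \<open>norm_krivine_dual_le\<close> gives convexity of the transpose, and a norming tuple
  \<open>f\<close> from \<open>ex_norming_functionals\<close> with \<open>holder_norm\<close> gives
  the converse. All testing tuples lie in \<open>X\<close> and in the dual of \<open>E\<close>, so
  no bidual appears.\<close>

lemma concave_consts_eq_convex_consts_transpose:
  fixes S :: "'x::banach_lattice \<Rightarrow>\<^sub>L 'e::real_normed_vector"
  assumes Y: "banach_seq_lattice Y"
  shows "concave_consts Y (blinfun_apply S) = convex_consts (kothe_dual Y) (transpose_op S)"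
proof -
  have "(\<forall>x. tuple_norm Y n (\<lambda>i. S (x i)) \<le> C * lattice_tuple_norm Y n x) \<longleftrightarrow>
      (\<forall>f. lattice_tuple_norm (kothe_dual Y) n (\<lambda>i. transpose_op S (f i)) \<le>
        C * tuple_norm (kothe_dual Y) n f)" if C: "0 < C" for C n
  proof -
    interpret norm_pair n "\<lambda>t. seq_norm Y (trunc n t)" "\<lambda>b. seq_norm (kothe_dual Y) (trunc n b)"
      by (rule norm_pair_kothe[OF Y])
    show ?thesis
      unfolding lattice_tuple_norm_def tuple_norm_def
    proof (intro iffI allI)
      fix f :: "nat \<Rightarrow> 'e dual"
      assume concave: "\<forall>x. seq_norm Y (trunc n (\<lambda>i. norm (S (x i)))) \<le> C * norm (K x)"
      let ?r = "seq_norm (kothe_dual Y) (trunc n (\<lambda>i. norm (f i)))"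
      have r: "0 \<le> ?r" by (rule seminorm_nonneg[OF N'])
      show "norm (krivine_calculus n (\<lambda>i. transpose_op S (f i))
          (\<lambda>t. seq_norm (kothe_dual Y) (trunc n t))) \<le> C * ?r"
      proof (rule norm_krivine_dual_le)
        fix x :: "nat \<Rightarrow> 'x"
        have "(\<Sum>i<n. functional (f i) (S (x i))) \<le> ?r * seq_norm Y (trunc n (\<lambda>i. norm (S (x i))))"
          by (rule holder_tuple)
        also have "\<dots> \<le> ?r * (C * norm (K x))"
          using concave r by (intro mult_left_mono) simp_all
        finally show "(\<Sum>i<n. functional (transpose_op S (f i)) (x i)) \<le> C * ?r * norm (K x)"
          by (simp add: functional_transpose_op mult_ac)
      qed (use C r in simp)
    next
      fix x :: "nat \<Rightarrow> 'x"
      assume convex: "\<forall>f. norm (krivine_calculus n (\<lambda>i. transpose_op S (f i))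
          (\<lambda>t. seq_norm (kothe_dual Y) (trunc n t))) \<le>
          C * seq_norm (kothe_dual Y) (trunc n (\<lambda>i. norm (f i)))"
      obtain f where f: "\<And>v. (\<Sum>i<n. functional (f i) (v i)) \<le> seq_norm Y (trunc n (\<lambda>i. norm (v i)))"
        "(\<Sum>i<n. functional (f i) (S (x i))) = seq_norm Y (trunc n (\<lambda>i. norm (S (x i))))"
        using ex_norming_functionals[OF N, of "\<lambda>i. S (x i)"] by blast
      have f1: "seq_norm (kothe_dual Y) (trunc n (\<lambda>i. norm (f i))) \<le> 1"
        by (rule norm_dual_tuple_le) (use f(1) in simp_all)
      have "seq_norm Y (trunc n (\<lambda>i. norm (S (x i)))) = (\<Sum>i<n. functional (transpose_op S (f i)) (x i))"
        by (simp add: functional_transpose_op f(2))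
      also have "\<dots> \<le> norm (krivine_calculus n (\<lambda>i. transpose_op S (f i))
          (\<lambda>t. seq_norm (kothe_dual Y) (trunc n t))) * norm (K x)"
        by (rule holder_norm)
      also have "\<dots> \<le> C * norm (K x)"
        using convex[THEN spec, of f] mult_left_mono[OF f1 less_imp_le[OF C]]
        by (intro mult_right_mono) simp_all
      finally show "seq_norm Y (trunc n (\<lambda>i. norm (S (x i)))) \<le> C * norm (K x)" .
    qed
  qed
  thus ?thesis unfolding convex_consts_def concave_consts_def by blast
qed

theorem theorem33:
  fixes Y :: seq_space
    and T :: "'e::banach \<Rightarrow>\<^sub>L 'x::banach_lattice"
    and S :: "'x \<Rightarrow>\<^sub>L 'e"
  assumes "banach_seq_lattice Y"
  shows "((convex_op Y (blinfun_apply T) \<longleftrightarrow> concave_op (kothe_dual Y) (transpose_op T)) \<and>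
          (convex_op Y (blinfun_apply T) \<longrightarrow>
             convexity_const Y (blinfun_apply T) = concavity_const (kothe_dual Y) (transpose_op T))) \<and>
         ((concave_op Y (blinfun_apply S) \<longleftrightarrow> convex_op (kothe_dual Y) (transpose_op S)) \<and>
          (concave_op Y (blinfun_apply S) \<longrightarrow>
             convexity_const (kothe_dual Y) (transpose_op S) = concavity_const Y (blinfun_apply S)))"
  using convex_consts_eq_concave_consts_transpose[OF assms, of T]
    concave_consts_eq_convex_consts_transpose[OF assms, of S]
  by (simp add: convex_op_def concave_op_def convexity_const_def concavity_const_def
      linear_transpose_op bounded_linear.linear[OF blinfun.bounded_linear_right])

end
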